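(* Let $m,n$ be positive integers with $0<m<n$ and $\gcd(m,n)=1$. Let $\mathbb{K}$ be either $\mathbb{Q}$ or an imaginary quadratic field, let $\mathbb{L}$ be a number field with $[\mathbb{L}:\mathbb{K}]=2$, and let $\sigma$ be the non-trivial element of $\mathrm{Gal}(\mathbb{L}/\mathbb{K})$. If $\mathbb{K}=\mathbb{Q}$ let $\tau=1$; otherwise let $\tau$ be an algebraic integer in $\mathbb{K}$ with $\mathbb{L}=\mathbb{K}(\sqrt{\tau})$. Let $\beta,\gamma,\eta$ be algebraic integers in $\mathbb{L}$. Let $g$ be an algebraic number such that $\eta/g$ and $\sigma(\eta)/g$ are algebraic integers (not necessarily in $\mathbb{L}$). For each non-negative integer $r$ let $h_r$ be a non-zero algebraic integer with $h_r/g^r\in\mathbb{K}$ and $|h_r|\le h$, for some fixed positive real $h$. Let $d$ be the largest positive rational integer such that $(\sigma(\eta)-\eta)/(dg)$ is an algebraic integer, and let $\mathcal{C}_n,\mathcal{D}_n$ be positive real numbers such that $$\max\left(1,\frac{\Gamma(1-m/n)\,r!}{\Gamma(r+1-m/n)},\frac{n\Gamma(r+1+m/n)}{m\Gamma(m/n)\,r!}\right)\frac{D_{n,r}}{N_{d,n,r}}<\mathcal{C}_n\left(\frac{\mathcal{D}_n}{\mathcal{N}_{d,n}}\right)^r$$ for all non-negative integers $r$. Put $$\alpha=\frac{\beta(\eta/\sigma(\eta))^{m/n}\pm\sigma(\beta)}{\gamma(\eta/\sigma(\eta))^{m/n}\pm\sigma(\gamma)}$$ (the same sign in numerator and denominator),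 $$E=\left\{\frac{\mathcal{D}_n}{|g|\mathcal{N}_{d,n}}\min\left(|\sqrt{\eta}-\sqrt{\sigma(\eta)}|^2,|\sqrt{\eta}+\sqrt{\sigma(\eta)}|^2\right)\right\}^{-1},$$ $$Q=\frac{\mathcal{D}_n}{|g|\mathcal{N}_{d,n}}\max\left(|\sqrt{\eta}-\sqrt{\sigma(\eta)}|^2,|\sqrt{\eta}+\sqrt{\sigma(\eta)}|^2\right),$$ $\kappa=\frac{\log Q}{\log E}$, and $$c=4h|\sqrt{\tau}|(|\gamma|+|\sigma(\gamma)|)\mathcal{C}_nQ\max\left\{E,\;5h|\sqrt{\tau}|\,|1-(\eta/\sigma(\eta))^{m/n}|\,|\beta-\alpha\gamma|\,\mathcal{C}_nE\right\}^{\kappa}.$$ If $E>1$ and either $0<\eta/\sigma(\eta)<1$ or ($|\eta/\sigma(\eta)|=1$ and $\eta/\sigma(\eta)\ne-1$), then $$|\alpha-p/q|>\frac{1}{c|q|^{\kappa+1}}$$ for all algebraic integers $p,q\in\mathbb{K}$ with $q\neq0$.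
   Context: For positive integers $m<n$ with $\gcd(m,n)=1$ and a non-negative integer $r$, $X_{m,n,r}(x)={}_2F_1(-r,-r-m/n;1-m/n;x)$ (a polynomial of degree $r$, ${}_2F_1$ the Gauss hypergeometric function). $D_{n,r}$ is the smallest positive integer such that $D_{n,r}X_{m,n,r}(x)$ has rational integer coefficients. For a positive integer $d$, $N_{d,n,r}$ is the greatest common divisor of the numerators of the (rational) coefficients of the polynomial $X_{m,n,r}(1-dx)$. For a prime $p$, $v_p(x)$ is the exponent of $p$ in the rational number $x$, and $\mathcal{N}_{d,n}=\prod_{p\mid n}p^{\min(v_p(d),\,v_p(n)+1/(p-1))}$. For a complex number $w=|w|e^{i\varphi}$ with $-\pi<\varphi\le\pi$ ($\varphi=0$ if $w=0$), $w^{m/n}$ (in particular $\sqrt{w}=w^{1/2}$) denotes $(|w|^{1/n})^me^{im\varphi/n}$, with $|w|^{1/n}$ the non-negative real $n$-th root.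
   Formalization: The formal theorem additionally assumes βσ(γ) ≠ γσ(β) (otherwise α = β/γ lies in K and the claim fails with p/q = α), and that g, η and the denominator of α are non-zero. *)

theory Defs
  imports
    "HOL-Algebra.Generated_Fields"
    "HOL-Algebra.Embedded_Algebras"
    "HOL-Algebra.Algebraic_Closure_Type"
    "HOL-Computational_Algebra.Computational_Algebra"
    "HOL-Complex_Analysis.Complex_Analysis"
begin

section \<open>Subfields of the complex numbers\<close>

text \<open>
  All fields are subfields of the complex numbers, because the absolute values and the
  principal roots below refer to an embedding.
\<close>

abbreviation complex_ring :: "complex ring" where
  "complex_ring \<equiv> ring_of_type_algebra"

definition ext_degree :: "complex set \<Rightarrow> complex set \<Rightarrow> nat \<Rightarrow> bool" where
  "ext_degree K L k \<longleftrightarrow> subfield K complex_ring \<and> subfield L complex_ring \<and> K \<subseteq> L \<and>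
     ring.dimension complex_ring k K L"

definition number_field :: "complex set \<Rightarrow> bool" where
  "number_field L \<longleftrightarrow> (\<exists>k. ext_degree \<rat> L k)"

definition imag_quadratic_field :: "complex set \<Rightarrow> bool" where
  "imag_quadratic_field K \<longleftrightarrow> ext_degree \<rat> K 2 \<and> \<not> K \<subseteq> \<real>"

text \<open>
  Elements of the Galois group are represented by functions on all complex numbers; only
  their restriction to \<open>L\<close> matters.
\<close>

definition Gal :: "complex set \<Rightarrow> complex set \<Rightarrow> (complex \<Rightarrow> complex) set" where
  "Gal K L = {\<sigma> \<in> ring_iso (complex_ring\<lparr>carrier := L\<rparr>) (complex_ring\<lparr>carrier := L\<rparr>).
                \<forall>x\<in>K. \<sigma> x = x}"


section \<open>The hypergeometric polynomials and their arithmetic invariants\<close>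

definition X_poly :: "nat \<Rightarrow> nat \<Rightarrow> nat \<Rightarrow> rat poly" where
  "X_poly m n r = truncate_fps (Suc r)
     (fps_hypergeo [- of_nat r, - of_nat r - of_nat m / of_nat n] [1 - of_nat m / of_nat n] 1)"

text \<open>The truncation loses nothing: the Gauss series terminates after the term of degree \<open>r\<close>.\<close>

lemma fps_of_poly_X_poly:
  "fps_of_poly (X_poly m n r) =
     fps_hypergeo [- of_nat r, - of_nat r - of_nat m / of_nat n] [1 - of_nat m / of_nat n] 1"
  by (rule fps_ext) (auto simp: X_poly_def coeff_truncate_fps pochhammer_of_nat_eq_0_iff)

definition D_den :: "nat \<Rightarrow> nat \<Rightarrow> nat \<Rightarrow> nat" where
  "D_den m n r = (LEAST D. D > 0 \<and> (\<forall>i. of_nat D * coeff (X_poly m n r) i \<in> \<int>))"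

text \<open>
  \<open>quotient_of\<close> yields the reduced fraction with positive denominator, so the first
  component is the numerator.
\<close>

definition N_num :: "nat \<Rightarrow> nat \<Rightarrow> nat \<Rightarrow> nat \<Rightarrow> int" where
  "N_num m d n r =
     (let P = pcompose (X_poly m n r) [:1, - of_nat d:]
      in Gcd (range (\<lambda>i. fst (quotient_of (coeff P i)))))"

definition calN :: "nat \<Rightarrow> nat \<Rightarrow> real" where
  "calN d n = (\<Prod>p\<in>prime_factors n.
     real p powr min (real (multiplicity p d)) (real (multiplicity p n) + 1 / (real p - 1)))"


section \<open>Principal roots\<close>

text \<open>
  The complex \<open>powr\<close> and \<open>csqrt\<close> use the branch given by an argument in the
  interval from \<open>-pi\<close> (exclusive) to \<open>pi\<close> (inclusive), with \<open>Arg 0 = 0\<close>.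
\<close>

lemma powr_principal:
  fixes w :: complex and m n :: nat
  assumes "m > 0" "n > 0"
  shows "w powr (of_nat m / of_nat n) =
           of_real (root n (norm w) ^ m) * cis (real m * Arg w / real n)"
proof (cases "w = 0")
  case False
  have "w powr (of_nat m / of_nat n) = exp (of_real (real m / real n) * Ln w)"
    using False by (simp add: powr_def)
  also have "Ln w = of_real (ln (norm w)) + \<i> * of_real (Arg w)"
    using False by (simp add: complex_eq_iff Arg_eq_Im_Ln)
  also have "exp (of_real (real m / real n) * (of_real (ln (norm w)) + \<i> * of_real (Arg w))) =
      of_real (exp (real m / real n * ln (norm w))) * cis (real m * Arg w / real n)"
    by (simp add: cis_conv_exp exp_add exp_of_real [symmetric] algebra_simps)
  also have "exp (real m / real n * ln (norm w)) = root n (norm w) ^ m"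
    using False assms
    by (simp add: root_powr_inverse powr_def exp_of_nat_mult [symmetric] field_simps)
  finally show ?thesis .
qed (use assms in auto)

lemma csqrt_principal: "csqrt w = of_real (sqrt (norm w)) * cis (Arg w / 2)"
proof (cases "w = 0")
  case False
  have "csqrt w = w powr (of_nat 1 / of_nat 2)"
    using False by (simp add: csqrt_exp_Ln powr_def)
  also have "\<dots> = of_real (sqrt (norm w)) * cis (Arg w / 2)"
    by (subst powr_principal) (simp_all add: sqrt_def)
  finally show ?thesis .
qed auto


section \<open>The degenerate quotient\<close>

text \<open>
  If \<open>\<beta> * \<sigma> \<gamma> = \<gamma> * \<sigma> \<beta>\<close>, then \<open>\<beta> / \<gamma>\<close> is fixed by \<open>\<sigma>\<close>, and the quotient below does not
  depend on the root \<open>w\<close>: it is the element \<open>\<beta> / \<gamma>\<close> of the base field, which is itself a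
  quotient of algebraic integers of that field. A lower bound for the distance to all such
  quotients therefore needs \<open>\<beta> * \<sigma> \<gamma> \<noteq> \<gamma> * \<sigma> \<beta>\<close>.
\<close>

lemma degenerate_quotient:
  fixes \<beta> \<gamma> \<beta>' \<gamma>' w s :: complex
  assumes "\<beta> * \<gamma>' = \<gamma> * \<beta>'" "\<gamma> \<noteq> 0" "\<gamma> * w + s * \<gamma>' \<noteq> 0"
  shows "(\<beta> * w + s * \<beta>') / (\<gamma> * w + s * \<gamma>') = \<beta> / \<gamma>"
proof -
  have "\<gamma> * (\<beta> * w + s * \<beta>') = \<beta> * (\<gamma> * w) + s * (\<gamma> * \<beta>')"
    by (simp add: algebra_simps)
  also have "\<dots> = \<beta> * (\<gamma> * w + s * \<gamma>')"
    unfolding assms(1) [symmetric] by (simp add: algebra_simps)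
  finally show ?thesis
    using assms(2,3) by (simp add: frac_eq_eq mult.commute)
qed

end

theory Submission
  imports Defs "Jordan_Normal_Form.Char_Poly"
begin

text \<open>
  Let \<open>\<nu> = m / n\<close>, \<open>w = \<eta> / \<sigma> \<eta>\<close>, \<open>X = X_poly m n r\<close> and \<open>Y x = x ^ r * X (1 / x)\<close>. The remainder
  \<open>X w - w powr \<nu> * Y w\<close> is a constant times the integral of
  \<open>((1 - t) * (t - w) / t) ^ r * t powr (\<nu> - 1)\<close> from \<open>1\<close> to \<open>w\<close>, hence of size
  \<open>\<bar>1 - sqrt w\<bar> ^ (2 * r)\<close>, while \<open>X w\<close> and \<open>Y w\<close> have size at most \<open>\<bar>1 + sqrt w\<bar> ^ (2 * r)\<close>.
  Homogenised at \<open>(\<eta>, \<sigma> \<eta>)\<close>, the polynomials \<open>X\<close> and \<open>Y\<close> are interchanged by \<open>\<sigma>\<close>, and after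
  multiplication by \<open>D / N * h / g ^ r\<close> their values are algebraic integers; combined with
  \<open>\<beta>, \<gamma>\<close> and their conjugates they give approximations \<open>P r / R r\<close> to \<open>\<alpha>\<close>. A nonzero
  algebraic integer \<open>z\<close> of \<open>L\<close> with \<open>\<sigma> z = \<plusminus> z\<close> satisfies \<open>\<bar>z\<bar> \<ge> 1\<close>, because \<open>z\<^sup>2 \<in> K\<close>. Applied to
  \<open>P r * q - R r * p\<close>, this is Thue's gap argument; consecutive approximations are distinct since
  their determinant is a nonzero multiple of \<open>(w - 1) ^ (2 * r + 1)\<close>.
\<close>

section \<open>Algebraic integers form a ring\<close>

text \<open>The bound for \<open>hypY\<close> with the constant 2 cannot hold on the whole interval
  (0, 1): at w = 0 the quotient of \<open>hypY\<close> by \<open>hypG\<close> grows like r powr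
  \<nu>. It is proved for real w >= 1/36 and on the unit circle. That a real w is never smaller is
  extracted from E > 1, using two integrality facts: 4 * Dn / calN d n >= 1, because D / N * X 1 is
  a positive integer, and norm (\<eta> * \<sigma> \<eta>) >= (norm g)^2, because suitable multiples
  of the powers of this product are integers of K.

  The constants of c arise as 4 = 2 * 2 and 5 = 2 * 5/2. The common factor 2 comes from making the
  remainder term at most 1/2 in the gap argument, the other 2 from the bounds for X and Y, and 5/2
  from comparing an arc with its chord.

  The gap argument needs \<kappa> >= 0, hence Q >= 1. This follows from E <= Q: the determinant of
  consecutive approximations is an integer of K, so at least 1 in absolute value, while it is at
  most a constant times (Q / E) ^ r.\<close>

lemma algebraic_int_if_integral_relations:
  fixes z :: complex and v :: "'b \<Rightarrow> complex" and M :: "'b \<Rightarrow> 'b \<Rightarrow> int"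
  assumes fin: "finite I" and nz: "i0 \<in> I" "v i0 \<noteq> 0"
    and rel: "\<And>i. i \<in> I \<Longrightarrow> z * v i = (\<Sum>j\<in>I. of_int (M i j) * v j)"
  shows "algebraic_int z"
proof -
  define n where "n = card I"
  obtain e where e: "bij_betw e {0..<n} I"
    using ex_bij_betw_nat_finite[OF fin] by (auto simp: n_def)
  \<comment> \<open>The relations say that the values of \<open>v\<close> form an eigenvector of
    this matrix with eigenvalue \<open>z\<close>. So \<open>z\<close> is a root of its
    characteristic polynomial, which is monic with integer coefficients.\<close>
  define A :: "int mat" where "A = mat n n (\<lambda>(i,j). M (e i) (e j))"
  define B :: "complex mat" where "B = map_mat of_int A"
  define u where "u = vec n (\<lambda>i. v (e i))"
  have A: "A \<in> carrier_mat n n" and B: "B \<in> carrier_mat n n"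
    by (auto simp: A_def B_def)
  obtain k where k: "k < n" "e k = i0"
    using e nz(1) by (metis atLeastLessThan_iff bij_betw_iff_bijections)
  have "u \<noteq> 0\<^sub>v n"
  proof
    assume "u = 0\<^sub>v n"
    then have "vec_index u k = 0" using k by simp
    then show False using k nz by (simp add: u_def)
  qed
  moreover have "B *\<^sub>v u = z \<cdot>\<^sub>v u"
  proof (rule eq_vecI)
    fix i assume "i < dim_vec (z \<cdot>\<^sub>v u)"
    then have i: "i < n" by (simp add: u_def)
    have "vec_index (B *\<^sub>v u) i = (\<Sum>j = 0..<n. of_int (M (e i) (e j)) * v (e j))"
      using i by (simp add: B_def A_def u_def scalar_prod_def)
    also have "\<dots> = (\<Sum>j\<in>I. of_int (M (e i) j) * v j)"
      by (rule sum.reindex_bij_betw[OF e])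
    also have "\<dots> = z * v (e i)"
      using rel e i by (metis atLeastLessThan_iff bij_betw_apply zero_le)
    finally show "vec_index (B *\<^sub>v u) i = vec_index (z \<cdot>\<^sub>v u) i"
      using i by (simp add: u_def)
  qed (simp add: B_def A_def u_def)
  ultimately have "eigenvalue B z"
    using B unfolding eigenvalue_def eigenvector_def by (auto intro!: exI[of _ u] simp: u_def)
  then have root: "poly (char_poly B) z = 0"
    using eigenvalue_root_char_poly[OF B] by simp
  have "char_poly B = map_poly of_int (char_poly A)"
    unfolding B_def by (rule of_int_hom.char_poly_hom[OF A])
  with root have "poly (map_poly of_int (char_poly A)) z = 0" by simp
  moreover have "lead_coeff (char_poly A) = 1"
    using degree_monic_char_poly[OF A] by simp
  ultimately show ?thesis
    unfolding algebraic_int_altdef_ipoly by blast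
qed

text \<open>\<open>c\<close> is the companion matrix of a monic integer polynomial with root
  \<open>x\<close>: its last row comes from the polynomial, the other rows only shift the
  exponent.\<close>

lemma algebraic_int_power_relations:
  fixes x :: complex
  assumes "algebraic_int x"
  obtains a :: nat and c :: "nat \<Rightarrow> nat \<Rightarrow> int"
    where "a > 0" "\<And>i. i < a \<Longrightarrow> x * x ^ i = (\<Sum>k<a. of_int (c i k) * x ^ k)"
proof -
  obtain p :: "int poly" where p: "poly (map_poly of_int p) x = 0" "lead_coeff p = 1"
    using assms unfolding algebraic_int_altdef_ipoly by blast
  define a where "a = degree p"
  define c where "c i k = (if Suc i < a then of_bool (k = Suc i) else - coeff p k)" for i k
  have "a > 0"
  proof (rule Nat.gr0I)
    assume "a = 0"
    then obtain u where "p = [:u:]" by (auto simp: a_def elim: degree_eq_zeroE)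
    then show False using p by simp
  qed
  moreover have "x * x ^ i = (\<Sum>k<a. of_int (c i k) * x ^ k)" if "i < a" for i
  proof (cases "Suc i < a")
    case True
    then have "(\<Sum>k<a. of_int (c i k) * x ^ k) = (\<Sum>k\<in>{Suc i}. x ^ k)"
      by (intro sum.mono_neutral_cong_right) (auto simp: c_def)
    then show ?thesis by simp
  next
    case False
    then have i: "Suc i = a" using that by simp
    have "0 = (\<Sum>k\<le>a. of_int (coeff p k) * x ^ k)"
      using p by (simp add: poly_altdef degree_map_poly coeff_map_poly a_def)
    also have "\<dots> = (\<Sum>k<a. of_int (coeff p k) * x ^ k) + x ^ a"
      using p by (simp add: lessThan_Suc_atMost [symmetric] a_def)
    finally have "x ^ a = - (\<Sum>k<a. of_int (coeff p k) * x ^ k)"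
      by (simp add: add_eq_0_iff)
    then show ?thesis
      using False i by (simp add: c_def sum_negf flip: power_Suc)
  qed
  ultimately show thesis using that by blast
qed

text \<open>On the products \<open>x ^ i * y ^ j\<close>, multiplication by \<open>x * y\<close> is
  the Kronecker product of the two companion matrices and multiplication by \<open>x + y\<close> is
  their Kronecker sum; both are integral.\<close>

lemma
  fixes x y :: complex
  assumes "algebraic_int x" "algebraic_int y"
  shows algebraic_int_add: "algebraic_int (x + y)"
    and algebraic_int_mult: "algebraic_int (x * y)"
proof -
  obtain a c where a: "a > 0" and c: "\<And>i. i < a \<Longrightarrow> x * x ^ i = (\<Sum>k<a. of_int (c i k) * x ^ k)"
    using algebraic_int_power_relations[OF assms(1)] by metis
  obtain b d where b: "b > 0" and d: "\<And>j. j < b \<Longrightarrow> y * y ^ j = (\<Sum>l<b. of_int (d j l) * y ^ l)"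
    using algebraic_int_power_relations[OF assms(2)] by metis
  define I where "I = {..<a} \<times> {..<b}"
  define v where "v = (\<lambda>(i,j). x ^ i * y ^ j)"
  have I: "finite I" "(0,0) \<in> I" "v (0,0) \<noteq> 0"
    using a b by (auto simp: I_def v_def)
  have "(x * y) * v i = (\<Sum>j\<in>I. of_int ((\<lambda>(i,j) (k,l). c i k * d j l) i j) * v j)" if iI: "i \<in> I" for i
  proof -
    obtain i1 i2 where i: "i = (i1, i2)" "i1 < a" "i2 < b" using iI by (auto simp: I_def)
    have "(x * y) * v i = (x * x ^ i1) * (y * y ^ i2)" by (simp add: i v_def)
    also have "\<dots> = (\<Sum>k<a. \<Sum>l<b. (of_int (c i1 k) * x ^ k) * (of_int (d i2 l) * y ^ l))"
      using c d i by (simp add: sum_product)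
    finally show ?thesis
      by (simp add: I_def sum.cartesian_product i v_def split_def mult_ac)
  qed
  from algebraic_int_if_integral_relations[OF I this] show "algebraic_int (x * y)" .
  have "(x + y) * v i = (\<Sum>j\<in>I. of_int ((\<lambda>(i,j) (k,l). c i k * of_bool (l = j) + d j l * of_bool (k = i)) i j) * v j)"
    if iI: "i \<in> I" for i
  proof -
    obtain i1 i2 where i: "i = (i1, i2)" "i1 < a" "i2 < b" using iI by (auto simp: I_def)
    have 1: "(\<Sum>l<b. of_int (c i1 k * of_bool (l = i2)) * (x ^ k * y ^ l)) = of_int (c i1 k) * x ^ k * y ^ i2" for k
    proof -
      have "(\<Sum>l<b. of_int (c i1 k * of_bool (l = i2)) * (x ^ k * y ^ l)) =
          (\<Sum>l\<in>{i2}. of_int (c i1 k) * x ^ k * y ^ l)"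
        using i by (intro sum.mono_neutral_cong_right) auto
      then show ?thesis by simp
    qed
    have 2: "(\<Sum>k<a. of_int (d i2 l * of_bool (k = i1)) * (x ^ k * y ^ l)) = x ^ i1 * (of_int (d i2 l) * y ^ l)" for l
    proof -
      have "(\<Sum>k<a. of_int (d i2 l * of_bool (k = i1)) * (x ^ k * y ^ l)) =
          (\<Sum>k\<in>{i1}. x ^ k * (of_int (d i2 l) * y ^ l))"
        using i by (intro sum.mono_neutral_cong_right) auto
      then show ?thesis by simp
    qed
    have "(\<Sum>j\<in>I. of_int ((\<lambda>(i,j) (k,l). c i k * of_bool (l = j) + d j l * of_bool (k = i)) i j) * v j)
       = (\<Sum>k<a. \<Sum>l<b. of_int (c i1 k * of_bool (l = i2)) * (x ^ k * y ^ l)) +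
         (\<Sum>k<a. \<Sum>l<b. of_int (d i2 l * of_bool (k = i1)) * (x ^ k * y ^ l))"
      by (simp add: I_def sum.cartesian_product i v_def split_def distrib_right sum.distrib)
    also have "\<dots> = (\<Sum>k<a. of_int (c i1 k) * x ^ k * y ^ i2) +
         (\<Sum>l<b. \<Sum>k<a. of_int (d i2 l * of_bool (k = i1)) * (x ^ k * y ^ l))"
      unfolding 1 by (subst (2) sum.swap) simp
    also have "\<dots> = (x * x ^ i1) * y ^ i2 + x ^ i1 * (y * y ^ i2)"
      unfolding 2 using c[OF i(2)] d[OF i(3)] by (simp add: sum_distrib_right sum_distrib_left)
    also have "\<dots> = (x + y) * v i" by (simp add: i v_def algebra_simps)
    finally show ?thesis ..
  qed
  from algebraic_int_if_integral_relations[OF I this] show "algebraic_int (x + y)" .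
qed

lemma algebraic_int_diff: "algebraic_int x \<Longrightarrow> algebraic_int y \<Longrightarrow> algebraic_int (x - y)" for x y :: complex
  using algebraic_int_add[of x "- y"] by simp

lemma algebraic_int_power: "algebraic_int x \<Longrightarrow> algebraic_int (x ^ k)" for x :: complex
  by (induction k) (auto intro: algebraic_int_mult int_imp_algebraic_int)

lemma algebraic_int_sum: "(\<And>i. i \<in> A \<Longrightarrow> algebraic_int (f i)) \<Longrightarrow> algebraic_int (\<Sum>i\<in>A. f i)"
  for f :: "'b \<Rightarrow> complex"
  by (induction A rule: infinite_finite_induct) (auto intro: algebraic_int_add)

section \<open>Quadratic extensions of subfields of the complex numbers\<close>

lemma complex_ring_simps [simp]:
  "carrier complex_ring = UNIV" "x \<otimes>\<^bsub>complex_ring\<^esub> y = x * y" "x \<oplus>\<^bsub>complex_ring\<^esub> y = x + y"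
  "\<one>\<^bsub>complex_ring\<^esub> = 1" "\<zero>\<^bsub>complex_ring\<^esub> = 0"
  by (auto simp: ring_of_type_algebra_def)

interpretation complex_field: Ring.ring complex_ring
  by (rule ring_from_type_algebra)

lemma complex_subfieldD:
  assumes K: "subfield K complex_ring"
  shows "0 \<in> K" "1 \<in> K" "\<And>x y. x \<in> K \<Longrightarrow> y \<in> K \<Longrightarrow> x + y \<in> K"
    "\<And>x y. x \<in> K \<Longrightarrow> y \<in> K \<Longrightarrow> x * y \<in> K" "\<And>x y. x \<in> K \<Longrightarrow> y \<in> K \<Longrightarrow> x - y \<in> K"
    "\<And>x. x \<in> K \<Longrightarrow> - x \<in> K" "\<And>x. x \<in> K \<Longrightarrow> inverse x \<in> K"
    "\<And>x y. x \<in> K \<Longrightarrow> y \<in> K \<Longrightarrow> x / y \<in> K" "\<And>x k. x \<in> K \<Longrightarrow> x ^ k \<in> K"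
proof -
  note sr = subringE[OF subfieldE(1)[OF K]]
  show zero: "0 \<in> K" and "1 \<in> K" using sr(2,3) by simp_all
  show add: "x + y \<in> K" if "x \<in> K" "y \<in> K" for x y using sr(7)[OF that] by simp
  show mult: "x * y \<in> K" if "x \<in> K" "y \<in> K" for x y using sr(6)[OF that] by simp
  show neg: "- x \<in> K" if "x \<in> K" for x
  proof -
    have "x + (\<ominus>\<^bsub>complex_ring\<^esub> x) = 0"
      using complex_field.r_neg[of x] by simp
    then have "\<ominus>\<^bsub>complex_ring\<^esub> x = - x" by (simp add: add_eq_0_iff)
    then show ?thesis using sr(5)[OF that] by simp
  qed
  show "x - y \<in> K" if "x \<in> K" "y \<in> K" for x y using add[OF that(1) neg[OF that(2)]] by simp
  show inv: "inverse x \<in> K" if "x \<in> K" for x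
  proof (cases "x = 0")
    case False
    then have x: "x \<in> K - {\<zero>\<^bsub>complex_ring\<^esub>}" using that by simp
    have "x * (inv\<^bsub>complex_ring\<^esub> x) = 1"
      using complex_field.subfield_m_inv(2)[OF K x] by simp
    then have "inv\<^bsub>complex_ring\<^esub> x = inverse x"
      by (metis inverse_unique)
    then show ?thesis using complex_field.subfield_m_inv(1)[OF K x] by simp
  qed (use zero in simp)
  show "x / y \<in> K" if "x \<in> K" "y \<in> K" for x y
    using mult[OF that(1) inv[OF that(2)]] by (simp add: divide_inverse)
  show "x ^ k \<in> K" if "x \<in> K" for x k
    using that sr(3) by (induction k) (auto intro: mult)
qed

lemma complex_subfield_Rats:
  assumes "subfield K complex_ring" "x \<in> \<rat>"
  shows "x \<in> K"
proof -
  note K = complex_subfieldD[OF assms(1)]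
  have nat: "of_nat k \<in> K" for k by (induction k) (auto intro: K)
  have int: "of_int k \<in> K" for k by (cases k) (auto intro!: K(3,5,6) K(2) nat)
  from assms(2) obtain a b where "x = of_int a / of_int b" by (auto elim: Rats_cases')
  then show ?thesis by (auto intro: K int)
qed

text \<open>Cramer's rule: a basis \<open>v\<close>, \<open>u\<close> of L is exchanged for
  \<open>1\<close>, \<open>e\<close>. The determinant \<open>D\<close> of their coordinates is
  nonzero, since otherwise \<open>e\<close> would be a quotient of elements of K.\<close>

lemma ext_degree_2_basis:
  assumes ext: "ext_degree K L 2" and e: "e \<in> L" "e \<notin> K" and x: "x \<in> L"
  obtains k1 k2 where "k1 \<in> K" "k2 \<in> K" "x = k1 + k2 * e"
proof -
  have sK: "subfield K complex_ring" and dim: "complex_field.dimension 2 K L"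
    and sL: "subfield L complex_ring"
    using ext by (auto simp: ext_degree_def)
  note K = complex_subfieldD[OF sK]
  have two: "2 = Suc (Suc 0)" by simp
  obtain v E' where 1: "complex_field.dimension (Suc 0) K E'" "L = complex_field.line_extension K v E'"
    using complex_field.dimension_backwards[OF sK dim[unfolded two]] by blast
  obtain u E'' where 2: "complex_field.dimension 0 K E''" "E' = complex_field.line_extension K u E''"
    using complex_field.dimension_backwards[OF sK 1(1)] by blast
  have E'': "E'' = {0}"
    using complex_field.dimension_zero[OF sK 2(1)] by simp
  have span: "y \<in> L \<longleftrightarrow> (\<exists>a\<in>K. \<exists>b\<in>K. y = a * v + b * u)" for y
    unfolding 1(2) 2(2) E'' complex_field.line_extension_mem_iff
    unfolding complex_ring_simps Bex_def complex_field.line_extension_mem_iff by auto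
  obtain a b where ab: "a \<in> K" "b \<in> K" "1 = a * v + b * u"
    using span[of 1] complex_subfieldD(2)[OF sL] by blast
  obtain a' b' where ab': "a' \<in> K" "b' \<in> K" "e = a' * v + b' * u"
    using span e(1) by blast
  obtain a'' b'' where ab'': "a'' \<in> K" "b'' \<in> K" "x = a'' * v + b'' * u"
    using span x by blast
  define D where "D = a * b' - a' * b"
  have "D * u = a * (a' * v + b' * u) - a' * (a * v + b * u)"
    "D * v = b' * (a * v + b * u) - b * (a' * v + b' * u)"
    by (simp_all add: D_def algebra_simps)
  then have Duv: "D * u = a * e - a'" "D * v = b' - b * e"
    unfolding ab(3) [symmetric] ab'(3) [symmetric] by simp_all
  have D: "D \<noteq> 0"
  proof
    assume "D = 0"
    then have "a * e = a'" "b * e = b'" using Duv by simp_all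
    moreover have "a \<noteq> 0 \<or> b \<noteq> 0" using ab(3) by auto
    ultimately have "e = a' / a \<or> e = b' / b" by (auto simp: field_simps)
    then show False using e(2) K(8)[OF ab'(1) ab(1)] K(8)[OF ab'(2) ab(2)] by auto
  qed
  then have v: "v = (b' - b * e) / D" and u: "u = (a * e - a') / D"
    using D by (simp_all flip: Duv)
  have "x = (a'' * b' - b'' * a') / D + ((b'' * a - a'' * b) / D) * e"
    unfolding ab''(3) v u by (simp add: divide_inverse algebra_simps)
  moreover have "D \<in> K" unfolding D_def using ab ab' by (auto intro!: K(4,5))
  then have "(a'' * b' - b'' * a') / D \<in> K" "(b'' * a - a'' * b) / D \<in> K"
    using ab ab' ab'' by (auto intro!: K(4,5,8))
  ultimately show thesis using that by blast
qed

text \<open>Vieta's formulas for the roots of \<open>t\<^sup>2 - v * t - u\<close>. They are applied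
  to \<sigma> as well as to complex conjugation.\<close>

lemma quadratic_conjugate:
  fixes x y u v :: complex
  assumes "x * x = u + v * x" "y * y = u + v * y" "y \<noteq> x"
  shows "y = v - x" "x * y = - u"
proof -
  have "(y - x) * (y + x - v) = (y * y - v * y) - (x * x - v * x)"
    by (simp add: algebra_simps)
  also have "\<dots> = 0" using assms(1,2) by simp
  finally show y: "y = v - x" using assms(3) by (simp add: eq_diff_eq)
  show "x * y = - u" unfolding y using assms(1) by (simp add: right_diff_distrib mult.commute)
qed

locale quadratic_extension =
  fixes K L :: "complex set" and \<sigma> :: "complex \<Rightarrow> complex"
  assumes ext: "ext_degree K L 2" and Gal: "\<sigma> \<in> Gal K L" and nontriv: "\<exists>x\<in>L. \<sigma> x \<noteq> x"
begin

lemma K: "subfield K complex_ring" and L: "subfield L complex_ring" and K_sub_L: "K \<subseteq> L"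
  using ext by (auto simp: ext_degree_def)

lemma \<sigma>_add: "x \<in> L \<Longrightarrow> y \<in> L \<Longrightarrow> \<sigma> (x + y) = \<sigma> x + \<sigma> y"
  and \<sigma>_mult: "x \<in> L \<Longrightarrow> y \<in> L \<Longrightarrow> \<sigma> (x * y) = \<sigma> x * \<sigma> y"
  and \<sigma>_in: "x \<in> L \<Longrightarrow> \<sigma> x \<in> L"
  and \<sigma>_K: "x \<in> K \<Longrightarrow> \<sigma> x = x"
  using Gal by (auto simp: Gal_def ring_iso_def Ring.ring_hom_def ring_of_type_algebra_def)

lemma \<sigma>_power: "x \<in> L \<Longrightarrow> \<sigma> (x ^ k) = \<sigma> x ^ k"
  using complex_subfieldD[OF L] complex_subfieldD(2)[OF K] \<sigma>_K
  by (induction k) (auto simp: \<sigma>_mult)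

lemma \<sigma>_minus: "x \<in> L \<Longrightarrow> \<sigma> (- x) = - \<sigma> x"
  using \<sigma>_mult[of "-1" x] \<sigma>_K[of "-1"] complex_subfieldD(2,6)[OF K] K_sub_L by auto

lemma \<sigma>_sum: "(\<And>i. i \<in> A \<Longrightarrow> f i \<in> L) \<Longrightarrow> \<sigma> (\<Sum>i\<in>A. f i) = (\<Sum>i\<in>A. \<sigma> (f i)) \<and> (\<Sum>i\<in>A. f i) \<in> L"
  using complex_subfieldD(1,3)[OF L] \<sigma>_K[OF complex_subfieldD(1)[OF K]]
  by (induction A rule: infinite_finite_induct) (auto simp: \<sigma>_add)

text \<open>An element outside K spans L together with 1, so \<sigma> cannot fix it without being
  trivial.\<close>

lemma fixed_imp_K: assumes "x \<in> L" "\<sigma> x = x" shows "x \<in> K"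
proof (rule ccontr)
  assume "x \<notin> K"
  obtain y where y: "y \<in> L" "\<sigma> y \<noteq> y" using nontriv by blast
  obtain k1 k2 where k: "k1 \<in> K" "k2 \<in> K" "y = k1 + k2 * x"
    using ext_degree_2_basis[OF ext assms(1) \<open>x \<notin> K\<close> y(1)] by blast
  have "\<sigma> y = y"
    unfolding k(3) using k assms K_sub_L complex_subfieldD(4)[OF L]
    by (subst \<sigma>_add) (auto simp: \<sigma>_K \<sigma>_mult)
  then show False using y by simp
qed

lemma \<sigma>_invol: assumes x: "x \<in> L" shows "\<sigma> (\<sigma> x) = x"
proof (cases "x \<in> K")
  case False
  note KD = complex_subfieldD[OF K] and LD = complex_subfieldD[OF L]
  obtain u v where k: "u \<in> K" "v \<in> K" "x * x = u + v * x"
    using ext_degree_2_basis[OF ext x False LD(4)[OF x x]] by blast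
  have uvL: "u \<in> L" "v \<in> L" using k K_sub_L by auto
  have "\<sigma> (x * x) = \<sigma> (u + v * x)" using k by simp
  then have "\<sigma> x * \<sigma> x = u + v * \<sigma> x"
    using x uvL LD(4)[OF uvL(2) x] \<sigma>_K[OF k(1)] \<sigma>_K[OF k(2)]
    by (simp add: \<sigma>_mult \<sigma>_add)
  moreover have "\<sigma> x \<noteq> x" using fixed_imp_K[OF x] False by blast
  ultimately have *: "\<sigma> x = v + - x" using quadratic_conjugate[OF k(3)] by simp
  have "\<sigma> (\<sigma> x) = v + - \<sigma> x"
    by (subst *, subst \<sigma>_add) (use x uvL LD k in \<open>auto simp: \<sigma>_K \<sigma>_minus\<close>)
  then show ?thesis using * by simp
qed (simp add: \<sigma>_K)

lemma norm_in_K: "x \<in> L \<Longrightarrow> x * \<sigma> x \<in> K"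
  by (rule fixed_imp_K) (auto simp: \<sigma>_mult \<sigma>_in \<sigma>_invol mult.commute complex_subfieldD(4)[OF L])

end

lemma Rats_algebraic_int_norm_ge_1:
  fixes x :: complex
  assumes "x \<in> \<rat>" "algebraic_int x" "x \<noteq> 0"
  shows "norm x \<ge> 1"
proof -
  have "x \<in> \<int>" by (rule rational_algebraic_int_is_int[OF assms(2,1)])
  then obtain k where "x = of_int k" by (auto elim: Ints_cases)
  with assms(3) show ?thesis by (simp add: norm_of_int)
qed

text \<open>An irrational \<open>x\<close> in K is not real, since otherwise K, spanned by 1 and
  \<open>x\<close> over the rationals, would be real. Hence \<open>cnj x\<close> is the second root
  of the rational quadratic equation of \<open>x\<close>, and the product of the roots is
  rational.\<close>

lemma imag_quadratic_norm_in_Rats: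
  assumes K: "imag_quadratic_field K" and x: "x \<in> K"
  shows "x * cnj x \<in> \<rat>"
proof (cases "x \<in> \<rat>")
  case True
  then obtain a b where "x = of_int a / of_int b" by (auto elim: Rats_cases')
  then show ?thesis using True by simp
next
  case False
  have ext: "ext_degree \<rat> K 2" and "\<not> K \<subseteq> \<real>" using K by (auto simp: imag_quadratic_field_def)
  then obtain y where y: "y \<in> K" "y \<notin> \<real>" by blast
  have Rats_Reals: "q \<in> \<rat> \<Longrightarrow> q \<in> \<real>" for q :: complex
    by (metis Rats_cases' Reals_divide Reals_of_int)
  obtain a b where "a \<in> \<rat>" "b \<in> \<rat>" "y = a + b * x"
    using ext_degree_2_basis[OF ext x False y(1)] by blast
  with y(2) have nreal: "x \<notin> \<real>" using Rats_Reals by auto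
  have "x * x \<in> K" using ext x by (auto simp: ext_degree_def intro: complex_subfieldD)
  then obtain u v where k: "u \<in> \<rat>" "v \<in> \<rat>" "x * x = u + v * x"
    using ext_degree_2_basis[OF ext x False] by blast
  have "cnj u = u" "cnj v = v" using k Rats_Reals by (auto simp: Reals_cnj_iff)
  moreover have "cnj x * cnj x = cnj u + cnj v * cnj x"
    using arg_cong[OF k(3), of cnj] by simp
  moreover have "cnj x \<noteq> x" using nreal by (simp add: Reals_cnj_iff)
  ultimately have "x * cnj x = - u" using quadratic_conjugate[OF k(3)] by simp
  then show ?thesis using k(1) by simp
qed

text \<open>In both cases a nonzero rational integer has absolute value at least 1; in the imaginary
  quadratic case this integer is \<open>x * cnj x\<close>.\<close>

lemma algebraic_int_norm_ge_1:
  assumes K: "K = \<rat> \<or> imag_quadratic_field K" and x: "x \<in> K" "algebraic_int x" "x \<noteq> 0"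
  shows "norm x \<ge> 1"
  using K
proof
  assume "K = \<rat>"
  then show ?thesis using Rats_algebraic_int_norm_ge_1 x by blast
next
  assume "imag_quadratic_field K"
  then have "norm (x * cnj x) \<ge> 1"
    using x by (intro Rats_algebraic_int_norm_ge_1)
      (auto intro: imag_quadratic_norm_in_Rats algebraic_int_mult algebraic_int_cnj)
  then have "1 \<le> (norm x)\<^sup>2" by (simp add: norm_mult power2_eq_square)
  then show ?thesis using power2_le_imp_le[of 1 "norm x"] by simp
qed

text \<open>Lets the factors \<open>norm (csqrt \<tau>)\<close> be inserted into the final constant.
  For K other than the rationals, \<tau> is nonzero because adjoining its root enlarges K.\<close>

lemma csqrt_generator_norm_ge_1:
  assumes quad: "quadratic_extension K L \<sigma>" and K: "K = \<rat> \<or> imag_quadratic_field K"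
    and tau_Rats: "K = \<rat> \<Longrightarrow> \<tau> = 1"
    and tau_imag: "K \<noteq> \<rat> \<Longrightarrow> \<tau> \<in> K \<and> algebraic_int \<tau> \<and>
                     L = generate_field complex_ring (insert (csqrt \<tau>) K)"
  shows "norm (csqrt \<tau>) \<ge> 1"
proof (cases "K = \<rat>")
  case False
  interpret quadratic_extension K L \<sigma> by fact
  have t: "\<tau> \<in> K" "algebraic_int \<tau>" "L = generate_field complex_ring (insert (csqrt \<tau>) K)"
    using tau_imag[OF False] by auto
  have "\<tau> \<noteq> 0"
  proof
    assume "\<tau> = 0"
    then have "insert (csqrt \<tau>) K = K" using complex_subfieldD(1)[OF K] by auto
    then have "L \<subseteq> K" unfolding t(3)
      using field.generate_field_min_subfield1[OF field_from_type_algebra, of K K] K by simp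
    then show False using nontriv \<sigma>_K by blast
  qed
  then have "norm \<tau> \<ge> 1" using algebraic_int_norm_ge_1[OF assms(2)] t by blast
  moreover have "norm (csqrt \<tau>) ^ 2 = norm \<tau>" by (metis norm_power power2_csqrt)
  ultimately show ?thesis using power2_le_imp_le[of 1 "norm (csqrt \<tau>)"] by simp
qed (simp add: tau_Rats)

section \<open>Bounds for Jacobi sums\<close>

text \<open>
  \<open>jac \<mu> r k * x ^ k\<close> summed over \<open>k\<close> is the coefficient of \<open>z ^ r\<close> in
  \<open>(1 + z) powr (r - \<mu>) * (1 + x * z) powr (r + \<mu>)\<close>, a Jacobi polynomial up to a change of variable.
\<close>

definition jac :: "real \<Rightarrow> nat \<Rightarrow> nat \<Rightarrow> real" where
  "jac \<mu> r k = ((real r - \<mu>) gchoose (r - k)) * ((real r + \<mu>) gchoose k)"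

text \<open>Reversing the coefficients changes the sign of \<mu>; this is how \<open>hypY\<close>
  becomes a Jacobi sum.\<close>

lemma jac_reflect: "k \<le> r \<Longrightarrow> jac \<mu> r (r - k) = jac (- \<mu>) r k"
  by (simp add: jac_def mult.commute)

lemma gbinomial_Suc_mult: "real (Suc k) * (a gchoose Suc k) = (a - real k) * (a gchoose k)" for a :: real
  using gbinomial_mult_1[of a k] by (simp add: algebra_simps)

text \<open>The ratio of consecutive terms that this yields increases with \<mu>; the comparison in
  \<open>sum_jac_le\<close> rests on that.\<close>

lemma jac_Suc:
  assumes "k < r"
  shows "jac \<mu> r (Suc k) * ((real k + 1 - \<mu>) * (real k + 1)) = jac \<mu> r k * ((real r + \<mu> - real k) * (real r - real k))"
proof -
  have r: "r - k = Suc (r - Suc k)" using assms by simp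
  have 1: "(real r - real k) * ((real r - \<mu>) gchoose (r - k)) = (real k + 1 - \<mu>) * ((real r - \<mu>) gchoose (r - Suc k))"
    using gbinomial_Suc_mult[of "r - Suc k" "real r - \<mu>"] assms by (simp add: r [symmetric] of_nat_diff algebra_simps)
  have 2: "(real k + 1) * ((real r + \<mu>) gchoose Suc k) = (real r + \<mu> - real k) * ((real r + \<mu>) gchoose k)"
    using gbinomial_Suc_mult[of k "real r + \<mu>"] by (simp add: algebra_simps)
  have "jac \<mu> r (Suc k) * ((real k + 1 - \<mu>) * (real k + 1)) =
      ((real k + 1 - \<mu>) * ((real r - \<mu>) gchoose (r - Suc k))) * ((real k + 1) * ((real r + \<mu>) gchoose Suc k))"
    by (simp add: jac_def mult_ac)
  also have "\<dots> = jac \<mu> r k * ((real r + \<mu> - real k) * (real r - real k))"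
    unfolding 1 [symmetric] 2 by (simp add: jac_def mult_ac)
  finally show ?thesis .
qed

lemma gbinomial_pos: "0 < a + 1 - real k \<Longrightarrow> 0 < a gchoose k" for a :: real
  unfolding gbinomial_pochhammer' by (intro divide_pos_pos pochhammer_pos) auto

lemma jac_pos: "\<bar>\<mu>\<bar> < 1 \<Longrightarrow> k \<le> r \<Longrightarrow> jac \<mu> r k > 0"
  unfolding jac_def by (intro mult_pos_pos gbinomial_pos) (auto simp: of_nat_diff)

section \<open>Jacobi sums on the unit interval\<close>

lemma sum_jac: "(\<Sum>k\<le>r. jac \<mu> r k) = real (2 * r choose r)"
proof -
  have "(\<Sum>k\<le>r. jac \<mu> r k) = (\<Sum>k\<le>r. ((real r + \<mu>) gchoose k) * ((real r - \<mu>) gchoose (r - k)))"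
    by (simp add: jac_def mult.commute)
  also have "\<dots> = ((real r + \<mu>) + (real r - \<mu>)) gchoose r"
    by (simp only: gbinomial_Vandermonde [symmetric] atLeast0AtMost)
  also have "\<dots> = real (2 * r choose r)" by (simp add: binomial_gbinomial)
  finally show ?thesis .
qed

text \<open>Let \<open>k0\<close> be the first index with a nonpositive weight. Replacing every
  \<open>x ^ k\<close> by \<open>x ^ k0\<close> can only lower the sum: positive weights lose a
  larger power, nonpositive ones receive a larger power. What is left is a multiple of the vanishing
  total weight.\<close>

lemma sum_mult_power_nonneg_if_single_crossing:
  fixes D :: "nat \<Rightarrow> real"
  assumes "(\<Sum>k\<le>r. D k) = 0" "\<And>k. k < r \<Longrightarrow> D k \<le> 0 \<Longrightarrow> D (Suc k) \<le> 0" "0 \<le> x" "x \<le> 1"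
  shows "(\<Sum>k\<le>r. D k * x ^ k) \<ge> 0"
proof (cases "\<exists>k\<le>r. D k \<le> 0")
  case True
  define k0 where "k0 = (LEAST k. k \<le> r \<and> D k \<le> 0)"
  have k0: "k0 \<le> r" "D k0 \<le> 0" using True LeastI_ex[of "\<lambda>k. k \<le> r \<and> D k \<le> 0"] by (auto simp: k0_def)
  have less: "D k > 0" if "k < k0" for k
    using that not_less_Least[of k "\<lambda>k. k \<le> r \<and> D k \<le> 0"] k0(1) by (fastforce simp: k0_def)
  have ge: "D k \<le> 0" if "k0 \<le> k" "k \<le> r" for k
    using that by (induction k rule: dec_induct) (use k0 assms(2) in auto)
  have "0 = (\<Sum>k\<le>r. D k * x ^ k0)" using assms(1) by (simp flip: sum_distrib_right)
  also have "\<dots> \<le> (\<Sum>k\<le>r. D k * x ^ k)"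
  proof (rule sum_mono)
    fix k assume "k \<in> {..r}"
    then show "D k * x ^ k0 \<le> D k * x ^ k"
      using less[of k] ge[of k] assms(3,4) power_decreasing[of k k0 x] power_decreasing[of k0 k x]
      by (cases "k < k0") (auto intro: mult_left_mono mult_left_mono_neg)
  qed
  finally show ?thesis .
next
  case False
  then show ?thesis using assms(3) by (intro sum_nonneg mult_nonneg_nonneg) force+
qed

text \<open>
  The quotient \<open>jac (-1) r k / jac \<mu> r k\<close> decreases in \<open>k\<close> and both families have the same sum, so the
  weights of \<open>\<mu> = -1\<close> sit on smaller powers of \<open>x\<close>. The case \<open>\<mu> = -1\<close> involves integer binomial
  coefficients only.
\<close>

lemma sum_jac_le:
  assumes \<mu>: "\<bar>\<mu>\<bar> < 1" and x: "0 \<le> x" "x \<le> 1"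
  shows "(\<Sum>k\<le>r. jac \<mu> r k * x ^ k) \<le> (\<Sum>k\<le>r. jac (-1) r k * x ^ k)"
proof -
  have "(\<Sum>k\<le>r. (jac (-1) r k - jac \<mu> r k) * x ^ k) \<ge> 0"
  proof (rule sum_mult_power_nonneg_if_single_crossing)
    show "(\<Sum>k\<le>r. jac (-1) r k - jac \<mu> r k) = 0" by (simp add: sum_subtractf sum_jac)
    fix k assume k: "k < r" and le: "jac (-1) r k - jac \<mu> r k \<le> 0"
    define s where "s = real r - real k"
    define t where "t = real k + 1"
    have st: "s \<ge> 1" "t \<ge> 1" using k by (auto simp: s_def t_def)
    have 1: "jac (-1) r (Suc k) * ((t + 1) * t) = jac (-1) r k * ((s - 1) * s)"
      using jac_Suc[OF k, of "-1"] by (simp add: s_def t_def algebra_simps)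
    have 2: "jac \<mu> r (Suc k) * ((t - \<mu>) * t) = jac \<mu> r k * ((s + \<mu>) * s)"
      using jac_Suc[OF k, of \<mu>] by (simp add: s_def t_def algebra_simps)
    have p: "jac \<mu> r k > 0" using jac_pos[OF \<mu>] k by simp
    have e1: "jac (-1) r (Suc k) = jac (-1) r k * (((s - 1) / (t + 1)) * (s / t))"
    proof -
      have "(t + 1) * t \<noteq> 0" using st by simp
      then have "jac (-1) r (Suc k) = jac (-1) r k * ((s - 1) * s) / ((t + 1) * t)"
        using 1 by (rule nonzero_eq_divide_eq [THEN iffD2])
      then show ?thesis by simp
    qed
    have e2: "jac \<mu> r (Suc k) = jac \<mu> r k * (((s + \<mu>) / (t - \<mu>)) * (s / t))"
    proof -
      have "(t - \<mu>) * t \<noteq> 0" using st \<mu> by auto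
      then have "jac \<mu> r (Suc k) = jac \<mu> r k * ((s + \<mu>) * s) / ((t - \<mu>) * t)"
        using 2 by (rule nonzero_eq_divide_eq [THEN iffD2])
      then show ?thesis by simp
    qed
    \<comment> \<open>These are the parts of the two ratios that differ. Passing from -1 to \<mu>
      raises the numerator and lowers the denominator.\<close>
    have "(s - 1) / (t + 1) \<le> (s + \<mu>) / (t - \<mu>)"
      using st \<mu> by (intro frac_le) auto
    then have "jac (-1) r (Suc k) \<le> jac \<mu> r (Suc k)"
      unfolding e1 e2 using st \<mu> le p by (intro mult_mono) auto
    then show "jac (-1) r (Suc k) - jac \<mu> r (Suc k) \<le> 0" by simp
  qed (use x in auto)
  then show ?thesis by (simp add: left_diff_distrib sum_subtractf)
qed

text \<open>
  The left-hand product is one term of Vandermonde's sum for the right-hand side; its two neighbours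
  together are at least half as large.
\<close>

lemma binomial_product_le:
  assumes "r \<ge> 3" "k < r"
  shows "3 * (real (Suc r choose Suc k) * real ((r - 1) choose k)) \<le> 2 * real (2 * r choose (2 * k + 1))"
proof -
  define A where "A = real (Suc r choose Suc k) * real ((r - 1) choose k)"
  define B where "B = real (Suc r choose k) * real ((r - 1) choose Suc k)"
  \<comment> \<open>For \<open>k = 0\<close> this neighbour does not exist, whereas truncated
    subtraction in \<open>k - 1\<close> would count a spurious term.\<close>
  define C where "C = (if k = 0 then 0 else real (Suc r choose Suc (Suc k)) * real ((r - 1) choose (k - 1)))"
  have bin: "real (Suc j) * real (n choose Suc j) = (real n - real j) * real (n choose j)" for n j
    using gbinomial_Suc_mult[of j "real n"] by (simp add: binomial_gbinomial)
  define F where "F = (\<lambda>j. real (Suc r choose j) * real ((r - 1) choose (2 * k + 1 - j)))"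
  have V: "(\<Sum>j\<le>2*k+1. F j) = real (2 * r choose (2 * k + 1))"
  proof -
    have "Suc r + (r - 1) = 2 * r" using assms by simp
    then have "(\<Sum>j\<le>2*k+1. (Suc r choose j) * ((r - 1) choose (2 * k + 1 - j))) = (2 * r choose (2 * k + 1))"
      using vandermonde[of "Suc r" "r - 1" "2 * k + 1"] by (simp only:)
    then show ?thesis unfolding F_def by (metis (mono_tags, lifting) of_nat_mult of_nat_sum sum.cong)
  qed
  have "A + B + C \<le> (\<Sum>j\<le>2*k+1. F j)"
  proof (cases "k = 0")
    case True
    then show ?thesis by (simp add: A_def B_def C_def F_def)
  next
    case False
    have "A + B + C = (\<Sum>j\<in>{k, Suc k, Suc (Suc k)}. F j)"
      using False by (simp add: A_def B_def C_def F_def numeral_2_eq_2)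
    also have "\<dots> \<le> (\<Sum>j\<le>2*k+1. F j)"
      using False by (intro sum_mono2) (auto simp: F_def)
    finally show ?thesis .
  qed
  moreover have "A \<le> 2 * B + 2 * C"
  proof -
    have "(real k + 1) * (B * (real r + 1 - real k)) = ((real r + 1 - real k) * real (Suc r choose k)) * (real (Suc k) * real ((r - 1) choose Suc k))"
      by (simp add: B_def mult_ac)
    also have "\<dots> = (real (Suc k) * real (Suc r choose Suc k)) * (real (Suc k) * real ((r - 1) choose Suc k))"
      using bin[of k "Suc r"] by (simp add: add.commute mult_ac del: binomial_Suc_Suc)
    also have "\<dots> = (real k + 1) * (A * (real r - 1 - real k))"
      using bin[of k "r - 1"] assms by (simp add: A_def of_nat_diff add.commute mult_ac del: binomial_Suc_Suc)
    finally have B: "B * (real r + 1 - real k) = A * (real r - 1 - real k)" by simp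
    have Bk: "B = A * ((real r - 1 - real k) / (real r + 1 - real k))"
      using B assms by (simp add: field_simps)
    have C: "C = A * (real k / (real k + 2))"
    proof (cases "k = 0")
      case False
      then obtain j where k: "k = Suc j" by (cases k) auto
      have "(real r - real k) * (C * (real k + 2)) = ((real k + 2) * real (Suc r choose Suc (Suc k))) * ((real r - 1 - real j) * real ((r - 1) choose j))"
        using False assms by (simp add: C_def k mult_ac del: binomial_Suc_Suc)
      also have "\<dots> = ((real r - real k) * real (Suc r choose Suc k)) * (real k * real ((r - 1) choose k))"
      proof -
        have "(real k + 2) * real (Suc r choose Suc (Suc k)) = (real r - real k) * real (Suc r choose Suc k)"
          using bin[of "Suc k" "Suc r"] by (simp add: add.commute del: binomial_Suc_Suc)
        moreover have "(real r - 1 - real j) * real ((r - 1) choose j) = real k * real ((r - 1) choose k)"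
          using bin[of j "r - 1"] assms by (simp add: k of_nat_diff del: binomial_Suc_Suc)
        ultimately show ?thesis by (simp only:)
      qed
      also have "\<dots> = (real r - real k) * (A * real k)" by (simp add: A_def mult_ac)
      finally have "C * (real k + 2) = A * real k" using assms by simp
      then show ?thesis by (simp add: field_simps)
    qed (simp add: C_def)
    have A: "A \<ge> 0" by (simp add: A_def)
    \<comment> \<open>The second summand suffices from \<open>k = 2\<close> on. The case
      \<open>k = 0\<close> is where \<open>r >= 3\<close> is sharp: equality holds at
      \<open>r = 3\<close>.\<close>
    have "1 \<le> 2 * ((real r - 1 - real k) / (real r + 1 - real k)) + 2 * (real k / (real k + 2))"
    proof -
      have pos: "real r + 1 - real k > 0" "real r - 1 - real k \<ge> 0" using assms by auto
      consider "k = 0" | "k = 1" | "k \<ge> 2" by linarith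
      then show ?thesis
      proof cases
        case 3
        then have "1 \<le> 2 * (real k / (real k + 2))" by (simp add: field_simps)
        moreover have "0 \<le> (real r - 1 - real k) / (real r + 1 - real k)" using pos by simp
        ultimately show ?thesis by linarith
      next
        case 1
        then show ?thesis using assms by (simp add: field_simps)
      next
        case 2
        have "1/3 \<le> (real r - 2) / real r" using assms by (simp add: field_simps)
        then show ?thesis using 2 by (simp add: algebra_simps diff_divide_distrib)
      qed
    qed
    from mult_left_mono[OF this A] show ?thesis unfolding Bk C by (simp add: algebra_simps)
  qed
  ultimately show ?thesis unfolding V A_def by linarith
qed

lemma sum_atMost_double: "(\<Sum>j\<le>2*r. f j) = (\<Sum>k\<le>r. f (2*k)) + (\<Sum>k<r. f (2*k+1))" for f :: "nat \<Rightarrow> real"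
  by (induction r) (simp_all add: algebra_simps)

text \<open>The even part of \<open>(1 + y) ^ (2 * r)\<close> minus its odd part is
  \<open>(1 - y) ^ (2 * r)\<close>, which is nonnegative, so the odd part is at most half of the
  whole.\<close>

lemma sum_odd_binomial_le:
  fixes y :: real
  shows "2 * (\<Sum>k<r. real (2*r choose (2*k+1)) * y ^ (2*k+1)) \<le> (1 + y) ^ (2 * r)"
proof -
  define Ev where "Ev = (\<Sum>k\<le>r. real (2*r choose (2*k)) * y ^ (2*k))"
  define Od where "Od = (\<Sum>k<r. real (2*r choose (2*k+1)) * y ^ (2*k+1))"
  have "(y + 1) ^ (2*r) = Ev + Od"
    unfolding binomial_ring Ev_def Od_def by (subst sum_atMost_double) simp
  moreover have "(- y + 1) ^ (2*r) = Ev - Od"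
    unfolding binomial_ring Ev_def Od_def by (subst sum_atMost_double) (simp add: sum_negf)
  moreover have "(- y + 1) ^ (2*r) \<ge> 0" by (simp add: power_mult)
  ultimately show ?thesis unfolding Od_def by (simp add: add.commute)
qed

text \<open>By \<open>binomial_product_le\<close> the sum is at most 2/3 of the odd part of
  \<open>(1 + y) ^ (2 * r)\<close> divided by \<open>y\<close>, hence at most
  \<open>(1 + y) ^ (2 * r) / (3 * y)\<close>. The threshold 1/6 is where \<open>1 / (3 * y)\<close>
  equals 2. The binomial estimate starts at \<open>r = 3\<close>, so smaller \<open>r\<close> are
  computed directly.\<close>

lemma sum_jac_minus_1_le:
  fixes y :: real
  assumes "y \<ge> 1/6"
  shows "(\<Sum>k\<le>r. jac (-1) r k * (y\<^sup>2) ^ k) \<le> 2 * (1 + y) ^ (2 * r)"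
proof -
  consider "r = 0" | "r = 1" | "r = 2" | "r \<ge> 3" by linarith
  then show ?thesis
  proof cases
    case 1
    then show ?thesis by (simp add: jac_def)
  next
    case 2
    have "(\<Sum>k\<le>r. jac (-1) r k * (y\<^sup>2) ^ k) = 2" using 2 by (simp add: jac_def gbinomial_0_left)
    also have "\<dots> \<le> 2 * (1 + y) ^ (2 * r)" using assms by (simp add: one_le_power)
    finally show ?thesis .
  next
    case 3
    have "3 gchoose 2 = (3::real)" "(1::real) gchoose 2 = 0"
      using binomial_gbinomial[of 3 2, where ?'a = real] binomial_gbinomial[of 1 2, where ?'a = real]
      by (simp_all add: choose_two)
    then have "(\<Sum>k\<le>r. jac (-1) r k * (y\<^sup>2) ^ k) = 3 + 3 * y ^ 2"
      using 3 by (simp add: jac_def numeral_2_eq_2)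
    also have "\<dots> \<le> 2 * (1 + 4 * y + 6 * y\<^sup>2)"
    proof -
      have "0 \<le> y\<^sup>2" by simp
      then show ?thesis using assms by argo
    qed
    also have "\<dots> \<le> 2 * (1 + y) ^ (2 * r)"
      using 3 assms by (simp add: eval_nat_numeral algebra_simps)
    finally show ?thesis .
  next
    case 4
    have jac: "jac (-1) r k = real (Suc r choose Suc k) * real ((r - 1) choose k)" if "k < r" for k
    proof -
      have "Suc r - Suc k = r - k" by simp
      then have "Suc r choose Suc k = Suc r choose (r - k)"
        using binomial_symmetric[of "Suc k" "Suc r"] that by simp
      then show ?thesis
        using that by (simp add: jac_def binomial_gbinomial of_nat_diff add.commute)
    qed
    have "jac (-1) r r = 0"
      using binomial_gbinomial[of "r - 1" r, where ?'a = real] 4 by (simp add: jac_def of_nat_diff binomial_eq_0)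
    then have "(\<Sum>k\<le>r. jac (-1) r k * (y\<^sup>2) ^ k) = (\<Sum>k<r. jac (-1) r k * (y\<^sup>2) ^ k)"
      by (simp add: lessThan_Suc_atMost [symmetric])
    also have "\<dots> \<le> (\<Sum>k<r. 2 / 3 * real (2 * r choose (2 * k + 1)) * (y\<^sup>2) ^ k)"
    proof (intro sum_mono mult_right_mono)
      fix k assume "k \<in> {..<r}"
      then show "jac (-1) r k \<le> 2 / 3 * real (2 * r choose (2 * k + 1))"
        using binomial_product_le[OF 4, of k] jac[of k] by (simp del: binomial_Suc_Suc)
    qed simp
    also have "\<dots> = 1 / (3 * y) * (2 * (\<Sum>k<r. real (2*r choose (2*k+1)) * y ^ (2*k+1)))"
      using assms by (simp add: sum_distrib_left field_simps flip: power_mult)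
    also have "\<dots> \<le> 1 / (3 * y) * (1 + y) ^ (2 * r)"
      using assms sum_odd_binomial_le[of r y] by (intro mult_left_mono) auto
    also have "\<dots> \<le> 2 * (1 + y) ^ (2 * r)"
      using assms by (intro mult_right_mono) (auto simp: field_simps)
    finally show ?thesis .
  qed
qed

section \<open>Jacobi sums on the unit circle\<close>

lemma gbinomial_sign_le_0:
  fixes a :: real
  assumes "0 \<le> a" "a \<le> 1"
  shows "(- 1) ^ Suc k * (a gchoose Suc k) \<le> 0"
proof (induction k)
  case (Suc k)
  have "real (Suc (Suc k)) * ((- 1) ^ Suc (Suc k) * (a gchoose Suc (Suc k))) =
      (real (Suc k) - a) * ((- 1) ^ Suc k * (a gchoose Suc k))"
    using arg_cong[OF gbinomial_Suc_mult[of "Suc k" a], of "\<lambda>z. (- 1) ^ Suc (Suc k) * z"]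
    by (simp only: power_Suc) (simp add: algebra_simps)
  also have "\<dots> \<le> 0" by (rule mult_nonneg_nonpos[OF _ Suc.IH]) (use assms in simp)
  finally show ?case by (simp only: mult_le_0_iff) (use of_nat_0_less_iff[of "Suc (Suc k)", where ?'a = real] in linarith)
qed (use assms in simp)

lemma abs_gbinomial_le_1:
  fixes a :: real
  assumes "0 \<le> a" "a \<le> 1"
  shows "\<bar>a gchoose k\<bar> \<le> 1"
proof (induction k)
  case (Suc k)
  have "real (Suc k) * \<bar>a gchoose Suc k\<bar> = \<bar>a - real k\<bar> * \<bar>a gchoose k\<bar>"
    using arg_cong[OF gbinomial_Suc_mult[of k a], of abs] by (simp add: abs_mult)
  also have "\<dots> \<le> real (Suc k) * 1" using Suc assms by (intro mult_mono) auto
  finally show ?case by simp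
qed simp

text \<open>For \<open>b\<close> between 1 and 2 the signs of the binomial coefficients alternate
  except at \<open>k = 1\<close>. So the sum is the alternating partial sum, known in closed form
  and nonpositive for \<open>N >= 1\<close>, plus the correction \<open>2 * b\<close>.\<close>

lemma sum_abs_gbinomial_le:
  fixes b :: real
  assumes "1 \<le> b" "b \<le> 2"
  shows "(\<Sum>k\<le>N. \<bar>b gchoose k\<bar>) \<le> 2 * b"
proof -
  have abs: "\<bar>b gchoose k\<bar> = (b gchoose k) * (- 1) ^ k + (if k = 1 then 2 * b else 0)" for k
  proof -
    consider "k = 0" | "k = 1" | j where "k = Suc (Suc j)" by (metis One_nat_def not0_implies_Suc)
    then show ?thesis
    proof cases
      case 3
      have "b gchoose k = (b / real k) * ((b - 1) gchoose Suc j)"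
        using gbinomial_absorption'[of k b] 3 by simp
      then have "(b gchoose k) * (- 1) ^ k = - ((b / real k) * ((- 1) ^ Suc j * ((b - 1) gchoose Suc j)))"
        by (simp add: 3)
      moreover have "(b / real k) * ((- 1) ^ Suc j * ((b - 1) gchoose Suc j)) \<le> 0"
        using assms by (intro mult_nonneg_nonpos gbinomial_sign_le_0) auto
      ultimately have "(b gchoose k) * (- 1) ^ k \<ge> 0" by simp
      then have "(b gchoose k) * (- 1) ^ k = \<bar>(b gchoose k) * (- 1) ^ k\<bar>" by simp
      then show ?thesis using 3 by (simp add: abs_mult power_abs)
    qed (use assms in auto)
  qed
  have "(\<Sum>k\<le>N. \<bar>b gchoose k\<bar>) = (- 1) ^ N * (b - 1 gchoose N) + (\<Sum>k\<le>N. if k = 1 then 2 * b else 0)"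
    unfolding abs sum.distrib gbinomial_sum_lower_neg ..
  also have "\<dots> \<le> 2 * b"
    using assms gbinomial_sign_le_0[of "b - 1" "N - 1"] by (cases N) (auto simp: sum.delta)
  finally show ?thesis .
qed

text \<open>The l1 norm of the coefficients up to \<open>N\<close>. Truncation makes sense of it for
  every series and preserves submultiplicativity, since a coefficient of a product involves no later
  coefficients of the factors.\<close>

definition fps_l1 :: "complex fps \<Rightarrow> nat \<Rightarrow> real" where
  "fps_l1 f N = (\<Sum>i\<le>N. norm (fps_nth f i))"

lemma fps_l1_nonneg: "fps_l1 f N \<ge> 0"
  by (simp add: fps_l1_def sum_nonneg)

lemma fps_l1_mult: "fps_l1 (f * g) N \<le> fps_l1 f N * fps_l1 g N"
proof -
  have "fps_l1 (f * g) N \<le> (\<Sum>n\<le>N. \<Sum>i\<le>n. norm (fps_nth f i) * norm (fps_nth g (n - i)))"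
    unfolding fps_l1_def fps_mult_nth atLeast0AtMost
    by (intro sum_mono order.trans[OF norm_sum]) (simp add: norm_mult)
  also have "\<dots> = (\<Sum>(i,j)\<in>{(i,j). i + j \<le> N}. norm (fps_nth f i) * norm (fps_nth g j))"
    by (rule sum.triangle_reindex_eq [symmetric])
  also have "\<dots> \<le> (\<Sum>(i,j)\<in>{..N}\<times>{..N}. norm (fps_nth f i) * norm (fps_nth g j))"
    by (intro sum_mono2) auto
  also have "\<dots> = fps_l1 f N * fps_l1 g N"
    by (simp add: fps_l1_def sum_product sum.cartesian_product)
  finally show ?thesis .
qed

lemma fps_l1_power: assumes "fps_l1 f N \<le> M" shows "fps_l1 (f ^ k) N \<le> M ^ k"
proof (induction k)
  case 0
  have "fps_l1 1 N = (\<Sum>i\<le>N. if i = 0 then 1 else 0)"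
    unfolding fps_l1_def by (intro sum.cong) auto
  then show ?case by simp
next
  case (Suc k)
  have "fps_l1 (f ^ Suc k) N \<le> fps_l1 f N * fps_l1 (f ^ k) N" by (simp add: fps_l1_mult)
  also have "\<dots> \<le> M * M ^ k"
    using assms Suc fps_l1_nonneg[of f N] fps_l1_nonneg[of "f^k" N] by (intro mult_mono) auto
  finally show ?case by simp
qed

lemma norm_fps_mult_nth_le:
  assumes "\<And>i. i \<le> r \<Longrightarrow> norm (fps_nth g i) \<le> B"
  shows "norm (fps_nth (f * g) r) \<le> fps_l1 f r * B"
proof -
  have "norm (fps_nth (f * g) r) \<le> (\<Sum>i\<le>r. norm (fps_nth f i) * norm (fps_nth g (r - i)))"
    unfolding fps_mult_nth atLeast0AtMost by (rule order.trans[OF norm_sum]) (simp add: norm_mult)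
  also have "\<dots> \<le> (\<Sum>i\<le>r. norm (fps_nth f i) * B)"
    using assms by (intro sum_mono mult_left_mono) auto
  finally show ?thesis by (simp add: fps_l1_def sum_distrib_right)
qed

text \<open>The binomial series of \<open>(1 + w * z) powr a\<close> in the variable
  \<open>z\<close>. Its exponent law is Vandermonde's convolution.\<close>

definition fps_bin :: "complex \<Rightarrow> real \<Rightarrow> complex fps" where
  "fps_bin w a = Abs_fps (\<lambda>k. of_real (a gchoose k) * w ^ k)"

lemma fps_bin_add: "fps_bin w (a + b) = fps_bin w a * fps_bin w b"
proof (rule fps_ext)
  fix k
  have "fps_nth (fps_bin w a * fps_bin w b) k = (\<Sum>i=0..k. of_real ((a gchoose i) * (b gchoose (k - i))) * w ^ k)"
    unfolding fps_mult_nth by (intro sum.cong) (auto simp: fps_bin_def power_add [symmetric] mult_ac)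
  also have "\<dots> = of_real (\<Sum>i=0..k. (a gchoose i) * (b gchoose (k - i))) * w ^ k"
    by (simp add: sum_distrib_right)
  also have "\<dots> = fps_nth (fps_bin w (a + b)) k"
    unfolding gbinomial_Vandermonde by (simp add: fps_bin_def)
  finally show "fps_nth (fps_bin w (a + b)) k = fps_nth (fps_bin w a * fps_bin w b) k" ..
qed

lemma fps_bin_1: "fps_bin w 1 = 1 + fps_const w * fps_X"
proof (rule fps_ext)
  fix k
  show "fps_nth (fps_bin w 1) k = fps_nth (1 + fps_const w * fps_X) k"
    using binomial_gbinomial[of 1 k, where ?'a = real]
    by (cases k) (auto simp: fps_bin_def binomial_eq_0)
qed

lemma fps_bin_of_nat: "fps_bin w (real n) = (1 + fps_const w * fps_X) ^ n"
proof (induction n)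
  case 0
  show ?case by (rule fps_ext) (simp add: fps_bin_def gbinomial_0_left)
next
  case (Suc n)
  then show ?case using fps_bin_add[of w 1 "real n"] by (simp add: fps_bin_1)
qed

lemma sum_jac_eq_fps_nth:
  "(\<Sum>k\<le>r. of_real (jac \<mu> r k) * w ^ k) = fps_nth (fps_bin w (real r + \<mu>) * fps_bin 1 (real r - \<mu>)) r"
  unfolding fps_mult_nth atLeast0AtMost
  by (intro sum.cong) (auto simp: fps_bin_def jac_def mult_ac)

text \<open>
  The generating function is split as \<open>((1 + z) * (1 + w * z)) ^ (r - 1)\<close>, whose coefficients have
  absolute sum at most \<open>(2 + norm (1 + w)) ^ (r - 1)\<close>, times
  \<open>(1 + z) powr (1 - \<nu>) * (1 + w * z) powr (1 + \<nu>)\<close>, whose coefficients are at most \<open>4\<close>.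
\<close>

lemma norm_sum_jac_le:
  fixes w :: complex
  assumes \<nu>: "0 < \<nu>" "\<nu> < 1" and w: "norm w = 1"
  shows "norm (\<Sum>k\<le>r. of_real (jac \<nu> r k) * w ^ k) \<le> 2 * (2 + norm (1 + w)) ^ r"
proof (cases r)
  case (Suc s)
  define f where "f = (1 + fps_const w * fps_X) * (1 + fps_const 1 * fps_X :: complex fps)"
  define g where "g = fps_bin 1 (1 - \<nu>) * fps_bin w (1 + \<nu>)"
  have fg: "fps_bin w (real r + \<nu>) * fps_bin 1 (real r - \<nu>) = f ^ s * g"
    using fps_bin_add[of w "real s" "1 + \<nu>"] fps_bin_add[of 1 "real s" "1 - \<nu>"]
    by (simp add: Suc f_def g_def fps_bin_of_nat power_mult_distrib add_ac add_diff_eq mult_ac)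
  \<comment> \<open>The coefficients of the first factor are at most 1 in absolute value, and those
    of the second have absolute sum at most \<open>2 * (1 + \<nu>)\<close>.\<close>
  have "norm (fps_nth g j) \<le> 4" for j
  proof -
    have "norm (fps_nth g j) \<le> (\<Sum>i\<le>j. \<bar>(1 - \<nu>) gchoose i\<bar> * \<bar>(1 + \<nu>) gchoose (j - i)\<bar>)"
      unfolding g_def fps_mult_nth atLeast0AtMost
      by (rule order.trans[OF norm_sum]) (simp add: norm_mult fps_bin_def norm_power w)
    also have "\<dots> \<le> (\<Sum>i\<le>j. 1 * \<bar>(1 + \<nu>) gchoose (j - i)\<bar>)"
      using \<nu> by (intro sum_mono mult_right_mono abs_gbinomial_le_1) auto
    also have "\<dots> = (\<Sum>i\<le>j. \<bar>(1 + \<nu>) gchoose i\<bar>)"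
      using sum.atLeastAtMost_rev[of "\<lambda>i. \<bar>(1 + \<nu>) gchoose (j - i)\<bar>" 0 j] by (simp add: atMost_atLeast0)
    also have "\<dots> \<le> 2 * (1 + \<nu>)" using \<nu> by (intro sum_abs_gbinomial_le) auto
    finally show ?thesis using \<nu> by simp
  qed
  then have "norm (fps_nth (f ^ s * g) r) \<le> fps_l1 (f ^ s) r * 4"
    by (intro norm_fps_mult_nth_le)
  also have "fps_l1 (f ^ s) r \<le> (2 + norm (1 + w)) ^ s"
  proof (rule fps_l1_power)
    \<comment> \<open>The product has to be expanded before taking absolute values: the two linear
      factors, estimated separately, would only give 4.\<close>
    have f: "f = 1 + fps_const (1 + w) * fps_X + fps_const w * fps_X ^ 2"
      by (simp add: f_def algebra_simps power2_eq_square flip: fps_const_add)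
    have nth: "fps_nth f i = (if i = 0 then 1 else if i = 1 then 1 + w else if i = 2 then w else 0)" for i
      by (auto simp: f fps_X_power_nth)
    have "fps_l1 f r \<le> (\<Sum>i\<in>{..r} \<union> {0,1,2}. norm (fps_nth f i))"
      unfolding fps_l1_def by (intro sum_mono2) auto
    also have "\<dots> = (\<Sum>i\<in>{0,1,2}. norm (fps_nth f i))"
      by (intro sum.mono_neutral_right) (auto simp: nth)
    also have "\<dots> = 2 + norm (1 + w)" using w by (simp add: nth)
    finally show "fps_l1 f r \<le> 2 + norm (1 + w)" .
  qed
  finally have "norm (\<Sum>k\<le>r. of_real (jac \<nu> r k) * w ^ k) \<le> (2 + norm (1 + w)) ^ s * 4"
    unfolding sum_jac_eq_fps_nth fg by simp
  \<comment> \<open>Writing 4 as 2 * 2, one factor 2 is spent on restoring the power that was split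
    off.\<close>
  also have "\<dots> \<le> (2 + norm (1 + w)) ^ s * (2 * (2 + norm (1 + w)))"
    by (intro mult_left_mono) auto
  also have "\<dots> = 2 * (2 + norm (1 + w)) ^ r" by (simp add: Suc)
  finally show ?thesis .
qed (simp add: jac_def)

section \<open>The hypergeometric polynomials\<close>

text \<open>The coefficients of \<open>X_poly m n r\<close> for \<nu> = m / n. The signs of the two
  Pochhammer symbols with negative argument have cancelled, which makes positivity visible.\<close>

definition hyp_coeff :: "real \<Rightarrow> nat \<Rightarrow> nat \<Rightarrow> real" where
  "hyp_coeff \<nu> r k = real (r choose k) * pochhammer (\<nu> + real r + 1 - real k) k / pochhammer (1 - \<nu>) k"

definition hypX :: "real \<Rightarrow> nat \<Rightarrow> complex \<Rightarrow> complex" where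
  "hypX \<nu> r w = (\<Sum>k\<le>r. of_real (hyp_coeff \<nu> r k) * w ^ k)"

text \<open>Written as a sum, and not through the reciprocal of \<open>w\<close>, so that the value
  at 0 is the leading coefficient of \<open>hypX\<close>; the determinant is evaluated
  there.\<close>

definition hypY :: "real \<Rightarrow> nat \<Rightarrow> complex \<Rightarrow> complex" where
  "hypY \<nu> r w = (\<Sum>k\<le>r. of_real (hyp_coeff \<nu> r k) * w ^ (r - k))"

text \<open>\<open>hypG\<close> and \<open>hypH\<close> are the two Gamma quotients in the
  assumption on \<open>Cn\<close> and \<open>Dn\<close>: \<open>hypG\<close> scales the polynomials,
  \<open>hypH\<close> their remainder.\<close>

definition hypG :: "real \<Rightarrow> nat \<Rightarrow> real" where
  "hypG \<nu> r = fact r / pochhammer (1 - \<nu>) r"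

definition hypH :: "real \<Rightarrow> nat \<Rightarrow> real" where
  "hypH \<nu> r = pochhammer (\<nu> + 1) r / fact r"

lemma hypG_pos: "\<nu> < 1 \<Longrightarrow> hypG \<nu> r > 0"
  unfolding hypG_def by (intro divide_pos_pos pochhammer_pos) auto

lemma hypH_pos: "\<nu> > 0 \<Longrightarrow> hypH \<nu> r > 0"
  unfolding hypH_def by (intro divide_pos_pos pochhammer_pos) auto

lemma hyp_coeff_eq_jac:
  assumes "\<nu> < 1" "k \<le> r"
  shows "hyp_coeff \<nu> r k = hypG \<nu> r * jac \<nu> r k"
proof -
  define P where "P = pochhammer (real r + \<nu> - real k + 1) k"
  define A where "A = pochhammer (1 - \<nu>) k"
  define B where "B = pochhammer (1 - \<nu> + real k) (r - k)"
  have AB: "A > 0" "B > 0" using assms unfolding A_def B_def by (auto intro!: pochhammer_pos)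
  have 1: "pochhammer (1 - \<nu>) r = A * B"
    using pochhammer_product'[of "1 - \<nu>" k "r - k"] assms by (simp add: A_def B_def)
  have 2: "(real r - \<nu>) gchoose (r - k) = B / fact (r - k)"
    unfolding gbinomial_pochhammer' B_def using assms by (simp add: of_nat_diff algebra_simps)
  have 3: "(real r + \<nu>) gchoose k = P / fact k"
    unfolding gbinomial_pochhammer' P_def by simp
  have 4: "hyp_coeff \<nu> r k = (fact r / (fact k * fact (r - k))) * P / A"
    using assms by (simp add: hyp_coeff_def P_def A_def binomial_fact algebra_simps)
  show ?thesis
    unfolding 4 hypG_def jac_def 1 2 3 using AB by simp
qed

lemma hyp_coeff_pos:
  assumes "0 < \<nu>" "\<nu> < 1" "k \<le> r"
  shows "hyp_coeff \<nu> r k > 0"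
  using assms jac_pos[of \<nu> k r] hypG_pos[of \<nu> r] by (simp add: hyp_coeff_eq_jac)

lemma of_rat_pochhammer: "of_rat (pochhammer a k) = (pochhammer (of_rat a) k :: real)"
  by (induction k) (simp_all add: pochhammer_Suc of_rat_mult of_rat_add)

lemma of_rat_coeff_X_poly:
  "of_rat (coeff (X_poly m n r) k) = hyp_coeff (real m / real n) r k"
proof -
  have 1: "pochhammer (- real r) k / fact k = (- 1) ^ k * real (r choose k)"
    by (simp add: binomial_gbinomial gbinomial_pochhammer)
  have 2: "pochhammer (- real r - real m / real n) k = (- 1) ^ k * pochhammer (real m / real n + real r + 1 - real k) k"
    using pochhammer_minus[of "real r + real m / real n" k] by (simp add: algebra_simps)
  have "coeff (X_poly m n r) k =
     pochhammer (- of_nat r) k * pochhammer (- of_nat r - of_nat m / of_nat n) k /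
       (pochhammer (1 - of_nat m / of_nat n) k * fact k)"
    using pochhammer_of_nat_eq_0_iff[of r k, where ?'a = rat]
    by (auto simp: X_poly_def coeff_truncate_fps)
  moreover have "real_of_rat (fact k) = fact k" by (metis of_nat_fact of_rat_of_nat_eq)
  ultimately have "of_rat (coeff (X_poly m n r) k) =
     (pochhammer (- real r) k / fact k) * pochhammer (- real r - real m / real n) k /
       pochhammer (1 - real m / real n) k"
    by (simp add: of_rat_pochhammer of_rat_mult of_rat_divide of_rat_diff of_rat_minus)
  then show ?thesis unfolding 1 2 by (simp add: hyp_coeff_def)
qed

text \<open>The coefficients are real and the inverse of \<open>w\<close> is \<open>cnj w\<close>,
  so \<open>hypY\<close> equals \<open>w ^ r\<close> times the conjugate of \<open>hypX\<close> and
  has the same modulus.\<close>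

lemma hypX_hypY_unit_circle_bound:
  assumes \<nu>: "0 < \<nu>" "\<nu> < 1" and w: "norm w = 1"
  shows "norm (hypX \<nu> r w) \<le> 2 * hypG \<nu> r * (2 + norm (1 + w)) ^ r"
    and "norm (hypY \<nu> r w) \<le> 2 * hypG \<nu> r * (2 + norm (1 + w)) ^ r"
proof -
  have "hypX \<nu> r w = of_real (hypG \<nu> r) * (\<Sum>k\<le>r. of_real (jac \<nu> r k) * w ^ k)"
    unfolding hypX_def sum_distrib_left using \<nu> by (intro sum.cong) (auto simp: hyp_coeff_eq_jac)
  then show 1: "norm (hypX \<nu> r w) \<le> 2 * hypG \<nu> r * (2 + norm (1 + w)) ^ r"
    using mult_left_mono[OF norm_sum_jac_le[OF \<nu> w, of r], of "hypG \<nu> r"] hypG_pos[of \<nu> r] \<nu>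
    by (simp add: norm_mult mult_ac)
  have cw: "w * cnj w = 1" using w by (simp add: complex_norm_square [symmetric])
  have "hypY \<nu> r w = w ^ r * cnj (hypX \<nu> r w)"
    unfolding hypX_def hypY_def cnj_sum sum_distrib_left
  proof (intro sum.cong refl)
    fix k assume "k \<in> {..r}"
    then have "w ^ r = w ^ (r - k) * w ^ k" by (simp flip: power_add)
    moreover have "w ^ k * cnj w ^ k = 1" using cw by (simp flip: power_mult_distrib)
    ultimately show "of_real (hyp_coeff \<nu> r k) * w ^ (r - k) = w ^ r * cnj (of_real (hyp_coeff \<nu> r k) * w ^ k)"
      by simp
  qed
  then show "norm (hypY \<nu> r w) \<le> 2 * hypG \<nu> r * (2 + norm (1 + w)) ^ r"
    using 1 by (simp add: norm_mult norm_power w)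
qed

text \<open>Up to the factor \<open>hypG\<close>, the polynomials \<open>hypX\<close> and
  \<open>hypY\<close> are Jacobi sums with parameters \<nu> and -\<nu>. Both are dominated by the
  parameter -1, so a single estimate covers them.\<close>

lemma hypX_hypY_real_bound:
  assumes \<nu>: "0 < \<nu>" "\<nu> < 1" and y: "1/6 \<le> y" "y \<le> 1"
  shows "norm (hypX \<nu> r (of_real (y\<^sup>2))) \<le> 2 * hypG \<nu> r * (1 + y) ^ (2 * r)"
    and "norm (hypY \<nu> r (of_real (y\<^sup>2))) \<le> 2 * hypG \<nu> r * (1 + y) ^ (2 * r)"
proof -
  have *: "0 \<le> (\<Sum>k\<le>r. jac \<mu> r k * (y\<^sup>2) ^ k)" "(\<Sum>k\<le>r. jac \<mu> r k * (y\<^sup>2) ^ k) \<le> 2 * (1 + y) ^ (2 * r)"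
    if "\<bar>\<mu>\<bar> < 1" for \<mu>
  proof -
    show "0 \<le> (\<Sum>k\<le>r. jac \<mu> r k * (y\<^sup>2) ^ k)"
      using jac_pos[OF that] y by (intro sum_nonneg mult_nonneg_nonneg) (auto intro: less_imp_le)
    show "(\<Sum>k\<le>r. jac \<mu> r k * (y\<^sup>2) ^ k) \<le> 2 * (1 + y) ^ (2 * r)"
      using sum_jac_le[OF that, of "y\<^sup>2" r] sum_jac_minus_1_le[OF y(1), of r] y by (simp add: power_le_one)
  qed
  have X: "hypX \<nu> r (of_real (y\<^sup>2)) = of_real (hypG \<nu> r * (\<Sum>k\<le>r. jac \<nu> r k * (y\<^sup>2) ^ k))"
    unfolding hypX_def sum_distrib_left of_real_sum using \<nu>
    by (intro sum.cong) (auto simp: hyp_coeff_eq_jac)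
  have "hypY \<nu> r (of_real (y\<^sup>2)) = (\<Sum>k\<le>r. of_real (hyp_coeff \<nu> r (r - k)) * of_real (y\<^sup>2) ^ k)"
    unfolding hypY_def atMost_atLeast0 by (subst sum.atLeastAtMost_rev) (auto intro!: sum.cong)
  also have "\<dots> = of_real (hypG \<nu> r * (\<Sum>k\<le>r. jac (- \<nu>) r k * (y\<^sup>2) ^ k))"
    unfolding sum_distrib_left of_real_sum using \<nu>
    by (intro sum.cong) (auto simp: hyp_coeff_eq_jac jac_reflect)
  finally have Y: "hypY \<nu> r (of_real (y\<^sup>2)) = of_real (hypG \<nu> r * (\<Sum>k\<le>r. jac (- \<nu>) r k * (y\<^sup>2) ^ k))" .
  have G: "hypG \<nu> r > 0" using hypG_pos \<nu> by blast
  show "norm (hypX \<nu> r (of_real (y\<^sup>2))) \<le> 2 * hypG \<nu> r * (1 + y) ^ (2 * r)"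
    unfolding X norm_of_real using *[of \<nu>] G \<nu> by (simp add: abs_mult)
  show "norm (hypY \<nu> r (of_real (y\<^sup>2))) \<le> 2 * hypG \<nu> r * (1 + y) ^ (2 * r)"
    unfolding Y norm_of_real using *[of "- \<nu>"] G \<nu> by (simp add: abs_mult)
qed

lemma hypX_1: assumes "\<nu> < 1" shows "hypX \<nu> r 1 = of_real (hypG \<nu> r * real (2 * r choose r))"
proof -
  have "hypX \<nu> r 1 = of_real (hypG \<nu> r * (\<Sum>k\<le>r. jac \<nu> r k))"
    unfolding hypX_def sum_distrib_left of_real_sum using assms
    by (intro sum.cong) (auto simp: hyp_coeff_eq_jac)
  then show ?thesis by (simp add: sum_jac)
qed

section \<open>Partial fraction form of the coefficients\<close>

lemma alternating_binomial_Suc: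
  fixes g :: "nat \<Rightarrow> real"
  shows "(\<Sum>i\<le>Suc r. (- 1) ^ i * real (Suc r choose i) * g i) =
    (\<Sum>i\<le>r. (- 1) ^ i * real (r choose i) * g i) - (\<Sum>i\<le>r. (- 1) ^ i * real (r choose i) * g (Suc i))"
proof -
  have "(\<Sum>i\<le>Suc r. (- 1) ^ i * real (Suc r choose i) * g i) =
     g 0 + (\<Sum>i\<le>r. (- 1) ^ Suc i * (real (r choose i) + real (r choose Suc i)) * g (Suc i))"
    by (subst sum.atMost_Suc_shift) (simp del: sum.atMost_Suc)
  also have "\<dots> = (g 0 + (\<Sum>i\<le>r. (- 1) ^ Suc i * real (r choose Suc i) * g (Suc i)))
      - (\<Sum>i\<le>r. (- 1) ^ i * real (r choose i) * g (Suc i))"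
    by (simp add: algebra_simps sum.distrib sum_negf sum_subtractf)
  also have "g 0 + (\<Sum>i\<le>r. (- 1) ^ Suc i * real (r choose Suc i) * g (Suc i)) =
      (\<Sum>i\<le>Suc r. (- 1) ^ i * real (r choose i) * g i)"
    by (subst sum.atMost_Suc_shift) simp
  finally show ?thesis by (simp add: binomial_eq_0)
qed

text \<open>The partial fraction decomposition of the reciprocal of
  \<open>pochhammer z (Suc r)\<close>. Pascal's rule reduces it to the case \<open>r\<close> at
  \<open>z\<close> and at \<open>z + 1\<close>, hence the induction with arbitrary
  \<open>z\<close>.\<close>

lemma alternating_binomial_reciprocal_sum:
  fixes z :: real
  assumes "\<And>i. i \<le> r \<Longrightarrow> z + real i \<noteq> 0"
  shows "(\<Sum>i\<le>r. (- 1) ^ i * real (r choose i) * (1 / (z + real i))) = fact r / pochhammer z (Suc r)"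
  using assms
proof (induction r arbitrary: z)
  case (Suc r)
  have nz: "z + real i \<noteq> 0" if "i \<le> Suc r" for i using Suc.prems that by blast
  have nz': "z + 1 + real i \<noteq> 0" if "i \<le> r" for i using nz[of "Suc i"] that by (simp add: algebra_simps)
  have nzr: "z \<noteq> 0" "z + (1 + real r) \<noteq> 0" using nz[of 0] nz[of "Suc r"] by auto
  define P where "P = pochhammer (z + 1) r"
  have P: "P \<noteq> 0" unfolding P_def pochhammer_eq_0_iff using nz'
    by (metis add.commute add.inverse_inverse add_eq_0_iff order_less_imp_le)
  have "(\<Sum>i\<le>Suc r. (- 1) ^ i * real (Suc r choose i) * (1 / (z + real i))) =
      fact r / pochhammer z (Suc r) - (\<Sum>i\<le>r. (- 1) ^ i * real (r choose i) * (1 / (z + real (Suc i))))"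
    unfolding alternating_binomial_Suc using nz by (subst Suc.IH) auto
  also have "(\<Sum>i\<le>r. (- 1) ^ i * real (r choose i) * (1 / (z + real (Suc i)))) = fact r / pochhammer (z + 1) (Suc r)"
    using Suc.IH[of "z + 1"] nz' by (simp add: algebra_simps)
  also have "pochhammer z (Suc r) = z * P" by (simp add: pochhammer_rec P_def)
  also have "pochhammer (z + 1) (Suc r) = P * (z + (1 + real r))" by (simp add: pochhammer_Suc P_def algebra_simps)
  also have "fact r / (z * P) - fact r / (P * (z + (1 + real r))) = fact (Suc r) / (z * P * (z + (1 + real r)))"
    using P nzr by (simp add: divide_simps) (simp add: algebra_simps)
  also have "z * P * (z + (1 + real r)) = pochhammer z (Suc (Suc r))"
    unfolding pochhammer_rec[of z "Suc r"] pochhammer_Suc[of "z + 1" r] P_def by (simp add: algebra_simps)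
  finally show ?case .
qed simp

text \<open>Formally the Beta integral of \<open>(1 - t) ^ r * t powr (l - r + \<nu> - 1)\<close>
  over (0, 1), expanded termwise. For \<open>l < r\<close> that integral diverges at 0, but the
  finite sum keeps its analytically continued value.\<close>

definition pfrac :: "real \<Rightarrow> nat \<Rightarrow> nat \<Rightarrow> real" where
  "pfrac \<nu> r l = (\<Sum>i\<le>r. (- 1) ^ i * real (r choose i) * (1 / (real i + real l - real r + \<nu>)))"

lemma nonint_shift_nonzero:
  assumes "0 < \<nu>" "\<nu> < (1::real)"
  shows "real i + real l - real r + \<nu> \<noteq> 0"
proof
  assume "real i + real l - real r + \<nu> = 0"
  then have "\<nu> = of_int (int r - int i - int l)" by simp
  with assms have "0 < int r - int i - int l" "int r - int i - int l < 1" by (metis of_int_0_less_iff) (metis \<open>\<nu> = _\<close> assms(2) of_int_less_1_iff)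
  then show False by simp
qed

text \<open>The denominator \<open>pochhammer (\<nu> - real k) (Suc r)\<close> splits at the sign
  change of its factors. The negative ones give \<open>pochhammer (1 - \<nu>) k\<close> up to sign;
  the positive ones cancel against the initial factors of \<open>pochhammer \<nu> (Suc r)\<close>,
  which comes from \<open>\<nu> * hypH \<nu> r\<close>.\<close>

lemma hyp_coeff_eq_pfrac:
  assumes \<nu>: "0 < \<nu>" "\<nu> < 1" and k: "k \<le> r"
  shows "\<nu> * hypH \<nu> r * ((- 1) ^ k * real (r choose k) * pfrac \<nu> r (r - k)) = hyp_coeff \<nu> r k"
proof -
  define A where "A = pochhammer (1 - \<nu>) k"
  define B where "B = pochhammer \<nu> (Suc r - k)"
  define C where "C = pochhammer (\<nu> + real r + 1 - real k) k"
  have AB: "A > 0" "B > 0" using \<nu> unfolding A_def B_def by (auto intro!: pochhammer_pos)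
  have "pfrac \<nu> r (r - k) = (\<Sum>i\<le>r. (- 1) ^ i * real (r choose i) * (1 / ((\<nu> - real k) + real i)))"
    unfolding pfrac_def using k by (intro sum.cong) (auto simp: of_nat_diff algebra_simps)
  also have "\<dots> = fact r / pochhammer (\<nu> - real k) (Suc r)"
  proof (rule alternating_binomial_reciprocal_sum)
    fix i show "\<nu> - real k + real i \<noteq> 0"
      using nonint_shift_nonzero[OF \<nu>, of i 0 k] by (simp add: algebra_simps)
  qed
  also have "pochhammer (\<nu> - real k) (Suc r) = pochhammer (\<nu> - real k) k * B"
    using pochhammer_product'[of "\<nu> - real k" k "Suc r - k"] k by (simp add: B_def)
  also have "pochhammer (\<nu> - real k) k = (- 1) ^ k * A"
    using pochhammer_minus[of "real k - \<nu>" k] by (simp add: A_def algebra_simps)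
  finally have 1: "pfrac \<nu> r (r - k) = fact r / ((- 1) ^ k * A * B)" .
  have "\<nu> * hypH \<nu> r = pochhammer \<nu> (Suc r) / fact r"
    by (simp add: hypH_def pochhammer_rec)
  also have "pochhammer \<nu> (Suc r) = B * C"
    using pochhammer_product'[of \<nu> "Suc r - k" k] k by (simp add: B_def C_def of_nat_diff algebra_simps)
  finally have 2: "\<nu> * hypH \<nu> r = B * C / fact r" .
  have "(- 1) ^ k * (- 1) ^ k = (1::real)" by (simp flip: power_mult_distrib)
  then show ?thesis unfolding 1 2 hyp_coeff_def A_def [symmetric] C_def [symmetric]
    using AB by (simp add: field_simps)
qed

section \<open>The remainder integral\<close>

text \<open>
  The integrand \<open>((1 - t) * (t - w) / t) ^ r * t powr \<nu> / t\<close> of the remainder, pulled back along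
  \<open>t = exp (s * \<omega>)\<close> with \<open>w = exp \<omega>\<close> and integrated termwise. This path is a segment for real \<open>w\<close>
  and an arc of the unit circle for \<open>norm w = 1\<close>.
\<close>

definition primF :: "real \<Rightarrow> nat \<Rightarrow> complex \<Rightarrow> real \<Rightarrow> complex" where
  "primF \<nu> r \<omega> s = (\<Sum>i\<le>r. \<Sum>l\<le>r. of_real ((- 1) ^ i * real (r choose i) * real (r choose l)) * (- exp \<omega>) ^ (r - l) *
      (exp (of_real s * \<omega> * of_real (real i + real l - real r + \<nu>)) / of_real (real i + real l - real r + \<nu>)))"

lemma primF_deriv:
  assumes \<nu>: "0 < \<nu>" "\<nu> < 1"
  shows "(primF \<nu> r \<omega> has_vector_derivative
     \<omega> * exp (of_real (s * \<nu>) * \<omega>) * ((1 - exp (of_real s * \<omega>)) * (exp (of_real s * \<omega>) - exp \<omega>) / exp (of_real s * \<omega>)) ^ r) (at s)"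
proof -
  define t where "t = exp (of_real s * \<omega>)"
  define e where "e i l = real i + real l - real r + \<nu>" for i l
  have t: "t \<noteq> 0" by (simp add: t_def)
  \<comment> \<open>Since \<nu> is no integer, no exponent vanishes and the termwise integration
    produces no logarithm.\<close>
  have nz: "e i l \<noteq> 0" for i l unfolding e_def by (rule nonint_shift_nonzero[OF \<nu>])
  have exp_e: "exp (of_real s * \<omega> * of_real (e i l)) = exp (of_real (s * \<nu>) * \<omega>) * (t ^ i * t ^ l / t ^ r)" for i l
    by (simp add: t_def e_def exp_add exp_diff distrib_left right_diff_distrib exp_of_nat_mult [symmetric] field_simps)
  have D: "((\<lambda>s. exp (of_real s * \<omega> * of_real (e i l)) / of_real (e i l)) has_vector_derivative
      (\<omega> * exp (of_real (s * \<nu>) * \<omega>) * (t ^ i * t ^ l / t ^ r))) (at s)" for i l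
  proof -
    have "((\<lambda>z. exp (z * \<omega> * of_real (e i l)) / of_real (e i l)) has_field_derivative
      \<omega> * exp (of_real s * \<omega> * of_real (e i l))) (at (of_real s))"
      using nz[of i l] by (auto intro!: derivative_eq_intros)
    from has_vector_derivative_real_field[OF this] show ?thesis
      unfolding exp_e by (simp add: mult.assoc)
  qed
  have "(primF \<nu> r \<omega> has_vector_derivative
     (\<Sum>i\<le>r. \<Sum>l\<le>r. of_real ((- 1) ^ i * real (r choose i) * real (r choose l)) * (- exp \<omega>) ^ (r - l) *
        (\<omega> * exp (of_real (s * \<nu>) * \<omega>) * (t ^ i * t ^ l / t ^ r)))) (at s)"
    unfolding primF_def e_def [symmetric]
    by (intro has_vector_derivative_sum has_vector_derivative_mult_right D)
  also have "(\<Sum>i\<le>r. \<Sum>l\<le>r. of_real ((- 1) ^ i * real (r choose i) * real (r choose l)) * (- exp \<omega>) ^ (r - l) *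
        (\<omega> * exp (of_real (s * \<nu>) * \<omega>) * (t ^ i * t ^ l / t ^ r))) =
      \<omega> * exp (of_real (s * \<nu>) * \<omega>) * (((\<Sum>i\<le>r. of_nat (r choose i) * (- t) ^ i * 1 ^ (r - i)) *
         (\<Sum>l\<le>r. of_nat (r choose l) * t ^ l * (- exp \<omega>) ^ (r - l))) / t ^ r)"
    unfolding sum_product
    unfolding sum_distrib_left sum_divide_distrib
    by (intro sum.cong refl) (simp add: power_minus[of t] mult_ac)
  also have "\<dots> = \<omega> * exp (of_real (s * \<nu>) * \<omega>) * ((1 - t) * (t - exp \<omega>) / t) ^ r"
    unfolding binomial_ring [symmetric] by (simp add: power_mult_distrib power_divide)
  finally show ?thesis unfolding t_def .
qed

text \<open>The endpoint \<open>t = 1\<close>: all exponentials are 1, so for fixed \<open>l\<close>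
  the sum over \<open>i\<close> is \<open>pfrac \<nu> r l\<close>, which accompanies the power
  \<open>r - l\<close> of \<open>w\<close>.\<close>

lemma primF_0: 
  "of_real (\<nu> * hypH \<nu> r) * primF \<nu> r \<omega> 0 = hypX \<nu> r (exp \<omega>)" if \<nu>: "0 < \<nu>" "\<nu> < 1"
proof -
  have "primF \<nu> r \<omega> 0 = (\<Sum>l\<le>r. of_real (real (r choose l) * pfrac \<nu> r l) * (- exp \<omega>) ^ (r - l))"
    unfolding primF_def pfrac_def
    by (subst sum.swap) (simp add: sum_distrib_left sum_distrib_right mult_ac)
  also have "\<dots> = (\<Sum>k\<le>r. of_real (real (r choose (r - k)) * pfrac \<nu> r (r - k)) * (- exp \<omega>) ^ k)"
    unfolding atMost_atLeast0 by (subst sum.atLeastAtMost_rev) (auto intro!: sum.cong)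
  also have "\<dots> = (\<Sum>k\<le>r. of_real ((- 1) ^ k * real (r choose k) * pfrac \<nu> r (r - k)) * exp \<omega> ^ k)"
    by (intro sum.cong refl) (simp add: binomial_symmetric [symmetric] power_minus[of "exp \<omega>"])
  finally show ?thesis
    unfolding hypX_def sum_distrib_left mult.assoc [symmetric] of_real_mult [symmetric]
    by (simp only: mult.assoc sum_distrib_left)
       (intro sum.cong refl, simp add: hyp_coeff_eq_pfrac[OF \<nu>, symmetric] mult.assoc)
qed

text \<open>The endpoint \<open>t = w\<close>: the powers of \<open>w\<close> combine to the
  exponent \<open>i + \<nu>\<close>, independent of \<open>l\<close>. Now the sum over
  \<open>l\<close> is the one to collapse to \<open>pfrac\<close>, with the power \<open>i\<close>
  in place of \<open>r - l\<close>; therefore the reversed polynomial appears.\<close>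

lemma primF_1:
  assumes \<nu>: "0 < \<nu>" "\<nu> < 1"
  shows "of_real (\<nu> * hypH \<nu> r) * primF \<nu> r \<omega> 1 = exp (\<omega> * of_real \<nu>) * hypY \<nu> r (exp \<omega>)"
proof -
  have "primF \<nu> r \<omega> 1 = (\<Sum>i\<le>r. exp (\<omega> * of_real \<nu>) * (of_real ((- 1) ^ r * (- 1) ^ i * real (r choose i) * pfrac \<nu> r i) * exp \<omega> ^ i))"
    unfolding primF_def
  proof (intro sum.cong refl)
    fix i
    have "(- exp \<omega>) ^ (r - l) * exp (of_real 1 * \<omega> * of_real (real i + real l - real r + \<nu>)) =
       (- 1) ^ r * (- 1) ^ l * (exp (\<omega> * of_real \<nu>) * exp \<omega> ^ i)" if "l \<le> r" for l
    proof -
      have "exp \<omega> ^ (r - l) * exp (of_real 1 * \<omega> * of_real (real i + real l - real r + \<nu>)) =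
          exp (of_nat (r - l) * \<omega> + \<omega> * of_real (real i + real l - real r + \<nu>))"
        by (simp add: exp_add exp_of_nat_mult)
      also have "of_nat (r - l) * \<omega> + \<omega> * of_real (real i + real l - real r + \<nu>) = \<omega> * of_real \<nu> + of_nat i * \<omega>"
        using that by (simp add: of_nat_diff algebra_simps)
      also have "exp \<dots> = exp (\<omega> * of_real \<nu>) * exp \<omega> ^ i" by (simp add: exp_add exp_of_nat_mult)
      moreover have "(- 1) ^ (r - l) = (- 1) ^ r * (- 1 :: complex) ^ l"
      proof -
        have "(- 1 :: complex) ^ r = (- 1) ^ (r - l) * (- 1) ^ l" using that by (simp flip: power_add)
        moreover have "(- 1 :: complex) ^ l * (- 1) ^ l = 1" by (simp flip: power_mult_distrib)
        ultimately show ?thesis by (simp add: mult.assoc)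
      qed
      ultimately show ?thesis by (simp add: power_minus[of "exp \<omega>"] mult.assoc)
    qed
    then have "(\<Sum>l\<le>r. of_real ((- 1) ^ i * real (r choose i) * real (r choose l)) * (- exp \<omega>) ^ (r - l) *
      (exp (of_real 1 * \<omega> * of_real (real i + real l - real r + \<nu>)) / of_real (real i + real l - real r + \<nu>))) =
      (\<Sum>l\<le>r. of_real ((- 1) ^ i * real (r choose i) * real (r choose l)) *
      ((- 1) ^ r * (- 1) ^ l * (exp (\<omega> * of_real \<nu>) * exp \<omega> ^ i) / of_real (real i + real l - real r + \<nu>)))"
      by (intro sum.cong refl) (simp only: mult.assoc times_divide_eq_right atMost_iff)
    also have "\<dots> = exp (\<omega> * of_real \<nu>) * (of_real ((- 1) ^ r * (- 1) ^ i * real (r choose i) * pfrac \<nu> r i) * exp \<omega> ^ i)"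
      unfolding pfrac_def by (simp add: sum_distrib_left sum_distrib_right mult_ac add_ac)
    finally show "(\<Sum>l\<le>r. of_real ((- 1) ^ i * real (r choose i) * real (r choose l)) * (- exp \<omega>) ^ (r - l) *
      (exp (of_real 1 * \<omega> * of_real (real i + real l - real r + \<nu>)) / of_real (real i + real l - real r + \<nu>))) =
      exp (\<omega> * of_real \<nu>) * (of_real ((- 1) ^ r * (- 1) ^ i * real (r choose i) * pfrac \<nu> r i) * exp \<omega> ^ i)" .
  qed
  also have "\<dots> = exp (\<omega> * of_real \<nu>) * (\<Sum>k\<le>r. of_real ((- 1) ^ k * real (r choose k) * pfrac \<nu> r (r - k)) * exp \<omega> ^ (r - k))"
    unfolding sum_distrib_left atMost_atLeast0
  proof (subst sum.atLeastAtMost_rev, intro sum.cong refl)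
    fix k assume "k \<in> {0..r}"
    then have k: "k \<le> r" by simp
    have "(- 1) ^ r * (- 1) ^ (r - k) = (- 1 :: real) ^ (2 * (r - k)) * (- 1) ^ k"
    proof -
      have "r + (r - k) = 2 * (r - k) + k" using k by simp
      then show ?thesis by (simp only: power_add [symmetric])
    qed
    then have "(- 1) ^ r * (- 1) ^ (r - k) = (- 1 :: real) ^ k" by simp
    then show "exp (\<omega> * of_real \<nu>) * (of_real ((- 1) ^ r * (- 1) ^ (r + 0 - k) * real (r choose (r + 0 - k)) * pfrac \<nu> r (r + 0 - k)) * exp \<omega> ^ (r + 0 - k)) =
      exp (\<omega> * of_real \<nu>) * (of_real ((- 1) ^ k * real (r choose k) * pfrac \<nu> r (r - k)) * exp \<omega> ^ (r - k))"
      using k by (simp add: binomial_symmetric [symmetric] flip: of_real_mult)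
  qed
  finally have 1: "primF \<nu> r \<omega> 1 = exp (\<omega> * of_real \<nu>) * (\<Sum>k\<le>r. of_real ((- 1) ^ k * real (r choose k) * pfrac \<nu> r (r - k)) * exp \<omega> ^ (r - k))" .
  have "of_real (\<nu> * hypH \<nu> r) * (\<Sum>k\<le>r. of_real ((- 1) ^ k * real (r choose k) * pfrac \<nu> r (r - k)) * exp \<omega> ^ (r - k)) = hypY \<nu> r (exp \<omega>)"
    unfolding hypY_def sum_distrib_left mult.assoc [symmetric] of_real_mult [symmetric]
    by (simp only: mult.assoc sum_distrib_left)
       (intro sum.cong refl, simp add: hyp_coeff_eq_pfrac[OF \<nu>, symmetric] mult.assoc)
  then show ?thesis unfolding 1 by (simp only: mult.left_commute[of "of_real (\<nu> * hypH \<nu> r)"])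
qed

text \<open>A mean value inequality in place of an integral: \<phi> is an antiderivative of a
  majorant of the integrand, and the remainder is, up to sign, \<open>\<nu> * hypH \<nu> r\<close>
  times the increment of \<open>primF\<close>.\<close>

lemma hyp_remainder_bound:
  fixes \<phi> :: "real \<Rightarrow> real"
  assumes \<nu>: "0 < \<nu>" "\<nu> < 1"
    and \<phi>: "\<And>s. (\<phi> has_vector_derivative \<phi>' s) (at s)"
    and bnd: "\<And>s. 0 < s \<Longrightarrow> s < 1 \<Longrightarrow>
      norm (\<omega> * exp (of_real (s * \<nu>) * \<omega>) * ((1 - exp (of_real s * \<omega>)) * (exp (of_real s * \<omega>) - exp \<omega>) / exp (of_real s * \<omega>)) ^ r) \<le> \<phi>' s"
  shows "norm (hypX \<nu> r (exp \<omega>) - exp (\<omega> * of_real \<nu>) * hypY \<nu> r (exp \<omega>)) \<le> \<nu> * hypH \<nu> r * (\<phi> 1 - \<phi> 0)"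
proof -
  have "norm (primF \<nu> r \<omega> 1 - primF \<nu> r \<omega> 0) \<le> \<phi> 1 - \<phi> 0"
    by (rule differentiable_bound_general[where \<phi>' = \<phi>', OF _ _ _ primF_deriv[OF \<nu>] \<phi> bnd])
       (auto intro!: continuous_at_imp_continuous_on has_vector_derivative_continuous[OF primF_deriv[OF \<nu>]] has_vector_derivative_continuous[OF \<phi>])
  moreover have "hypX \<nu> r (exp \<omega>) - exp (\<omega> * of_real \<nu>) * hypY \<nu> r (exp \<omega>) =
      - (of_real (\<nu> * hypH \<nu> r) * (primF \<nu> r \<omega> 1 - primF \<nu> r \<omega> 0))"
    unfolding primF_0[OF \<nu>, symmetric] primF_1[OF \<nu>, symmetric] by (simp only: right_diff_distrib minus_diff_eq)
  ultimately show ?thesis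
    using \<nu> hypH_pos[of \<nu> r]
    by (simp only: norm_minus_cancel norm_mult norm_of_real) (simp add: abs_mult mult_left_mono)
qed

text \<open>With \<open>x = y\<^sup>2\<close>, the factor \<open>(1 - t) * (t - x) / t\<close>
  equals \<open>(1 - y)\<^sup>2 - (t - y)\<^sup>2 / t\<close>, so it is largest at the geometric
  mean of the endpoints. The remaining \<open>t powr (\<nu> - 1)\<close> integrates to
  \<open>(1 - x powr \<nu>) / \<nu>\<close>.\<close>

lemma hyp_remainder_real:
  assumes \<nu>: "0 < \<nu>" "\<nu> < 1" and y: "0 < y" "y < 1"
  shows "norm (hypX \<nu> r (of_real (y\<^sup>2)) - of_real (y\<^sup>2 powr \<nu>) * hypY \<nu> r (of_real (y\<^sup>2)))
     \<le> hypH \<nu> r * (1 - y) ^ (2 * r) * (1 - y\<^sup>2 powr \<nu>)"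
proof -
  define x where "x = y\<^sup>2"
  have x: "0 < x" "x < 1" using y by (auto simp: x_def power_less_one_iff)
  define l where "l = ln x"
  have l: "l < 0" "exp l = x" using x by (auto simp: l_def)
  define \<phi> where "\<phi> s = - ((1 - y) ^ (2 * r) / \<nu>) * exp (s * \<nu> * l)" for s
  define \<phi>' where "\<phi>' s = - ((1 - y) ^ (2 * r)) * l * exp (s * \<nu> * l)" for s
  have d: "(\<phi> has_vector_derivative \<phi>' s) (at s)" for s
    unfolding has_real_derivative_iff_has_vector_derivative [symmetric] \<phi>_def \<phi>'_def
    using \<nu> by (auto intro!: derivative_eq_intros)
  have "norm (of_real l * exp (of_real (s * \<nu>) * of_real l) *
      ((1 - exp (of_real s * of_real l)) * (exp (of_real s * of_real l) - exp (of_real l)) / exp (of_real s * of_real l)) ^ r :: complex) \<le> \<phi>' s"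
    if s: "0 < s" "s < 1" for s
  proof -
    define t where "t = exp (s * l)"
    have t: "t > 0" "t \<le> 1" "x \<le> t"
    proof -
      have "1 * l \<le> s * l" using s l by (intro mult_right_mono_neg) auto
      then show "x \<le> t" unfolding t_def l(2) [symmetric] by simp
    qed (use s l in \<open>auto simp: t_def mult_le_0_iff\<close>)
    have nn: "0 \<le> (1 - t) * (t - x) / t" using t by simp
    have "(1 - y)\<^sup>2 - (1 - t) * (t - x) / t = (t - y)\<^sup>2 / t"
      using t by (simp add: x_def power2_eq_square field_simps)
    moreover have "0 \<le> (t - y)\<^sup>2 / t" using t by simp
    ultimately have le: "(1 - t) * (t - x) / t \<le> (1 - y)\<^sup>2" by simp
    have eq: "of_real l * exp (of_real (s * \<nu>) * of_real l) *
      ((1 - exp (of_real s * of_real l)) * (exp (of_real s * of_real l) - exp (of_real l)) / exp (of_real s * of_real l)) ^ r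
      = (of_real (l * exp (s * \<nu> * l) * ((1 - t) * (t - x) / t) ^ r) :: complex)"
      unfolding t_def l(2) [symmetric] by (simp add: exp_of_real [symmetric])
    have "norm (of_real (l * exp (s * \<nu> * l) * ((1 - t) * (t - x) / t) ^ r) :: complex)
      = (- l) * exp (s * \<nu> * l) * ((1 - t) * (t - x) / t) ^ r"
      unfolding norm_of_real abs_mult[of _ "((1 - t) * (t - x) / t) ^ r"] abs_mult[of l] using l nn by (simp add: abs_of_nonneg[OF zero_le_power[OF nn]])
    also have "\<dots> \<le> (- l) * exp (s * \<nu> * l) * ((1 - y)\<^sup>2) ^ r"
      using l nn le by (intro mult_left_mono power_mono mult_nonneg_nonneg) auto
    also have "\<dots> = \<phi>' s" by (simp add: \<phi>'_def power_mult)
    finally show ?thesis unfolding eq .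
  qed
  from hyp_remainder_bound[OF \<nu> d this]
  have "norm (hypX \<nu> r (exp (of_real l)) - exp (of_real l * of_real \<nu>) * hypY \<nu> r (exp (of_real l))) \<le> \<nu> * hypH \<nu> r * (\<phi> 1 - \<phi> 0)"
    by blast
  also have "exp (of_real l) = (of_real x :: complex)" using l by (simp add: exp_of_real)
  also have "exp (of_real l * of_real \<nu>) = (of_real (x powr \<nu>) :: complex)"
    using x by (simp add: powr_def l_def exp_of_real [symmetric] mult.commute)
  also have "\<nu> * hypH \<nu> r * (\<phi> 1 - \<phi> 0) = hypH \<nu> r * (1 - y) ^ (2 * r) * (1 - x powr \<nu>)"
    using \<nu> x by (simp add: \<phi>_def powr_def l_def field_simps)
  finally show ?thesis unfolding x_def .
qed

lemma cis_add_cis: "cis a + cis b = cis ((a + b) / 2) * of_real (2 * cos ((a - b) / 2))"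
proof -
  have a: "a = (a + b) / 2 + (a - b) / 2" and b: "b = (a + b) / 2 + (- ((a - b) / 2))" by (simp_all add: field_simps)
  have "cis a + cis b = cis ((a + b) / 2) * (cis ((a - b) / 2) + cis (- ((a - b) / 2)))"
    by (subst a, subst b) (simp only: distrib_left cis_mult)
  also have "cis ((a - b) / 2) + cis (- ((a - b) / 2)) = of_real (2 * cos ((a - b) / 2))"
    by (simp add: complex_eq_iff)
  finally show ?thesis .
qed

lemma norm_1_minus_cis: "(norm (1 - cis a))\<^sup>2 = 2 - 2 * cos a"
  and norm_1_plus_cis: "(norm (1 + cis a))\<^sup>2 = 2 + 2 * cos a"
  using sin_cos_squared_add[of a] unfolding cmod_power2 by (simp_all add: power2_eq_square algebra_simps)

text \<open>On the arc, \<open>(1 - t) * (t - w) / t\<close> has modulus \<open>2 * cos ((2 * s - 1)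
  * \<theta> / 2) - 2 * cos (\<theta> / 2)\<close>, which is largest at the midpoint of the arc. The
  other factors of the integrand have modulus \<bar>\<theta>\<bar>, so the majorant is
  constant.\<close>

lemma hyp_remainder_cis:
  assumes \<nu>: "0 < \<nu>" "\<nu> < 1" and \<theta>: "\<bar>\<theta>\<bar> \<le> pi"
  shows "norm (hypX \<nu> r (cis \<theta>) - cis (\<nu> * \<theta>) * hypY \<nu> r (cis \<theta>))
     \<le> \<nu> * hypH \<nu> r * \<bar>\<theta>\<bar> * (2 - 2 * cos (\<theta> / 2)) ^ r"
proof -
  define M where "M = 2 - 2 * cos (\<theta> / 2)"
  have d: "((\<lambda>s. \<bar>\<theta>\<bar> * M ^ r * s) has_vector_derivative \<bar>\<theta>\<bar> * M ^ r) (at s)" for s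
    unfolding has_real_derivative_iff_has_vector_derivative [symmetric]
    by (auto intro!: derivative_eq_intros)
  have "norm (\<i> * of_real \<theta> * exp (of_real (s * \<nu>) * (\<i> * of_real \<theta>)) *
      ((1 - exp (of_real s * (\<i> * of_real \<theta>))) * (exp (of_real s * (\<i> * of_real \<theta>)) - exp (\<i> * of_real \<theta>)) / exp (of_real s * (\<i> * of_real \<theta>))) ^ r :: complex) \<le> \<bar>\<theta>\<bar> * M ^ r"
    if s: "0 < s" "s < 1" for s
  proof -
    have e: "exp (of_real u * (\<i> * of_real \<theta>)) = cis (u * \<theta>)" for u
      by (simp add: cis_conv_exp mult_ac)
    have e1: "exp (\<i> * of_real \<theta>) = cis \<theta>" by (simp add: cis_conv_exp)
    have "(1 - cis (s * \<theta>)) * (cis (s * \<theta>) - cis \<theta>) / cis (s * \<theta>) = (cis 0 + cis \<theta>) - (cis (s * \<theta>) + cis \<theta> / cis (s * \<theta>))"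
    proof -
      have "(1 - t) * (t - w) / t = (1 + w) - (t + w / t)" if "t \<noteq> 0" for t w :: complex
      proof -
        have "(1 - t) * (t - w) = ((1 + w) - (t + w / t)) * t" 
        proof -
          have *: "w / t * t = w" using that by simp
          show ?thesis unfolding left_diff_distrib distrib_right * by (simp add: algebra_simps)
        qed
        then show ?thesis using nonzero_mult_div_cancel_right[OF that] by (simp only:)
      qed
      from this[OF cis_neq_zero] show ?thesis by (simp only: cis_zero)
    qed
    also have "cis \<theta> / cis (s * \<theta>) = cis ((1 - s) * \<theta>)" by (simp add: cis_divide algebra_simps)
    also have "(cis 0 + cis \<theta>) - (cis (s * \<theta>) + cis ((1 - s) * \<theta>)) =
      cis (\<theta> / 2) * of_real (2 * cos (\<theta> / 2) - 2 * cos ((2 * s - 1) * \<theta> / 2))"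
      unfolding cis_add_cis by (simp add: algebra_simps)
    finally have *: "norm ((1 - cis (s * \<theta>)) * (cis (s * \<theta>) - cis \<theta>) / cis (s * \<theta>)) =
       \<bar>2 * cos (\<theta> / 2) - 2 * cos ((2 * s - 1) * \<theta> / 2)\<bar>"
      by (simp only: norm_mult norm_cis norm_of_real mult_1)
    have "cos \<bar>\<theta> / 2\<bar> \<le> cos \<bar>(2 * s - 1) * \<theta> / 2\<bar>"
    proof (rule cos_monotone_0_pi_le)
      have "\<bar>2 * s - 1\<bar> * \<bar>\<theta>\<bar> \<le> 1 * \<bar>\<theta>\<bar>" using s by (intro mult_right_mono) auto
      then show "\<bar>(2 * s - 1) * \<theta> / 2\<bar> \<le> \<bar>\<theta> / 2\<bar>" by (simp add: abs_mult)
      show "\<bar>\<theta> / 2\<bar> \<le> pi" using \<theta> pi_ge_zero by auto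
    qed simp
    then have "cos (\<theta> / 2) \<le> cos ((2 * s - 1) * \<theta> / 2)" by (simp only: cos_abs_real)
    moreover have "cos ((2 * s - 1) * \<theta> / 2) \<le> 1" by simp
    ultimately have "\<bar>2 * cos (\<theta> / 2) - 2 * cos ((2 * s - 1) * \<theta> / 2)\<bar> \<le> M" unfolding M_def by simp
    then show ?thesis unfolding e e1 norm_mult norm_power *
      by (simp add: norm_mult mult_left_mono power_mono)
  qed
  then have "norm (hypX \<nu> r (exp (\<i> * of_real \<theta>)) - exp (\<i> * of_real \<theta> * of_real \<nu>) * hypY \<nu> r (exp (\<i> * of_real \<theta>))) \<le> \<nu> * hypH \<nu> r * (\<bar>\<theta>\<bar> * M ^ r * 1 - \<bar>\<theta>\<bar> * M ^ r * 0)"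
    by (rule hyp_remainder_bound[OF \<nu> d])
  moreover have "exp (\<i> * of_real \<theta>) = cis \<theta>" "exp (\<i> * of_real \<theta> * of_real \<nu>) = cis (\<nu> * \<theta>)"
    by (simp_all only: cis_conv_exp of_real_mult mult_ac)
  ultimately show ?thesis by (simp only: M_def mult_1_right mult_zero_right diff_zero mult.assoc)
qed

text \<open>Converts the arc length in \<open>hyp_remainder_cis\<close> into
  \<open>norm (1 - w powr \<nu>)\<close>. The chord is twice the sine of the half angle
  \<open>u\<close>, and \<open>u - u ^ 3 / 6 >= u / 2\<close> because \<open>u\<^sup>2 <= 3\<close>.
  This gives the factor 2, which is relaxed to 5/2.\<close>

lemma abs_angle_le_chord:
  assumes "\<bar>\<psi>\<bar> \<le> pi"
  shows "\<bar>\<psi>\<bar> \<le> 5 / 2 * norm (1 - cis \<psi>)"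
proof -
  define u where "u = \<bar>\<psi>\<bar> / 2"
  have "pi \<le> 16/5" by (rule order.trans[OF pi_approx(2)]) simp
  then have u: "0 \<le> u" "u \<le> 8/5" using assms unfolding u_def by argo+
  have "2 - 2 * cos \<psi> = (2 * sin u)\<^sup>2"
  proof -
    have "cos \<psi> = cos (2 * u)" by (simp add: u_def)
    also have "\<dots> = 1 - 2 * (sin u)\<^sup>2" by (rule cos_double_sin)
    finally show ?thesis by (simp add: power2_eq_square)
  qed
  moreover have sin_nonneg: "sin u \<ge> 0" using assms pi_ge_zero unfolding u_def by (intro sin_ge_zero) auto
  ultimately have n: "norm (1 - cis \<psi>) = 2 * sin u"
    using norm_1_minus_cis[of \<psi>] power2_eq_iff_nonneg[of "norm (1 - cis \<psi>)" "2 * sin u"] by simp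
  have "(\<Sum>m<3. sin_coeff m * u ^ m) = u" "fact 3 = (6::real)"
    by (simp_all add: numeral_3_eq_3 sin_coeff_def fact_numeral)
  then have "\<bar>sin u - u\<bar> \<le> inverse 6 * u ^ 3"
    using Maclaurin_sin_bound[of u 3] abs_of_nonneg[OF u(1)] by (simp only:)
  then have "u - u ^ 3 / 6 \<le> sin u" unfolding abs_le_iff by (simp add: algebra_simps)
  moreover have "u / 2 \<le> u - u ^ 3 / 6"
  proof -
    have "u * u \<le> 8/5 * (8/5)" by (rule mult_mono'[OF u(2) u(2) u(1) u(1)])
    also have "\<dots> \<le> (3::real)" by simp
    finally have "u * u \<le> 3" .
    from mult_left_mono[OF this u(1)] show ?thesis by (simp add: power3_eq_cube)
  qed
  ultimately have "u / 2 \<le> sin u" by (rule order.trans[rotated])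
  then have "\<bar>\<psi>\<bar> \<le> 4 * sin u" by (simp add: u_def)
  with sin_nonneg show ?thesis unfolding n by simp
qed

section \<open>Estimates and determinant\<close>

lemma norm_1_minus_of_real: "norm (1 - of_real x :: complex) = \<bar>1 - x\<bar>"
  and norm_1_plus_of_real: "norm (1 + of_real x :: complex) = \<bar>1 + x\<bar>"
  by (metis norm_of_real of_real_1 of_real_diff) (metis norm_of_real of_real_1 of_real_add)

lemma unit_circle_cis_Arg:
  assumes "norm w = 1"
  shows "w = cis (Arg w)" "csqrt w = cis (Arg w / 2)" "w powr of_real \<nu> = cis (\<nu> * Arg w)" "\<bar>Arg w\<bar> \<le> pi"
proof -
  have w: "w \<noteq> 0" using assms by auto
  show "w = cis (Arg w)" using cis_Arg[OF w] assms by (simp add: sgn_div_norm)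
  show "csqrt w = cis (Arg w / 2)" unfolding csqrt_principal by (simp add: assms)
  have "Ln w = \<i> * of_real (Arg w)"
    using w assms by (simp add: complex_eq_iff Arg_eq_Im_Ln)
  then show "w powr of_real \<nu> = cis (\<nu> * Arg w)"
    using w by (simp add: powr_def cis_conv_exp mult_ac)
  show "\<bar>Arg w\<bar> \<le> pi" using Arg_bounded[of w] by (simp add: abs_le_iff)
qed

lemma hyp_remainder:
  assumes \<nu>: "0 < \<nu>" "\<nu> < 1"
    and w: "(\<exists>t. w = of_real t \<and> 0 < t \<and> t < 1) \<or> norm w = 1"
  shows "norm (hypX \<nu> r w - w powr of_real \<nu> * hypY \<nu> r w)
    \<le> 5 / 2 * hypH \<nu> r * norm (1 - w powr of_real \<nu>) * norm (1 - csqrt w) ^ (2 * r)"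
  using w
proof
  assume "\<exists>t. w = of_real t \<and> 0 < t \<and> t < 1"
  then obtain t where t: "w = of_real t" "0 < t" "t < 1" by blast
  define y where "y = sqrt t"
  have y: "0 < y" "y < 1" "y\<^sup>2 = t" using t by (auto simp: y_def)
  have p: "w powr of_real \<nu> = of_real (t powr \<nu>)" using t by (simp add: powr_of_real)
  have s: "csqrt w = of_real y" using t by (simp add: y_def)
  have "t powr \<nu> \<le> 1" using t \<nu> by (simp add: powr_le1)
  then have n: "norm (1 - w powr of_real \<nu>) = 1 - t powr \<nu>"
    unfolding p norm_1_minus_of_real by simp
  have n': "norm (1 - csqrt w) = 1 - y"
    unfolding s norm_1_minus_of_real using y by simp
  have "norm (hypX \<nu> r w - w powr of_real \<nu> * hypY \<nu> r w)
     \<le> 1 * (hypH \<nu> r * (1 - y) ^ (2 * r) * (1 - t powr \<nu>))"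
    using hyp_remainder_real[OF \<nu> y(1,2), of r] unfolding p unfolding t(1) y(3) by simp
  also have "\<dots> \<le> 5 / 2 * (hypH \<nu> r * (1 - y) ^ (2 * r) * (1 - t powr \<nu>))"
    using hypH_pos[of \<nu> r] \<nu> y \<open>t powr \<nu> \<le> 1\<close> by (intro mult_right_mono mult_nonneg_nonneg) auto
  finally show ?thesis unfolding n n' by (simp only: mult_ac)
next
  assume "norm w = 1"
  note w = unit_circle_cis_Arg[OF this]
  define \<theta> where "\<theta> = Arg w"
  have "\<bar>\<nu> * \<theta>\<bar> \<le> 1 * pi" unfolding abs_mult
    using \<nu> w(4) unfolding \<theta>_def by (intro mult_mono) auto
  then have chord: "\<nu> * \<bar>\<theta>\<bar> \<le> 5 / 2 * norm (1 - cis (\<nu> * \<theta>))"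
    using abs_angle_le_chord[of "\<nu> * \<theta>"] \<nu> by (simp add: abs_mult)
  have "norm (hypX \<nu> r w - w powr of_real \<nu> * hypY \<nu> r w)
     \<le> \<nu> * hypH \<nu> r * \<bar>\<theta>\<bar> * (2 - 2 * cos (\<theta> / 2)) ^ r"
    using hyp_remainder_cis[OF \<nu> w(4), of r] w(1) unfolding w(3) \<theta>_def by metis
  also have "\<dots> = (\<nu> * \<bar>\<theta>\<bar>) * (hypH \<nu> r * norm (1 - csqrt w) ^ (2 * r))"
    unfolding w(2) power_mult norm_1_minus_cis \<theta>_def by (simp only: mult_ac)
  also have "\<dots> \<le> (5 / 2 * norm (1 - cis (\<nu> * \<theta>))) * (hypH \<nu> r * norm (1 - csqrt w) ^ (2 * r))"
    using hypH_pos[of \<nu> r] \<nu> by (intro mult_right_mono chord) auto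
  finally show ?thesis unfolding w(3) \<theta>_def by (simp only: mult_ac)
qed

lemma hypX_hypY_bound:
  assumes \<nu>: "0 < \<nu>" "\<nu> < 1"
    and w: "(\<exists>t. w = of_real t \<and> 1 / 36 \<le> t \<and> t < 1) \<or> norm w = 1"
  shows "norm (hypX \<nu> r w) \<le> 2 * hypG \<nu> r * norm (1 + csqrt w) ^ (2 * r)"
    and "norm (hypY \<nu> r w) \<le> 2 * hypG \<nu> r * norm (1 + csqrt w) ^ (2 * r)"
proof -
  have "norm (hypX \<nu> r w) \<le> 2 * hypG \<nu> r * norm (1 + csqrt w) ^ (2 * r) \<and>
    norm (hypY \<nu> r w) \<le> 2 * hypG \<nu> r * norm (1 + csqrt w) ^ (2 * r)"
    using w
  proof
    assume "\<exists>t. w = of_real t \<and> 1 / 36 \<le> t \<and> t < 1"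
    then obtain t where t: "w = of_real t" "1 / 36 \<le> t" "t < 1" by blast
    define y where "y = sqrt t"
    have "sqrt ((1/6)\<^sup>2) \<le> y" unfolding y_def using t(2) by (intro real_sqrt_le_mono) (simp add: power2_eq_square)
    then have y: "1/6 \<le> y" "y \<le> 1" "y\<^sup>2 = t" using t by (auto simp: y_def)
    have s: "csqrt w = of_real y" using t by (simp add: y_def)
    have n: "norm (1 + csqrt w) = 1 + y"
      unfolding s norm_1_plus_of_real using y by simp
    show ?thesis using hypX_hypY_real_bound[OF \<nu> y(1,2), of r] unfolding n unfolding y(3) t(1) by simp
  next
    assume w: "norm w = 1"
    note cis = unit_circle_cis_Arg[OF w]
    define c where "c = cos (Arg w / 2)"
    \<comment> \<open>The half angle of the principal argument has nonnegative cosine. Thus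
      \<open>norm (1 + w) = 2 * c\<close>, while \<open>csqrt w\<close> gives
      \<open>2 + 2 * c\<close>, and the circle estimate takes the same form as the one on the
      interval.\<close>
    have c: "c \<ge> 0" unfolding c_def using cis(4) by (intro cos_ge_zero) (auto simp: abs_le_iff)
    have "(norm (1 + w))\<^sup>2 = 2 + 2 * cos (Arg w)" by (subst cis(1)) (rule norm_1_plus_cis)
    also have "cos (Arg w) = 2 * c\<^sup>2 - 1"
      using cos_double_cos[of "Arg w / 2"] by (simp add: c_def)
    finally have "(norm (1 + w))\<^sup>2 = (2 * c)\<^sup>2" by (simp add: power2_eq_square)
    then have "norm (1 + w) = 2 * c" by (rule power2_eq_imp_eq) (use c in auto)
    moreover have "(norm (1 + csqrt w))\<^sup>2 = 2 + 2 * c"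
      unfolding cis(2) norm_1_plus_cis c_def ..
    ultimately have "2 + norm (1 + w) = (norm (1 + csqrt w))\<^sup>2" by simp
    then show ?thesis using hypX_hypY_unit_circle_bound[OF \<nu> w, of r] by (simp add: power_mult)
  qed
  then show "norm (hypX \<nu> r w) \<le> 2 * hypG \<nu> r * norm (1 + csqrt w) ^ (2 * r)"
    and "norm (hypY \<nu> r w) \<le> 2 * hypG \<nu> r * norm (1 + csqrt w) ^ (2 * r)" by auto
qed

text \<open>If the order of the zero at 1 were smaller than \<open>N\<close>, then dividing the
  bound by that power of \<open>1 - x\<close> would force the cofactor to vanish at 1 as
  well.\<close>

lemma power_dvd_if_small_near_1:
  fixes P :: "complex poly"
  assumes "P \<noteq> 0" and bnd: "\<And>x :: real. 0 < x \<Longrightarrow> x < 1 \<Longrightarrow> norm (poly P (of_real x)) \<le> C * (1 - x) ^ N"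
  shows "[:- 1, 1:] ^ N dvd P"
proof (rule ccontr)
  assume "\<not> [:- 1, 1:] ^ N dvd P"
  then have less: "order 1 P < N" using order_divides[of 1 N P] by auto
  obtain G where P: "P = [:- 1, 1:] ^ order 1 P * G" and G: "\<not> [:- 1, 1:] dvd G"
    using order_decomp[OF \<open>P \<noteq> 0\<close>, of 1] by auto
  have C: "C \<ge> 0"
  proof -
    have "0 \<le> C * (1 - 1/2) ^ N" by (rule order.trans[OF norm_ge_zero bnd]) auto
    then show ?thesis using mult_neg_pos[of C "(1 - 1/2) ^ N"] by (intro leI notI) simp
  qed
  have small: "norm (poly G (of_real x)) \<le> C * (1 - x)" if x: "0 < x" "x < 1" for x :: real
  proof -
    obtain e where N: "N = order 1 P + Suc e" using less less_imp_Suc_add by auto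
    have "norm (poly P (of_real x)) = norm (complex_of_real x - 1) ^ order 1 P * norm (poly G (of_real x))"
      by (subst P) (simp add: norm_mult norm_power)
    also have "norm (complex_of_real x - 1) = 1 - x"
      unfolding norm_minus_commute[of _ 1] norm_1_minus_of_real using x by simp
    finally have "(1 - x) ^ order 1 P * norm (poly G (of_real x)) \<le> (1 - x) ^ order 1 P * (C * (1 - x) ^ Suc e)"
      using bnd[OF x] by (simp add: N power_add mult_ac)
    then have "norm (poly G (of_real x)) \<le> C * (1 - x) ^ Suc e" using x by simp
    also have "\<dots> \<le> C * (1 - x)"
      using x C power_decreasing[of 1 "Suc e" "1 - x"] by (intro mult_left_mono) auto
    finally show ?thesis .
  qed
  have L1: "((\<lambda>x::real. poly G (of_real x)) \<longlongrightarrow> 0) (at_left 1)"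
  proof (rule Lim_null_comparison)
    show "\<forall>\<^sub>F x in at_left (1::real). norm (poly G (of_real x)) \<le> C * (1 - x)"
    proof (rule eventually_mono)
      show "\<forall>\<^sub>F x in at_left (1::real). x \<in> {0<..<1}" by (rule eventually_at_left_real) simp
    qed (auto intro: small)
    show "((\<lambda>x. C * (1 - x)) \<longlongrightarrow> 0) (at_left (1::real))"
      by (auto intro!: tendsto_eq_intros)
  qed
  have L2: "((\<lambda>x::real. poly G (of_real x)) \<longlongrightarrow> poly G (of_real 1)) (at_left 1)"
    by (intro tendsto_intros)
  have "poly G 1 = 0" using tendsto_unique[OF trivial_limit_at_left_real L1 L2] by simp
  then show False using G by (simp add: poly_eq_0_iff_dvd)
qed

text \<open>
  On the real axis the remainder bound forces a zero of order at least \<open>2 * r + 1\<close> at \<open>1\<close>, which is also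
  the largest possible degree; the value at \<open>0\<close> is the difference of two consecutive leading coefficients.
\<close>

lemma hyp_determinant_nonzero:
  assumes \<nu>: "0 < \<nu>" "\<nu> < 1" and w: "w \<noteq> 1"
  shows "hypX \<nu> r w * hypY \<nu> (Suc r) w - hypX \<nu> (Suc r) w * hypY \<nu> r w \<noteq> 0"
proof -
  define PX :: "nat \<Rightarrow> complex poly" where "PX r = (\<Sum>k\<le>r. monom (of_real (hyp_coeff \<nu> r k)) k)" for r
  define PY :: "nat \<Rightarrow> complex poly" where "PY r = (\<Sum>k\<le>r. monom (of_real (hyp_coeff \<nu> r k)) (r - k))" for r
  define P where "P = PX r * PY (Suc r) - PX (Suc r) * PY r"
  define N where "N = 2 * r + 1"
  have pX: "poly (PX r) z = hypX \<nu> r z" and pY: "poly (PY r) z = hypY \<nu> r z" for r z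
    by (simp_all add: PX_def PY_def hypX_def hypY_def poly_sum poly_monom)
  have pP: "poly P z = hypX \<nu> r z * hypY \<nu> (Suc r) z - hypX \<nu> (Suc r) z * hypY \<nu> r z" for z
    by (simp add: P_def pX pY)
  have dX: "degree (PX r) \<le> r" and dY: "degree (PY r) \<le> r" for r
    unfolding PX_def PY_def by (intro degree_sum_le; auto intro: order.trans[OF degree_monom_le])+
  have deg: "degree P \<le> N"
    unfolding P_def N_def
    using dX[of r] dX[of "Suc r"] dY[of r] dY[of "Suc r"] degree_mult_le[of "PX r" "PY (Suc r)"] degree_mult_le[of "PX (Suc r)" "PY r"]
    by (intro degree_diff_le) auto
  have X0: "hypX \<nu> r 0 = 1" for r
  proof -
    have "hypX \<nu> r 0 = (\<Sum>k\<le>r. if k = 0 then 1 else 0)"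
      unfolding hypX_def by (intro sum.cong) (auto simp: hyp_coeff_def power_0_left)
    then show ?thesis by simp
  qed
  define H where "H r = hyp_coeff \<nu> r r" for r
  have Y0: "hypY \<nu> r 0 = of_real (H r)" for r
  proof -
    have "hypY \<nu> r 0 = (\<Sum>k\<le>r. if k = r then of_real (H r) else 0)"
      unfolding hypY_def by (intro sum.cong) (auto simp: power_0_left H_def)
    then show ?thesis by simp
  qed
  have H: "H r = pochhammer (\<nu> + 1) r / pochhammer (1 - \<nu>) r" for r by (simp add: H_def hyp_coeff_def)
  have "H (Suc r) = H r * ((\<nu> + 1 + real r) / (1 - \<nu> + real r))"
    unfolding H pochhammer_Suc by simp
  also have "\<dots> > H r * 1"
    using \<nu> by (intro mult_strict_left_mono) (auto simp: H intro!: divide_pos_pos pochhammer_pos)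
  finally have "H (Suc r) \<noteq> H r" by simp
  then have "poly P 0 \<noteq> 0" unfolding pP X0 Y0 by simp
  then have P: "P \<noteq> 0" by auto
  define C where "C = (5 / 2 * hypH \<nu> r) * norm (hypY \<nu> (Suc r) 1) + (5 / 2 * hypH \<nu> (Suc r)) * norm (hypY \<nu> r 1)"
  have "norm (poly P (of_real x)) \<le> C * (1 - x) ^ N" if x: "0 < x" "x < 1" for x :: real
  proof -
    define z where "z = complex_of_real x"
    have zr: "(\<exists>t. z = of_real t \<and> 0 < t \<and> t < 1) \<or> norm z = 1" using x by (auto simp: z_def)
    have "x powr 1 \<le> x powr \<nu>" using x \<nu> by (intro powr_mono') auto
    moreover have "x powr \<nu> \<le> 1" using x \<nu> by (simp add: powr_le1)
    moreover have "z powr of_real \<nu> = of_real (x powr \<nu>)" using x by (simp add: z_def powr_of_real)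
    ultimately have 1: "norm (1 - z powr of_real \<nu>) \<le> 1 - x"
      using x by (simp add: norm_1_minus_of_real)
    have "x \<le> sqrt x" using x by (intro real_le_rsqrt) (simp add: power2_eq_square mult_left_le_one_le)
    moreover have "sqrt x \<le> 1" using x by simp
    moreover have "csqrt z = of_real (sqrt x)" using x by (simp add: z_def)
    ultimately have 2: "norm (1 - csqrt z) \<le> 1 - x"
      by (simp add: norm_1_minus_of_real)
    have R: "norm (hypX \<nu> k z - z powr of_real \<nu> * hypY \<nu> k z) \<le> 5 / 2 * hypH \<nu> k * (1 - x) ^ N" if k: "k = r \<or> k = Suc r" for k
    proof -
      have "norm (hypX \<nu> k z - z powr of_real \<nu> * hypY \<nu> k z) \<le> 5 / 2 * hypH \<nu> k * norm (1 - z powr of_real \<nu>) * norm (1 - csqrt z) ^ (2 * k)"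
        by (rule hyp_remainder[OF \<nu> zr])
      \<comment> \<open>The factor \<open>norm (1 - z powr \<nu>)\<close> contributes one power of
        \<open>1 - x\<close> beyond the \<open>2 * k\<close> from the square root. This extra power
        raises the order of vanishing to \<open>2 * r + 1\<close>.\<close>
      also have "\<dots> \<le> 5 / 2 * hypH \<nu> k * (1 - x) * (1 - x) ^ (2 * k)"
        using 1 2 hypH_pos[of \<nu> k] \<nu> x by (intro mult_mono power_mono mult_nonneg_nonneg) auto
      also have "\<dots> = 5 / 2 * hypH \<nu> k * (1 - x) ^ Suc (2 * k)" by simp
      also have "\<dots> \<le> 5 / 2 * hypH \<nu> k * (1 - x) ^ N"
        using k hypH_pos[of \<nu> k] \<nu> x by (intro mult_left_mono power_decreasing) (auto simp: N_def)
      finally show ?thesis .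
    qed
    have Y: "norm (hypY \<nu> k z) \<le> norm (hypY \<nu> k 1)" for k
    proof -
      have "norm (hypY \<nu> k z) \<le> (\<Sum>i\<le>k. hyp_coeff \<nu> k i * 1)"
        unfolding hypY_def
      proof (rule order.trans[OF norm_sum], rule sum_mono)
        fix i assume "i \<in> {..k}"
        then have "hyp_coeff \<nu> k i > 0" using hyp_coeff_pos[OF \<nu>] by simp
        then show "norm (of_real (hyp_coeff \<nu> k i) * z ^ (k - i)) \<le> hyp_coeff \<nu> k i * 1"
          using x by (simp add: norm_mult norm_power z_def power_le_one)
      qed
      also have "\<dots> \<le> norm (of_real (\<Sum>i\<le>k. hyp_coeff \<nu> k i) :: complex)" by (simp only: norm_of_real mult_1_right abs_ge_self)
      also have "of_real (\<Sum>i\<le>k. hyp_coeff \<nu> k i) = hypY \<nu> k 1" by (simp add: hypY_def)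
      finally show ?thesis .
    qed
    \<comment> \<open>A column operation: the determinant is unchanged when \<open>hypX\<close> is
      replaced by the remainder.\<close>
    have "poly P z = (hypX \<nu> r z - z powr of_real \<nu> * hypY \<nu> r z) * hypY \<nu> (Suc r) z
       - (hypX \<nu> (Suc r) z - z powr of_real \<nu> * hypY \<nu> (Suc r) z) * hypY \<nu> r z"
      unfolding pP by (simp add: algebra_simps)
    also have "norm \<dots> \<le> norm (hypX \<nu> r z - z powr of_real \<nu> * hypY \<nu> r z) * norm (hypY \<nu> (Suc r) z)
       + norm (hypX \<nu> (Suc r) z - z powr of_real \<nu> * hypY \<nu> (Suc r) z) * norm (hypY \<nu> r z)"
      unfolding norm_mult [symmetric] by (rule norm_triangle_ineq4)
    also have "\<dots> \<le> (5 / 2 * hypH \<nu> r * (1 - x) ^ N) * norm (hypY \<nu> (Suc r) 1) + (5 / 2 * hypH \<nu> (Suc r) * (1 - x) ^ N) * norm (hypY \<nu> r 1)"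
      using hypH_pos[of \<nu>] \<nu> x by (intro add_mono mult_mono R Y) (auto intro!: mult_nonneg_nonneg less_imp_le)
    also have "\<dots> = C * (1 - x) ^ N" by (simp add: C_def algebra_simps)
    finally show ?thesis unfolding z_def .
  qed
  from power_dvd_if_small_near_1[OF P this] obtain G where G: "P = [:- 1, 1:] ^ N * G" by (auto simp: dvd_def)
  have "G \<noteq> 0" using P G by auto
  have "degree P = N + degree G"
    unfolding G using \<open>G \<noteq> 0\<close> by (subst degree_mult_eq) (auto simp: degree_power_eq)
  with deg have "degree G = 0" by simp
  then obtain g where g: "G = [:g:]" by (auto elim: degree_eq_zeroE)
  have "poly P w = (w - 1) ^ N * g" unfolding G g by simp
  then show ?thesis using w \<open>G \<noteq> 0\<close> g unfolding pP by auto
qed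

section \<open>Denominators and numerators\<close>

lemma D_den_pos: "D_den m n r > 0"
  and D_den_coeff: "of_nat (D_den m n r) * coeff (X_poly m n r) i \<in> \<int>"
proof -
  define p where "p = X_poly m n r"
  define b where "b i = nat (snd (quotient_of (coeff p i)))" for i
  \<comment> \<open>A common denominator, which shows that the minimum defining \<open>D_den\<close>
    is attained.\<close>
  define D where "D = (\<Prod>i\<le>degree p. b i)"
  have bpos: "b i > 0" for i using quotient_of_denom_pos'[of "coeff p i"] by (simp add: b_def)
  have "of_nat D * coeff p i \<in> \<int>" for i
  proof (cases "i \<le> degree p")
    case True
    have "D = b i * (\<Prod>j\<in>{..degree p} - {i}. b j)"
      unfolding D_def using True by (subst prod.remove[of _ i]) auto
    moreover have "of_nat (b i) * coeff p i = of_int (fst (quotient_of (coeff p i)))"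
    proof -
      have "coeff p i = of_int (fst (quotient_of (coeff p i))) / of_int (snd (quotient_of (coeff p i)))"
        by (intro quotient_of_div) simp
      moreover have "of_nat (b i) = (of_int (snd (quotient_of (coeff p i))) :: rat)"
        using quotient_of_denom_pos'[of "coeff p i"] by (simp add: b_def)
      ultimately show ?thesis using bpos[of i] by (simp add: field_simps)
    qed
    ultimately have "of_nat D * coeff p i = of_nat (\<Prod>j\<in>{..degree p} - {i}. b j) * of_int (fst (quotient_of (coeff p i)))"
      by (simp add: mult_ac)
    also have "\<dots> \<in> \<int>" by (intro Ints_mult) auto
    finally show ?thesis .
  qed (simp add: coeff_eq_0)
  moreover have "D > 0" using bpos by (simp add: D_def)
  ultimately have "\<exists>D::nat. D > 0 \<and> (\<forall>i. of_nat D * coeff (X_poly m n r) i \<in> \<int>)"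
    unfolding p_def by blast
  from LeastI_ex[OF this] show "D_den m n r > 0" "of_nat (D_den m n r) * coeff (X_poly m n r) i \<in> \<int>"
    unfolding D_den_def by auto
qed

lemma pcompose_Ints:
  fixes p q :: "rat poly"
  assumes "\<And>i. coeff p i \<in> \<int>" "\<And>i. coeff q i \<in> \<int>"
  shows "coeff (pcompose p q) i \<in> \<int>"
  using assms(1)
proof (induction p arbitrary: i)
  case (pCons a p)
  have "coeff p i \<in> \<int>" for i using pCons.prems[of "Suc i"] by simp
  then have "coeff (q * pcompose p q) i \<in> \<int>" for i
    unfolding coeff_mult using pCons.IH assms(2) by (intro Ints_sum Ints_mult) auto
  moreover have "coeff [:a:] i \<in> \<int>" using pCons.prems[of 0] by (auto simp: coeff_pCons split: nat.splits)
  ultimately show ?case by (simp add: pcompose_pCons)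
qed simp

definition shifted_X :: "nat \<Rightarrow> nat \<Rightarrow> nat \<Rightarrow> nat \<Rightarrow> rat poly" where
  "shifted_X m d n r = pcompose (X_poly m n r) [:1, - of_nat d:]"

lemma degree_X_poly_le: "degree (X_poly m n r) \<le> r"
proof (rule degree_le, intro allI impI)
  fix i assume "r < i"
  then have "real_of_rat (coeff (X_poly m n r) i) = 0"
    by (simp add: of_rat_coeff_X_poly hyp_coeff_def binomial_eq_0)
  then show "coeff (X_poly m n r) i = 0" by simp
qed

lemma degree_shifted_X_le: "degree (shifted_X m d n r) \<le> r"
proof -
  have "degree (shifted_X m d n r) \<le> degree (X_poly m n r) * degree [:1, - of_nat d :: rat:]"
    unfolding shifted_X_def by (rule degree_pcompose_le)
  also have "\<dots> \<le> r * 1"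
    using degree_X_poly_le by (intro mult_mono) auto
  finally show ?thesis by simp
qed

lemma of_real_of_rat: "complex_of_real (of_rat x) = of_rat x"
  by (cases x) (simp add: of_rat_rat)

lemma poly_map_of_rat:
  fixes z :: complex
  assumes "degree p \<le> N"
  shows "poly (map_poly of_rat p) z = (\<Sum>i\<le>N. of_rat (coeff p i) * z ^ i)"
proof -
  have "degree (map_poly of_rat p :: complex poly) = degree p"
    by (rule degree_map_poly) simp
  then have "poly (map_poly of_rat p) z = (\<Sum>i\<le>degree p. of_rat (coeff p i) * z ^ i)"
    by (simp add: poly_altdef coeff_map_poly)
  also have "\<dots> = (\<Sum>i\<le>N. of_rat (coeff p i) * z ^ i)"
    using assms by (intro sum.mono_neutral_left) (auto simp: coeff_eq_0)
  finally show ?thesis .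
qed

lemma poly_map_of_rat_X_poly:
  "poly (map_poly of_rat (X_poly m n r)) z = hypX (real m / real n) r z"
proof -
  have "poly (map_poly of_rat (X_poly m n r)) z = (\<Sum>k\<le>r. of_rat (coeff (X_poly m n r) k) * z ^ k)"
    by (rule poly_map_of_rat) (rule degree_X_poly_le)
  also have "\<dots> = hypX (real m / real n) r z"
    unfolding hypX_def of_rat_coeff_X_poly [symmetric] by (simp add: of_real_of_rat)
  finally show ?thesis .
qed

lemma poly_map_of_rat_shifted_X:
  "poly (map_poly of_rat (shifted_X m d n r)) z = hypX (real m / real n) r (1 - of_nat d * z)"
proof -
  have "poly (map_poly of_rat (shifted_X m d n r)) z =
      poly (map_poly of_rat (X_poly m n r)) (poly (map_poly of_rat [:1, - of_nat d:]) z)"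
    unfolding shifted_X_def of_rat_hom.map_poly_pcompose poly_pcompose ..
  also have "poly (map_poly of_rat [:1, - of_nat d:]) z = 1 - of_nat d * z"
    by (subst poly_map_of_rat[of _ 1]) (simp_all add: of_rat_minus mult.commute)
  finally show ?thesis by (simp add: poly_map_of_rat_X_poly)
qed

lemma coeff_0_shifted_X:
  assumes "0 < m" "m < n"
  shows "of_rat (coeff (shifted_X m d n r) 0) = hypG (real m / real n) r * real (2 * r choose r)"
proof -
  have "complex_of_real (of_rat (coeff (shifted_X m d n r) 0)) = poly (map_poly of_rat (shifted_X m d n r)) 0"
    by (simp add: poly_0_coeff_0 coeff_map_poly of_real_of_rat)
  also have "\<dots> = of_real (hypG (real m / real n) r * real (2 * r choose r))"
    unfolding poly_map_of_rat_shifted_X using assms by (simp add: hypX_1)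
  finally show ?thesis by (simp only: of_real_eq_iff)
qed

definition DN :: "nat \<Rightarrow> nat \<Rightarrow> nat \<Rightarrow> nat \<Rightarrow> real" where
  "DN m d n r = real (D_den m n r) / real_of_int (N_num m d n r)"

lemma N_num_pos:
  assumes "0 < m" "m < n"
  shows "N_num m d n r > 0"
proof -
  have "hypG (real m / real n) r * real (2 * r choose r) > 0"
    using assms hypG_pos[of "real m / real n" r] by simp
  then have "coeff (shifted_X m d n r) 0 \<noteq> 0"
    using coeff_0_shifted_X[OF assms, of d r] by (metis of_rat_0 less_irrefl)
  then have "fst (quotient_of (coeff (shifted_X m d n r) 0)) \<noteq> 0"
    by (metis quotient_of_div prod.collapse of_int_0 divide_eq_0_iff)
  then have "N_num m d n r \<noteq> 0"
    unfolding N_num_def Let_def shifted_X_def Gcd_0_iff by blast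
  moreover have "N_num m d n r \<ge> 0" unfolding N_num_def Let_def by simp
  ultimately show ?thesis by simp
qed

text \<open>In lowest terms \<open>u / v\<close>, coprimality makes \<open>v\<close> divide D,
  because D times the coefficient is an integer, and N divides \<open>u\<close> by definition. So D
  / N times the coefficient is \<open>(D / v) * (u / N)\<close>.\<close>

lemma DN_coeff_Ints:
  assumes "0 < m" "m < n"
  shows "\<exists>z::int. DN m d n r * of_rat (coeff (shifted_X m d n r) i) = of_int z"
proof -
  define c where "c = coeff (shifted_X m d n r) i"
  define u v where "u = fst (quotient_of c)" and "v = snd (quotient_of c)"
  have c: "c = of_int u / of_int v" "v > 0" "coprime u v"
    using quotient_of_div[of c u v] quotient_of_denom_pos'[of c] quotient_of_coprime[of c u v] by (simp_all add: u_def v_def)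
  have "of_nat (D_den m n r) * c \<in> \<int>"
  proof -
    have "coeff (pcompose (smult (of_nat (D_den m n r)) (X_poly m n r)) [:1, - of_nat d:]) i \<in> \<int>"
      by (rule pcompose_Ints) (auto simp: D_den_coeff coeff_pCons split: nat.splits)
    then show ?thesis by (simp add: pcompose_smult c_def shifted_X_def)
  qed
  then obtain w where "of_nat (D_den m n r) * c = of_int w" by (auto elim: Ints_cases)
  then have "of_int (int (D_den m n r) * u) = (of_int (w * v) :: rat)"
    using c by (simp add: field_simps)
  then have "int (D_den m n r) * u = w * v" by (simp only: of_int_eq_iff)
  then have "v dvd int (D_den m n r) * u" by simp
  then have "v dvd int (D_den m n r)" using c(3) by (simp add: coprime_commute coprime_dvd_mult_left_iff)
  then obtain D' where D': "int (D_den m n r) = v * D'" by (auto simp: dvd_def)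
  have "N_num m d n r dvd u"
    unfolding N_num_def Let_def u_def c_def shifted_X_def by (intro Gcd_dvd) auto
  then obtain u' where u': "u = N_num m d n r * u'" by (auto simp: dvd_def)
  have "real (D_den m n r) = of_int v * of_int D'" using D' by (metis of_int_mult of_int_of_nat_eq)
  moreover have "of_rat c = (of_int u / of_int v :: real)" unfolding c(1) by (simp add: of_rat_divide)
  ultimately have "DN m d n r * of_rat c = of_int (D' * u')"
    using N_num_pos[OF assms, of d r] c(2) by (simp add: DN_def u')
  then show ?thesis unfolding c_def by blast
qed

text \<open>The product is a positive integer, namely D / N times the value \<open>X 1\<close>,
  which is the constant coefficient of the shifted polynomial.\<close>

lemma DN_lower_bound:
  assumes "0 < m" "m < n"
  shows "1 \<le> DN m d n r * (hypG (real m / real n) r * real (2 * r choose r))"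
proof -
  obtain z :: int where "DN m d n r * (hypG (real m / real n) r * real (2 * r choose r)) = of_int z"
    using DN_coeff_Ints[OF assms, of d r 0] unfolding coeff_0_shifted_X[OF assms] by blast
  moreover have "DN m d n r * (hypG (real m / real n) r * real (2 * r choose r)) > 0"
    using N_num_pos[OF assms, of d r] D_den_pos[of m n r] hypG_pos[of "real m / real n" r] assms
    by (auto simp: DN_def intro!: mult_pos_pos divide_pos_pos)
  ultimately show ?thesis by simp
qed

lemma DN_pos: "0 < m \<Longrightarrow> m < n \<Longrightarrow> DN m d n r > 0"
  using N_num_pos[of m n d r] D_den_pos[of m n r] by (simp add: DN_def)

text \<open>Here the shift by \<open>d\<close> enters: \<open>a / b = 1 - d * z\<close> with
  \<open>z = (b - a) / (d * b)\<close>. In the shifted coefficients the form becomes an integral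
  combination of products of powers of \<open>(b - a) / (d * g)\<close> and
  \<open>b / g\<close>.\<close>

lemma DN_homogeneous_algebraic_int:
  fixes a b g :: complex
  assumes mn: "0 < m" "m < n" and nz: "b \<noteq> 0" "g \<noteq> 0" "d > 0"
    and ab: "algebraic_int (b / g)" "algebraic_int ((b - a) / (of_nat d * g))"
  shows "algebraic_int (of_real (DN m d n r) * (b ^ r * hypX (real m / real n) r (a / b)) / g ^ r)"
proof -
  define z where "z = (b - a) / (of_nat d * b)"
  define y where "y = (b - a) / (of_nat d * g)"
  have z: "1 - of_nat d * z = a / b" using nz by (simp add: z_def field_simps)
  have zb: "z * (b / g) = y" using nz by (simp add: z_def y_def)
  have "of_real (DN m d n r) * (b ^ r * hypX (real m / real n) r (a / b)) / g ^ r
    = of_real (DN m d n r) * (b / g) ^ r * (\<Sum>i\<le>r. of_rat (coeff (shifted_X m d n r) i) * z ^ i)"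
    unfolding z [symmetric] poly_map_of_rat_shifted_X [symmetric] poly_map_of_rat[OF degree_shifted_X_le]
    by (simp add: power_divide)
  also have "\<dots> = (\<Sum>i\<le>r. of_real (DN m d n r * of_rat (coeff (shifted_X m d n r) i)) * (y ^ i * (b / g) ^ (r - i)))"
    unfolding sum_distrib_left
  proof (intro sum.cong refl)
    fix i assume "i \<in> {..r}"
    then have "(b / g) ^ r = (b / g) ^ i * (b / g) ^ (r - i)" by (simp flip: power_add)
    then have "z ^ i * (b / g) ^ r = y ^ i * (b / g) ^ (r - i)"
      unfolding zb [symmetric] power_mult_distrib by (simp only: mult.assoc)
    moreover have "A * (b / g) ^ r * (B * z ^ i) = A * B * (z ^ i * (b / g) ^ r)" for A B
      by (simp only: mult_ac)
    ultimately show "of_real (DN m d n r) * (b / g) ^ r * (of_rat (coeff (shifted_X m d n r) i) * z ^ i) =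
      of_real (DN m d n r * of_rat (coeff (shifted_X m d n r) i)) * (y ^ i * (b / g) ^ (r - i))"
      by (simp only: of_real_mult of_real_of_rat)
  qed
  finally have eq: "of_real (DN m d n r) * (b ^ r * hypX (real m / real n) r (a / b)) / g ^ r =
    (\<Sum>i\<le>r. of_real (DN m d n r * of_rat (coeff (shifted_X m d n r) i)) * (y ^ i * (b / g) ^ (r - i)))" .
  show ?thesis unfolding eq
  proof (intro algebraic_int_sum algebraic_int_mult algebraic_int_power)
    fix i
    obtain k :: int where "DN m d n r * of_rat (coeff (shifted_X m d n r) i) = of_int k"
      using DN_coeff_Ints[OF mn] by blast
    then show "algebraic_int (complex_of_real (DN m d n r * of_rat (coeff (shifted_X m d n r) i)))"
      by (simp add: int_imp_algebraic_int)
  qed (use ab in \<open>auto simp: y_def\<close>)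
qed

section \<open>Thue's gap argument\<close>

text \<open>Letting \<open>r\<close> tend to infinity removes the constant \<open>C\<close>.
  Estimates valid for every \<open>r\<close> are sharpened in this way several times below.\<close>

lemma ge_1_if_powers_bounded_below:
  fixes z :: real
  assumes "0 \<le> z" "\<And>r. 1 \<le> C * z ^ r"
  shows "1 \<le> z"
proof (rule ccontr)
  assume "\<not> 1 \<le> z"
  then have "(\<lambda>r. C * z ^ r) \<longlonglongrightarrow> C * 0"
    using assms(1) by (intro tendsto_intros LIMSEQ_power_zero) auto
  then have "1 \<le> C * 0" using assms(2) by (intro LIMSEQ_le_const) auto
  then show False by simp
qed

text \<open>Expressed through the remainders \<open>R r * \<alpha> - P r\<close>, the determinant is
  at most a constant times \<open>(Q / E) ^ r\<close>, which cannot tend to 0.\<close>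

lemma approximation_determinant_bound:
  fixes P R :: "nat \<Rightarrow> complex"
  assumes E: "E > 0" and Q: "Q \<ge> 0"
    and R: "\<And>r. norm (R r) \<le> k * Q ^ r" and rem: "\<And>r. norm (R r * \<alpha> - P r) \<le> l / E ^ r"
    and det: "\<And>r. 1 \<le> norm (P r * R (Suc r) - P (Suc r) * R r)"
  shows "E \<le> Q"
proof -
  have k: "k \<ge> 0" using order.trans[OF norm_ge_zero R[of 0]] by simp
  have l: "l \<ge> 0" using order.trans[OF norm_ge_zero rem[of 0]] by simp
  have "1 \<le> (l * k * (Q + 1 / E)) * (Q / E) ^ r" for r
  proof -
    have "P r * R (Suc r) - P (Suc r) * R r = (R (Suc r) * \<alpha> - P (Suc r)) * R r - (R r * \<alpha> - P r) * R (Suc r)"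
      by (simp add: algebra_simps)
    also have "norm \<dots> \<le> norm (R (Suc r) * \<alpha> - P (Suc r)) * norm (R r) + norm (R r * \<alpha> - P r) * norm (R (Suc r))"
      unfolding norm_mult [symmetric] by (rule norm_triangle_ineq4)
    also have "\<dots> \<le> (l / E ^ Suc r) * (k * Q ^ r) + (l / E ^ r) * (k * Q ^ Suc r)"
      using E l by (intro add_mono mult_mono R rem) auto
    also have "\<dots> = (l * k * (Q + 1 / E)) * (Q / E) ^ r"
      by (simp add: power_divide divide_inverse power_inverse algebra_simps)
    finally show ?thesis using det[of r] by linarith
  qed
  then have "1 \<le> Q / E" by (rule ge_1_if_powers_bounded_below[rotated]) (use E Q in simp)
  then show ?thesis using E by simp
qed

text \<open>Take the least \<open>r0\<close> for which the remainder times \<open>norm q\<close> is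
  guaranteed to be at most 1/2. By the determinant condition, \<open>r0\<close> or
  \<open>Suc r0\<close> yields an approximation different from \<open>p / q\<close>; its integrality
  leaves at least 1/2 for the term containing the distance.\<close>

lemma approximation_gap:
  fixes P R :: "nat \<Rightarrow> complex" and \<alpha> p q :: complex
  assumes E: "E > 1" and Q: "Q \<ge> 1" and \<kappa>: "\<kappa> = ln Q / ln E" and q: "norm q \<ge> 1"
    and R: "\<And>r. norm (R r) < k * Q ^ r" and rem: "\<And>r. norm (R r * \<alpha> - P r) \<le> l / E ^ r"
    and det: "\<And>r. P r * R (Suc r) \<noteq> P (Suc r) * R r"
    and int: "\<And>r. P r * q \<noteq> R r * p \<Longrightarrow> 1 \<le> norm (P r * q - R r * p)"
  shows "norm (\<alpha> - p / q) > 1 / (2 * k * Q * max E (2 * l * E) powr \<kappa> * norm q powr (\<kappa> + 1))"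
proof -
  define M where "M = max E (2 * l * E)"
  define \<delta> where "\<delta> = norm (\<alpha> - p / q)"
  have q0: "q \<noteq> 0" using q by auto
  have k: "k > 0" using le_less_trans[OF norm_ge_zero R[of 0]] by simp
  have l: "l \<ge> 0" using order.trans[OF norm_ge_zero rem[of 0]] by simp
  have M: "M \<ge> 1" "M \<ge> E" "M \<ge> 2 * l * E" using E by (auto simp: M_def)
  have \<kappa>0: "\<kappa> \<ge> 0" using \<kappa> E Q by simp
  have QE: "Q = E powr \<kappa>" using E Q by (simp add: \<kappa> powr_def)
  define r0 where "r0 = (LEAST r. 2 * l * norm q \<le> E ^ r)"
  have ex: "\<exists>r. 2 * l * norm q \<le> E ^ r"
    using real_arch_pow[OF E, of "2 * l * norm q"] less_imp_le by blast
  have r0: "2 * l * norm q \<le> E ^ r0" unfolding r0_def by (rule LeastI_ex[OF ex])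
  have "\<exists>r. (r = r0 \<or> r = Suc r0) \<and> P r * q \<noteq> R r * p"
  proof (rule ccontr)
    assume "\<not> ?thesis"
    then have *: "P r0 * q = R r0 * p" "P (Suc r0) * q = R (Suc r0) * p" by auto
    have "(P r0 * R (Suc r0)) * q = (P r0 * q) * R (Suc r0)" by simp
    also have "\<dots> = (P (Suc r0) * q) * R r0" unfolding * by simp
    finally show False using det[of r0] q0 by simp
  qed
  then obtain r where r: "r = r0 \<or> r = Suc r0" "P r * q \<noteq> R r * p" by blast
  have "E ^ r0 \<le> E ^ r" using E r(1) by (intro power_increasing) auto
  then have Er: "2 * l * norm q \<le> E ^ r" using r0 by simp
  have Epos: "E ^ r > 0" using E by simp
  have half: "norm q * norm (R r * \<alpha> - P r) \<le> 1 / 2"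
  proof -
    have "norm q * norm (R r * \<alpha> - P r) \<le> norm q * (l / E ^ r)" by (intro mult_left_mono rem) simp
    also have "\<dots> \<le> 1 / 2" using Er Epos by (simp add: field_simps)
    finally show ?thesis .
  qed
  have "1 \<le> norm (P r * q - R r * p)" using int r(2) by simp
  also have "P r * q - R r * p = R r * q * (\<alpha> - p / q) - q * (R r * \<alpha> - P r)"
    using q0 by (simp add: algebra_simps)
  also have "norm \<dots> \<le> norm (R r) * norm q * \<delta> + norm q * norm (R r * \<alpha> - P r)"
    unfolding \<delta>_def norm_mult [symmetric] by (rule norm_triangle_ineq4)
  finally have 1: "1 / 2 \<le> norm (R r) * norm q * \<delta>" using half by simp
  then have "\<delta> \<noteq> 0" by auto
  then have \<delta>: "\<delta> > 0" by (simp add: \<delta>_def)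
  have "1 / 2 < (k * Q ^ r) * (norm q * \<delta>)"
  proof (rule le_less_trans)
    show "1 / 2 \<le> norm (R r) * (norm q * \<delta>)" using 1 by (simp only: mult.assoc)
    show "norm (R r) * (norm q * \<delta>) < (k * Q ^ r) * (norm q * \<delta>)"
      using \<delta> q0 by (intro mult_strict_right_mono R) auto
  qed
  \<comment> \<open>The single factor \<open>Q\<close> pays for the possible choice
    \<open>Suc r0\<close>. Minimality of \<open>r0\<close> bounds \<open>E ^ r0\<close> by
    \<open>M * norm q\<close>, and \<open>Q = E powr \<kappa>\<close> translates this; for
    \<open>r0 = 0\<close> the bound holds because \<open>M\<close> and \<open>norm q\<close> are at
    least 1.\<close>
  also have "Q ^ r \<le> Q * (M * norm q) powr \<kappa>"
  proof -
    have "E ^ r0 \<le> M * norm q"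
    proof (cases r0)
      case 0
      then show ?thesis using mult_mono[of 1 M 1 "norm q"] M q by simp
    next
      case (Suc r')
      then have "\<not> 2 * l * norm q \<le> E ^ r'"
        using not_less_Least[of r' "\<lambda>r. 2 * l * norm q \<le> E ^ r"] by (simp add: r0_def)
      then have "E * E ^ r' \<le> E * (2 * l * norm q)" using E by (intro mult_left_mono) auto
      also have "\<dots> = (2 * l * E) * norm q" by simp
      also have "\<dots> \<le> M * norm q" using M by (intro mult_right_mono) auto
      finally show ?thesis using Suc by simp
    qed
    then have "(E ^ r0) powr \<kappa> \<le> (M * norm q) powr \<kappa>" using \<kappa>0 E by (intro powr_mono2) auto
    moreover have "Q ^ r0 = (E ^ r0) powr \<kappa>"
      unfolding QE using E by (simp add: powr_realpow [symmetric] powr_powr mult.commute)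
    ultimately have "Q * Q ^ r0 \<le> Q * (M * norm q) powr \<kappa>" using Q by (intro mult_left_mono) auto
    moreover have "Q ^ r \<le> Q ^ Suc r0" using r(1) Q by (intro power_increasing) auto
    ultimately show ?thesis by simp
  qed
  also have "k * (Q * (M * norm q) powr \<kappa>) * (norm q * \<delta>) = (k * Q * M powr \<kappa> * norm q powr (\<kappa> + 1)) * \<delta>"
    using M q by (simp add: powr_mult powr_add)
  finally have "1 / 2 < (k * Q * M powr \<kappa> * norm q powr (\<kappa> + 1)) * \<delta>"
    using k \<delta> q0 by (simp add: mult_right_mono mult_left_mono)
  moreover have "k * Q * M powr \<kappa> * norm q powr (\<kappa> + 1) > 0"
    using k Q M q0 by (intro mult_pos_pos) auto
  ultimately show ?thesis unfolding M_def [symmetric] \<delta>_def [symmetric] by (simp add: field_simps)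
qed

text \<open>\<open>csqrt\<close> is multiplicative only up to sign. The wrong sign interchanges the
  sum and the difference of the roots, which minimum and maximum do not notice;
  \<open>Re (csqrt (a / b)) >= 0\<close> decides which one is smaller.\<close>

lemma csqrt_min_max:
  fixes a b :: complex
  assumes b: "b \<noteq> 0"
  shows "min ((norm (csqrt a - csqrt b))\<^sup>2) ((norm (csqrt a + csqrt b))\<^sup>2) = norm b * (norm (1 - csqrt (a / b)))\<^sup>2"
    and "max ((norm (csqrt a - csqrt b))\<^sup>2) ((norm (csqrt a + csqrt b))\<^sup>2) = norm b * (norm (1 + csqrt (a / b)))\<^sup>2"
proof -
  define u where "u = csqrt (a / b)"
  have nb: "(norm (csqrt b))\<^sup>2 = norm b" by (metis norm_power power2_csqrt)
  have Re: "Re u \<ge> 0" unfolding u_def by (rule Re_csqrt)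
  have sub: "(norm (csqrt b * (1 - u)))\<^sup>2 = norm b * (norm (1 - u))\<^sup>2"
    and add: "(norm (csqrt b * (1 + u)))\<^sup>2 = norm b * (norm (1 + u))\<^sup>2"
    unfolding norm_mult power_mult_distrib nb by (rule refl)+
  have "(norm (1 - u))\<^sup>2 \<le> (norm (1 + u))\<^sup>2"
    unfolding cmod_power2 using Re by (simp add: power2_eq_square algebra_simps)
  then have le: "norm b * (norm (1 - u))\<^sup>2 \<le> norm b * (norm (1 + u))\<^sup>2" by (intro mult_left_mono) auto
  have "(csqrt a)\<^sup>2 = (csqrt b * u)\<^sup>2" using b by (simp add: u_def power_mult_distrib)
  then have "csqrt a = csqrt b * u \<or> csqrt a = - (csqrt b * u)" by (rule power2_eq_iff[THEN iffD1])
  then have "((norm (csqrt a - csqrt b))\<^sup>2 = norm b * (norm (1 - u))\<^sup>2 \<and> (norm (csqrt a + csqrt b))\<^sup>2 = norm b * (norm (1 + u))\<^sup>2) \<or>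
    ((norm (csqrt a - csqrt b))\<^sup>2 = norm b * (norm (1 + u))\<^sup>2 \<and> (norm (csqrt a + csqrt b))\<^sup>2 = norm b * (norm (1 - u))\<^sup>2)"
  proof
    assume "csqrt a = csqrt b * u"
    then have "csqrt a - csqrt b = - (csqrt b * (1 - u))" "csqrt a + csqrt b = csqrt b * (1 + u)"
      by (simp_all add: algebra_simps)
    then show ?thesis unfolding sub [symmetric] add [symmetric] by (metis norm_minus_cancel)
  next
    assume "csqrt a = - (csqrt b * u)"
    then have "csqrt a - csqrt b = - (csqrt b * (1 + u))" "csqrt a + csqrt b = csqrt b * (1 - u)"
      by (simp_all add: algebra_simps)
    then show ?thesis unfolding sub [symmetric] add [symmetric] by (metis norm_minus_cancel)
  qed
  with le show "min ((norm (csqrt a - csqrt b))\<^sup>2) ((norm (csqrt a + csqrt b))\<^sup>2) = norm b * (norm (1 - csqrt (a / b)))\<^sup>2"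
    and "max ((norm (csqrt a - csqrt b))\<^sup>2) ((norm (csqrt a + csqrt b))\<^sup>2) = norm b * (norm (1 + csqrt (a / b)))\<^sup>2"
    unfolding u_def [symmetric]
    by (elim disjE conjE; simp only: min_absorb1 min_absorb2 max_absorb1 max_absorb2)+
qed

lemma hypG_Gamma:
  assumes "\<nu> < 1"
  shows "Gamma (1 - \<nu>) * fact r / Gamma (real r + 1 - \<nu>) = hypG \<nu> r"
proof -
  have "1 - \<nu> \<notin> \<int>\<^sub>\<le>\<^sub>0" using assms by (auto elim!: nonpos_Ints_cases)
  then have "pochhammer (1 - \<nu>) r = Gamma (1 - \<nu> + real r) / Gamma (1 - \<nu>)" by (rule pochhammer_Gamma)
  then show ?thesis by (simp add: hypG_def algebra_simps)
qed

lemma hypH_Gamma: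
  assumes "0 < m" "0 < n"
  shows "real n * Gamma (real r + 1 + real m / real n) / (real m * Gamma (real m / real n) * fact r)
     = hypH (real m / real n) r"
proof -
  define \<nu> where "\<nu> = real m / real n"
  have \<nu>: "\<nu> > 0" using assms by (simp add: \<nu>_def)
  then have "\<nu> + 1 \<notin> \<int>\<^sub>\<le>\<^sub>0" by (auto elim!: nonpos_Ints_cases)
  then have "pochhammer (\<nu> + 1) r = Gamma (\<nu> + 1 + real r) / Gamma (\<nu> + 1)" by (rule pochhammer_Gamma)
  also have "Gamma (\<nu> + 1) = \<nu> * Gamma \<nu>" using \<nu> by (intro Gamma_plus1) (auto elim!: nonpos_Ints_cases)
  finally have "hypH \<nu> r = Gamma (real r + 1 + \<nu>) / (\<nu> * Gamma \<nu> * fact r)"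
    by (simp add: hypH_def add_ac)
  then show ?thesis unfolding \<nu>_def using assms by simp
qed

lemma hypY_eq_hypX_inverse:
  assumes "w \<noteq> 0"
  shows "hypY \<nu> r w = w ^ r * hypX \<nu> r (1 / w)"
  unfolding hypX_def hypY_def sum_distrib_left
  using assms by (intro sum.cong) (auto simp: power_diff power_divide)

lemma calN_pos: "calN d n > 0"
  unfolding calN_def by (intro prod_pos) (auto simp: prime_factors_gt_0_nat)

context quadratic_extension
begin

lemma \<sigma>_algebraic_int:
  assumes x: "x \<in> L" "algebraic_int x"
  shows "algebraic_int (\<sigma> x)"
proof -
  obtain p :: "int poly" where p: "poly (map_poly of_int p) x = 0" "lead_coeff p = 1"
    using x(2) unfolding algebraic_int_altdef_ipoly by blast
  have c: "of_int k \<in> K" for k using complex_subfield_Rats[OF K] by simp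
  have cL: "of_int k * x ^ i \<in> L" for k i
    using c K_sub_L complex_subfieldD(4,9)[OF L] x(1) by blast
  have "\<sigma> (\<Sum>i\<le>degree p. of_int (coeff p i) * x ^ i) = (\<Sum>i\<le>degree p. of_int (coeff p i) * \<sigma> x ^ i)"
    using \<sigma>_sum[of "{..degree p}" "\<lambda>i. of_int (coeff p i) * x ^ i"] cL c K_sub_L complex_subfieldD(9)[OF L x(1)]
    by (simp add: \<sigma>_mult \<sigma>_power x(1) \<sigma>_K subset_iff)
  moreover have "(\<Sum>i\<le>degree p. of_int (coeff p i) * x ^ i) = 0"
    using p(1) by (simp add: poly_altdef degree_map_poly coeff_map_poly)
  moreover have "\<sigma> 0 = 0" using \<sigma>_K complex_subfieldD(1)[OF K] by blast
  ultimately have "poly (map_poly of_int p) (\<sigma> x) = 0"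
    by (simp add: poly_altdef degree_map_poly coeff_map_poly)
  then show ?thesis unfolding algebraic_int_altdef_ipoly using p(2) by blast
qed

text \<open>The forms have rational coefficients, which \<sigma> fixes, and \<sigma> exchanges the
  variables \<open>a\<close> and \<open>\<sigma> a\<close>; this reverses the coefficients.\<close>

lemma \<sigma>_homogeneous_hyp:
  fixes m n r :: nat
  assumes a: "a \<in> L" "\<sigma> a \<noteq> 0"
  defines "U \<equiv> \<sigma> a ^ r * hypX (real m / real n) r (a / \<sigma> a)"
    and "V \<equiv> \<sigma> a ^ r * hypY (real m / real n) r (a / \<sigma> a)"
  shows "U \<in> L" "V \<in> L" "\<sigma> U = V" "\<sigma> V = U"
proof -
  define c :: "nat \<Rightarrow> complex" where "c k = of_real (hyp_coeff (real m / real n) r k)" for k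
  have c: "c k \<in> K" for k
  proof -
    have "c k = of_rat (coeff (X_poly m n r) k)"
      unfolding c_def of_rat_coeff_X_poly [symmetric] by (cases "coeff (X_poly m n r) k") (simp add: of_rat_rat)
    then show ?thesis using complex_subfield_Rats[OF K] by simp
  qed
  then have cL: "c k \<in> L" for k using K_sub_L by blast
  have pow: "x ^ k \<in> L" if "x \<in> L" for x k using complex_subfieldD(9)[OF L that] .
  note LD = complex_subfieldD(4)[OF L]
  have b: "\<sigma> a \<in> L" using a by (simp add: \<sigma>_in)
  have U: "U = (\<Sum>k\<le>r. c k * (a ^ k * \<sigma> a ^ (r - k)))"
    unfolding U_def hypX_def sum_distrib_left c_def [symmetric]
    using a(2) by (intro sum.cong) (auto simp: power_divide power_diff)
  have V: "V = (\<Sum>k\<le>r. c k * (\<sigma> a ^ k * a ^ (r - k)))"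
    unfolding V_def hypY_def sum_distrib_left c_def [symmetric]
    using a(2) by (intro sum.cong) (auto simp: power_divide power_diff)
  have "\<sigma> U = (\<Sum>k\<le>r. \<sigma> (c k * (a ^ k * \<sigma> a ^ (r - k)))) \<and> U \<in> L"
    unfolding U using cL pow LD a b by (intro \<sigma>_sum) auto
  also have "(\<Sum>k\<le>r. \<sigma> (c k * (a ^ k * \<sigma> a ^ (r - k)))) = V"
    unfolding V using a b cL c pow LD by (intro sum.cong) (auto simp: \<sigma>_mult \<sigma>_power \<sigma>_K \<sigma>_invol)
  finally show "\<sigma> U = V" "U \<in> L" by auto
  then show "V \<in> L" "\<sigma> V = U" using \<sigma>_in \<sigma>_invol by auto
qed

end

theorem theorem1:
  fixes m n d :: nat
    and K L :: "complex set"
    and \<sigma> :: "complex \<Rightarrow> complex"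
    and \<tau> \<beta> \<gamma> \<eta> g s \<alpha> p q :: complex
    and hs :: "nat \<Rightarrow> complex"
    and h Cn Dn E Q \<kappa> c :: real
  assumes mn: "0 < m" "m < n" "coprime m n"
    and K: "K = \<rat> \<or> imag_quadratic_field K"
    and L: "number_field L" "ext_degree K L 2"
    and sigma: "\<sigma> \<in> Gal K L" "\<exists>x\<in>L. \<sigma> x \<noteq> x"
    and tau_Rats: "K = \<rat> \<Longrightarrow> \<tau> = 1"
    and tau_imag: "K \<noteq> \<rat> \<Longrightarrow> \<tau> \<in> K \<and> algebraic_int \<tau> \<and>
                     L = generate_field complex_ring (insert (csqrt \<tau>) K)"
    and beta: "\<beta> \<in> L" "algebraic_int \<beta>"
    and gamma: "\<gamma> \<in> L" "algebraic_int \<gamma>"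
    and eta: "\<eta> \<in> L" "algebraic_int \<eta>" "\<eta> \<noteq> 0"
    and g: "algebraic g" "g \<noteq> 0" "algebraic_int (\<eta> / g)" "algebraic_int (\<sigma> \<eta> / g)"
    and h_pos: "h > 0"
    and hs: "\<And>r. hs r \<noteq> 0" "\<And>r. algebraic_int (hs r)" "\<And>r. hs r / g ^ r \<in> K"
            "\<And>r. norm (hs r) \<le> h"
    and d: "d > 0" "algebraic_int ((\<sigma> \<eta> - \<eta>) / (of_nat d * g))"
           "\<And>k :: nat. k > 0 \<Longrightarrow> algebraic_int ((\<sigma> \<eta> - \<eta>) / (of_nat k * g)) \<Longrightarrow> k \<le> d"
    and Cn_Dn_pos: "Cn > 0" "Dn > 0"
    and Cn_Dn: "\<And>r :: nat.
       Max {1,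
            Gamma (1 - real m / real n) * fact r / Gamma (real r + 1 - real m / real n),
            real n * Gamma (real r + 1 + real m / real n) /
              (real m * Gamma (real m / real n) * fact r)}
         * (real (D_den m n r) / real_of_int (N_num m d n r))
       < Cn * (Dn / calN d n) ^ r"
    and sign: "s = 1 \<or> s = -1"
    and denom: "\<gamma> * (\<eta> / \<sigma> \<eta>) powr (of_nat m / of_nat n) + s * \<sigma> \<gamma> \<noteq> 0"
    and nondegenerate: "\<beta> * \<sigma> \<gamma> \<noteq> \<gamma> * \<sigma> \<beta>"
    and alpha: "\<alpha> = (\<beta> * (\<eta> / \<sigma> \<eta>) powr (of_nat m / of_nat n) + s * \<sigma> \<beta>) /
                     (\<gamma> * (\<eta> / \<sigma> \<eta>) powr (of_nat m / of_nat n) + s * \<sigma> \<gamma>)"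
    and E_eq: "E = inverse (Dn / (norm g * calN d n) *
                 min ((norm (csqrt \<eta> - csqrt (\<sigma> \<eta>)))\<^sup>2) ((norm (csqrt \<eta> + csqrt (\<sigma> \<eta>)))\<^sup>2))"
    and Q_eq: "Q = Dn / (norm g * calN d n) *
                 max ((norm (csqrt \<eta> - csqrt (\<sigma> \<eta>)))\<^sup>2) ((norm (csqrt \<eta> + csqrt (\<sigma> \<eta>)))\<^sup>2)"
    and kappa: "\<kappa> = ln Q / ln E"
    and c_eq: "c = 4 * h * norm (csqrt \<tau>) * (norm \<gamma> + norm (\<sigma> \<gamma>)) * Cn * Q *
                 max E (5 * h * norm (csqrt \<tau>) *
                        norm (1 - (\<eta> / \<sigma> \<eta>) powr (of_nat m / of_nat n)) *
                        norm (\<beta> - \<alpha> * \<gamma>) * Cn * E) powr \<kappa>"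
    and E_gt_1: "E > 1"
    and eta_ratio: "(\<exists>t :: real. \<eta> / \<sigma> \<eta> = of_real t \<and> 0 < t \<and> t < 1) \<or>
                    (norm (\<eta> / \<sigma> \<eta>) = 1 \<and> \<eta> / \<sigma> \<eta> \<noteq> -1)"
    and pq: "p \<in> K" "q \<in> K" "algebraic_int p" "algebraic_int q" "q \<noteq> 0"
  shows "norm (\<alpha> - p / q) > 1 / (c * norm q powr (\<kappa> + 1))"
proof -
  interpret quadratic_extension K L \<sigma>
    using L(2) sigma by unfold_locales
  note KD = complex_subfieldD[OF K] and LD = complex_subfieldD[OF L]
  have KL: "x \<in> K \<Longrightarrow> x \<in> L" for x using K_sub_L by blast

  \<comment> \<open>Reduction to the variable \<open>w\<close> and its admissible range\<close>
  define \<nu> where "\<nu> = real m / real n"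
  have \<nu>: "0 < \<nu>" "\<nu> < 1" using mn by (auto simp: \<nu>_def)
  define b where "b = \<sigma> \<eta>"
  define w where "w = \<eta> / b"
  define W where "W = w powr of_real \<nu>"
  have W: "(\<eta> / \<sigma> \<eta>) powr (of_nat m / of_nat n) = W"
    by (simp add: W_def w_def b_def \<nu>_def)
  have b: "b \<in> L" "\<sigma> b = \<eta>" using eta(1) by (simp_all add: b_def \<sigma>_in \<sigma>_invol)
  have b0: "b \<noteq> 0"
  proof
    assume "b = 0"
    then have "\<eta> = \<sigma> 0" using b(2) by simp
    then show False using eta(3) \<sigma>_K[OF KD(1)] by simp
  qed
  have w0: "w \<noteq> 0" and \<eta>_eq: "\<eta> = w * b" using eta(3) b0 by (simp_all add: w_def)
  define D where "D = Dn / calN d n"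
  have D: "D > 0" using Cn_Dn_pos calN_pos by (simp add: D_def)
  define S where "S = norm b * (norm (1 - csqrt w))\<^sup>2"
  define T where "T = norm b * (norm (1 + csqrt w))\<^sup>2"
  define e where "e = D / norm g * S"
  have E: "E = inverse e"
    unfolding E_eq b_def [symmetric] csqrt_min_max(1)[OF b0] e_def D_def S_def w_def by (simp add: mult_ac)
  have Q: "Q = D / norm g * T"
    unfolding Q_eq b_def [symmetric] csqrt_min_max(2)[OF b0] D_def T_def w_def by (simp add: mult_ac)
  have e: "0 < e" "e < 1"
  proof -
    have "inverse e > 1" using E_gt_1 E by simp
    then show "0 < e" "e < 1" by (simp_all add: one_less_inverse_iff)
  qed
  have w1: "w \<noteq> 1" using e(1) by (auto simp: e_def S_def)
  have "1 + csqrt w \<noteq> 0"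
  proof
    assume "1 + csqrt w = 0"
    then have "1 + Re (csqrt w) = 0"
      by (metis one_complex.sel(1) plus_complex.sel(1) zero_complex.sel(1))
    then show False using Re_csqrt[of w] by linarith
  qed
  then have T: "T > 0" using b0 by (simp add: T_def)
  have Q0: "Q > 0" unfolding Q using D T g(2) by simp
  have cond: "x * DN m d n r < Cn * D ^ r"
    if "x \<in> {1, hypG \<nu> r, hypH \<nu> r}" for x r
  proof -
    have "Max {1, Gamma (1 - real m / real n) * fact r / Gamma (real r + 1 - real m / real n),
            real n * Gamma (real r + 1 + real m / real n) / (real m * Gamma (real m / real n) * fact r)}
       = Max {1, hypG \<nu> r, hypH \<nu> r}"
      using mn \<nu> by (simp add: hypG_Gamma hypH_Gamma \<nu>_def)
    then have "Max {1, hypG \<nu> r, hypH \<nu> r} * DN m d n r < Cn * D ^ r"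
      using Cn_Dn[of r] by (simp add: DN_def D_def)
    moreover have "x * DN m d n r \<le> Max {1, hypG \<nu> r, hypH \<nu> r} * DN m d n r"
      using that DN_pos[OF mn(1,2), of d r] by (intro mult_right_mono Max_ge) auto
    ultimately show ?thesis by simp
  qed
  \<comment> \<open>\<open>D / N * X 1\<close> is a positive integer and \<open>X 1\<close> grows like \<open>4 ^ r\<close>\<close>
  have D4: "1 \<le> 4 * D"
  proof (rule ge_1_if_powers_bounded_below)
    fix r
    have "2 * r choose r \<le> 4 ^ r"
      using binomial_le_pow2[of "2 * r" r] by (simp add: power_mult)
    then have "real (2 * r choose r) \<le> real (4 ^ r)" by (rule of_nat_mono)
    then have central: "real (2 * r choose r) \<le> 4 ^ r" by simp
    have "1 \<le> DN m d n r * (hypG \<nu> r * real (2 * r choose r))"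
      using DN_lower_bound[OF mn(1,2), of d r] by (simp add: \<nu>_def)
    also have "\<dots> = (hypG \<nu> r * DN m d n r) * real (2 * r choose r)" by simp
    also have "\<dots> \<le> (Cn * D ^ r) * 4 ^ r"
      by (rule mult_mono) (use cond[of "hypG \<nu> r" r] central Cn_Dn_pos D in auto)
    finally show "1 \<le> Cn * (4 * D) ^ r" by (simp add: power_mult_distrib mult_ac)
  qed (use D in simp)
  have norm_ge: "1 \<le> norm (\<eta> * b / g\<^sup>2)"
  proof (rule ge_1_if_powers_bounded_below)
    fix r
    \<comment> \<open>The first factor is a power of the norm of \<eta> and the second is in K by
      assumption. Regrouped with \<open>\<eta> / g\<close> and \<open>b / g\<close>, the product is
      an algebraic integer, so its modulus is at least 1.\<close>
    define z where "z = (\<eta> * b) ^ r * (hs r / g ^ r)\<^sup>2"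
    have z: "z = (\<eta> / g) ^ r * (b / g) ^ r * (hs r)\<^sup>2"
      by (simp add: z_def power_mult_distrib power_divide power2_eq_square)
    have "z \<in> K" unfolding z_def b_def by (rule KD(4)[OF KD(9)[OF norm_in_K[OF eta(1)]] KD(9)[OF hs(3)]])
    moreover have "algebraic_int z"
      unfolding z b_def using g(3,4) hs(2) by (intro algebraic_int_mult algebraic_int_power)
    moreover have "z \<noteq> 0" using eta(3) b0 hs(1)[of r] g(2) by (simp add: z_def)
    ultimately have "1 \<le> norm z" using algebraic_int_norm_ge_1[OF assms(4)] by blast
    also have "norm z = (norm (hs r))\<^sup>2 * norm (\<eta> * b / g\<^sup>2) ^ r"
      by (simp add: z norm_mult norm_power norm_divide power_divide power_mult_distrib power2_eq_square)
    also have "\<dots> \<le> h\<^sup>2 * norm (\<eta> * b / g\<^sup>2) ^ r"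
      using hs(4)[of r] by (intro mult_right_mono power_mono) auto
    finally show "1 \<le> h\<^sup>2 * norm (\<eta> * b / g\<^sup>2) ^ r" .
  qed simp
  have w_cases: "(\<exists>t. w = of_real t \<and> 0 < t \<and> t < 1) \<or> norm w = 1"
    using eta_ratio by (auto simp: w_def b_def)
  \<comment> \<open>the bound for \<open>Y\<close> fails for small \<open>w\<close>, but \<open>E > 1\<close>, \<open>1 \<le> 4 * D\<close> and \<open>norm_ge\<close> exclude these\<close>
  have w_cases': "(\<exists>t. w = of_real t \<and> 1 / 36 \<le> t \<and> t < 1) \<or> norm w = 1"
    using w_cases
  proof (elim disjE exE conjE)
    fix t :: real
    assume t: "w = of_real t" "0 < t" "t < 1"
    define y where "y = sqrt t"
    have y: "0 < y" "y\<^sup>2 = t" using t by (simp_all add: y_def)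
    have "csqrt w = of_real y" using t by (simp add: y_def)
    then have S': "S = norm b * (1 - y)\<^sup>2" by (simp add: S_def norm_1_minus_of_real)
    define B where "B = norm b / norm g"
    have B: "B > 0" using b0 g(2) by (simp add: B_def)
    have "norm (\<eta> * b / g\<^sup>2) = (B * y)\<^sup>2"
      using t y(2) unfolding \<eta>_eq B_def
      by (simp add: norm_mult norm_divide norm_power power2_eq_square mult_ac)
    then have By: "1 \<le> B * y" using norm_ge B y(1) power2_le_imp_le[of 1 "B * y"] by simp
    have "1 / 4 * (B * (1 - y)\<^sup>2) \<le> D * (B * (1 - y)\<^sup>2)"
      using D4 B by (intro mult_right_mono) auto
    also have "\<dots> = e" by (simp add: e_def S' B_def)
    finally have "B * (1 - y)\<^sup>2 < 4" using e(2) by simp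
    then have "(B * (1 - y)\<^sup>2) * y < 4 * y" using y(1) by (intro mult_strict_right_mono)
    moreover have "1 * (1 - y)\<^sup>2 \<le> (B * y) * (1 - y)\<^sup>2" by (intro mult_right_mono By) simp
    ultimately have lt: "(1 - y)\<^sup>2 < 4 * y" by (simp add: mult_ac)
    \<comment> \<open>The threshold just suffices: below 1/6 the left side of \<open>lt\<close> is
      at least 25/36, while the right side is less than 24/36.\<close>
    have "1 / 6 \<le> y"
    proof (rule ccontr)
      assume "\<not> 1 / 6 \<le> y"
      then have y6: "y < 1 / 6" by simp
      then have "(5 / 6)\<^sup>2 \<le> (1 - y)\<^sup>2" by (intro power_mono) auto
      then have "25 / 36 < 4 * y" using lt by (simp add: power2_eq_square)
      then show False using y6 by simp
    qed
    then have "(1 / 6)\<^sup>2 \<le> y\<^sup>2" by (intro power_mono) auto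
    then have "1 / 36 \<le> t" unfolding y(2) by (simp add: power2_eq_square)
    with t show ?thesis by blast
  qed simp

  \<comment> \<open>Integrality and conjugation of the homogenised values\<close>
  define hX where "hX r = hypX \<nu> r w" for r
  define hY where "hY r = hypY \<nu> r w" for r
  define U where "U r = b ^ r * hX r" for r
  define V where "V r = b ^ r * hY r" for r
  have UV: "U r \<in> L" "V r \<in> L" "\<sigma> (U r) = V r" "\<sigma> (V r) = U r" for r
    using \<sigma>_homogeneous_hyp[OF eta(1), where m = m and n = n and r = r] b0
    by (simp_all add: U_def V_def hX_def hY_def w_def b_def \<nu>_def)
  have int_UV: "algebraic_int (of_real (DN m d n r) * U r / g ^ r)" "algebraic_int (of_real (DN m d n r) * V r / g ^ r)" for r
  proof -
    show "algebraic_int (of_real (DN m d n r) * U r / g ^ r)"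
      unfolding U_def hX_def w_def \<nu>_def
      using b0 g(2,4) d(1,2) by (intro DN_homogeneous_algebraic_int mn) (auto simp: b_def)
    \<comment> \<open>\<open>V r\<close> is \<open>U r\<close> with \<eta> and its conjugate
      exchanged, so the same integrality lemma applies.\<close>
    have "V r = \<eta> ^ r * hypX (real m / real n) r (b / \<eta>)"
      unfolding V_def hY_def hypY_eq_hypX_inverse[OF w0]
      unfolding \<nu>_def w_def using b0 by (simp add: power_divide)
    moreover have "(\<eta> - b) / (of_nat d * g) = - ((\<sigma> \<eta> - \<eta>) / (of_nat d * g))"
      by (simp add: b_def minus_divide_left)
    then have "algebraic_int ((\<eta> - b) / (of_nat d * g))" using d(2) by simp
    ultimately show "algebraic_int (of_real (DN m d n r) * V r / g ^ r)"
      using eta(3) g(2,3) d(1) by (auto intro!: DN_homogeneous_algebraic_int mn)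
  qed
  \<comment> \<open>This multiplier lies in K and thus commutes with \<sigma>, although
    \<open>hs r\<close> and \<open>g\<close> by themselves may lie outside L.\<close>
  define k where "k r = of_real (DN m d n r) * hs r / g ^ r" for r
  have kK: "k r \<in> K" for r
  proof -
    have "complex_of_real (DN m d n r) \<in> \<rat>" by (simp add: DN_def)
    then have "of_real (DN m d n r) * (hs r / g ^ r) \<in> K"
      using complex_subfield_Rats[OF K] hs(3) by (intro KD(4))
    then show ?thesis by (simp add: k_def)
  qed
  have k0: "k r \<noteq> 0" for r
    using DN_pos[OF mn(1,2), of d r] hs(1)[of r] g(2) by (simp add: k_def)
  have nk: "norm (k r) \<le> DN m d n r * h / norm g ^ r" for r
    using DN_pos[OF mn(1,2), of d r] hs(4)[of r]
    by (simp add: k_def norm_mult norm_divide norm_power divide_right_mono mult_left_mono)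
  have s: "s \<in> K" "s * s = 1" "algebraic_int s" "norm s = 1" using sign KD(2,6) by auto

  \<comment> \<open>The second summand is \<open>s\<close> times the conjugate of the first. Since
    \<open>s * s = 1\<close>, applying \<sigma> multiplies the whole expression by
    \<open>s\<close>.\<close>
  define A where "A r x = k r * (x * U r + s * \<sigma> x * V r)" for r x
  have A_L: "A r x \<in> L" and A_\<sigma>: "\<sigma> (A r x) = s * A r x" if x: "x \<in> L" for r x
  proof -
    have mem: "x * U r \<in> L" "s * \<sigma> x \<in> L" "s * \<sigma> x * V r \<in> L" "x * U r + s * \<sigma> x * V r \<in> L"
      using x UV \<sigma>_in KL[OF s(1)] by (auto intro!: LD(3,4))
    then show "A r x \<in> L" unfolding A_def using KL[OF kK] by (intro LD(4))
    have "\<sigma> (A r x) = k r * (\<sigma> x * V r + s * x * U r)"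
      unfolding A_def using mem x UV KL[OF kK] KL[OF s(1)] \<sigma>_in
      by (simp add: \<sigma>_mult \<sigma>_add \<sigma>_K[OF kK] \<sigma>_K[OF s(1)] \<sigma>_invol)
    also have "\<dots> = k r * ((s * s) * (\<sigma> x * V r) + s * x * U r)" unfolding s(2) by simp
    also have "\<dots> = s * A r x" unfolding A_def by (simp add: algebra_simps)
    finally show "\<sigma> (A r x) = s * A r x" .
  qed
  have A_int: "algebraic_int (A r x)" if x: "x \<in> L" "algebraic_int x" for r x
  proof -
    have eq: "A r x = x * (hs r * (of_real (DN m d n r) * U r / g ^ r)) +
        s * \<sigma> x * (hs r * (of_real (DN m d n r) * V r / g ^ r))"
      by (simp add: A_def k_def algebra_simps add_divide_distrib)
    show ?thesis
      unfolding eq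
      by (intro algebraic_int_add algebraic_int_mult x s(3) int_UV hs(2) \<sigma>_algebraic_int)
  qed
  have norm_ge_1: "1 \<le> norm z" if z: "z \<in> L" "\<sigma> z = s * z" "algebraic_int z" "z \<noteq> 0" for z
  proof -
    have "\<sigma> (z * z) = (s * s) * (z * z)" using z by (simp add: \<sigma>_mult)
    then have "z * z \<in> K" using s(2) z LD(4) by (intro fixed_imp_K) auto
    then have "1 \<le> norm (z * z)"
      using z by (intro algebraic_int_norm_ge_1[OF assms(4)]) (auto intro: algebraic_int_mult)
    then have "1\<^sup>2 \<le> (norm z)\<^sup>2" by (simp add: norm_mult power2_eq_square)
    then show ?thesis by (rule power2_le_imp_le) simp
  qed

  \<comment> \<open>The approximations to \<alpha>\<close>
  define P where "P r = A r \<beta>" for r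
  define R where "R r = A r \<gamma>" for r
  have det: "P r * R (Suc r) - P (Suc r) * R r \<noteq> 0" for r
  proof -
    \<comment> \<open>Up to the scalar \<open>k r * b ^ r\<close>, the pair of \<open>P r\<close>
      and \<open>R r\<close> is the image of the pair of \<open>hX r\<close> and \<open>hY r\<close>
      under one fixed matrix. Its determinant \<open>s * (\<beta> * \<sigma> \<gamma> - \<gamma> *
      \<sigma> \<beta>)\<close> splits off.\<close>
    have "P r * R (Suc r) - P (Suc r) * R r =
      k r * k (Suc r) * b ^ r * b ^ Suc r * s * (\<beta> * \<sigma> \<gamma> - \<gamma> * \<sigma> \<beta>) * (hX r * hY (Suc r) - hX (Suc r) * hY r)"
      by (simp add: P_def R_def A_def U_def V_def algebra_simps)
    moreover have "hX r * hY (Suc r) - hX (Suc r) * hY r \<noteq> 0"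
      unfolding hX_def hY_def by (rule hyp_determinant_nonzero[OF \<nu> w1])
    ultimately show ?thesis using k0 b0 s(2) nondegenerate by auto
  qed
  have det_ge: "1 \<le> norm (P r * R (Suc r) - P (Suc r) * R r)" for r
  proof -
    define z where "z = P r * R (Suc r) - P (Suc r) * R r"
    have mem: "P i \<in> L" "R i \<in> L" "\<sigma> (P i) = s * P i" "\<sigma> (R i) = s * R i"
      "algebraic_int (P i)" "algebraic_int (R i)" for i
      using beta gamma A_L A_\<sigma> A_int by (simp_all add: P_def R_def)
    have \<sigma>_PR: "\<sigma> (P i * R j) = P i * R j" for i j
    proof -
      have "\<sigma> (P i * R j) = (s * P i) * (s * R j)"
        unfolding \<sigma>_mult[OF mem(1) mem(2)] mem(3,4) ..
      also have "\<dots> = (s * s) * (P i * R j)" by (simp only: mult_ac)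
      finally show ?thesis by (simp only: s(2) mult_1_left)
    qed
    have PR_L: "P i * R j \<in> L" for i j using mem by (intro LD(4))
    have "\<sigma> z = \<sigma> (P r * R (Suc r) + - (P (Suc r) * R r))" by (simp add: z_def)
    also have "\<dots> = \<sigma> (P r * R (Suc r)) + - \<sigma> (P (Suc r) * R r)"
      unfolding \<sigma>_add[OF PR_L LD(6)[OF PR_L]] \<sigma>_minus[OF PR_L] ..
    finally have "\<sigma> z = z" unfolding \<sigma>_PR z_def by simp
    moreover have "z \<in> L" unfolding z_def using mem by (intro LD(4,5))
    ultimately have "z \<in> K" by (intro fixed_imp_K)
    moreover have "algebraic_int z"
      unfolding z_def using mem by (intro algebraic_int_diff algebraic_int_mult)
    ultimately show ?thesis
      using algebraic_int_norm_ge_1[OF assms(4)] det[of r] unfolding z_def by blast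
  qed

  \<comment> \<open>Doubled by \<open>approximation_gap\<close>, these constants produce the
    coefficients 4 and 5 of \<open>c\<close>.\<close>
  define k1 where "k1 = 2 * h * (norm \<gamma> + norm (\<sigma> \<gamma>)) * Cn"
  define l1 where "l1 = 5 / 2 * h * norm (1 - W) * norm (\<beta> - \<alpha> * \<gamma>) * Cn"
  have \<gamma>0: "norm \<gamma> + norm (\<sigma> \<gamma>) > 0"
  proof -
    have "\<gamma> \<noteq> 0"
    proof
      assume "\<gamma> = 0"
      then show False using denom \<sigma>_K[OF KD(1)] by simp
    qed
    then show ?thesis by (simp add: add_pos_nonneg)
  qed
  have k1: "k1 > 0" using h_pos \<gamma>0 Cn_Dn_pos by (simp add: k1_def)
  have l1: "l1 \<ge> 0" using h_pos Cn_Dn_pos by (simp add: l1_def)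
  have R_bound: "norm (R r) < k1 * Q ^ r" for r
  proof -
    define N where "N = norm (1 + csqrt w) ^ (2 * r)"
    have XY: "norm (hX r) \<le> 2 * hypG \<nu> r * N" "norm (hY r) \<le> 2 * hypG \<nu> r * N"
      unfolding hX_def hY_def N_def by (rule hypX_hypY_bound[OF \<nu> w_cases'])+
    have "norm (R r) = norm (k r) * norm (\<gamma> * U r + s * \<sigma> \<gamma> * V r)" by (simp add: R_def A_def norm_mult)
    also have "\<dots> \<le> norm (k r) * (norm \<gamma> * norm (U r) + norm (\<sigma> \<gamma>) * norm (V r))"
      using norm_triangle_ineq[of "\<gamma> * U r" "s * \<sigma> \<gamma> * V r"]
      by (intro mult_left_mono) (simp_all add: norm_mult s(4))
    also have "\<dots> \<le> (DN m d n r * h / norm g ^ r) *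
        (norm \<gamma> * (norm b ^ r * (2 * hypG \<nu> r * N)) + norm (\<sigma> \<gamma>) * (norm b ^ r * (2 * hypG \<nu> r * N)))"
      using nk[of r] DN_pos[OF mn(1,2), of d r] h_pos XY
      by (intro mult_mono add_mono mult_left_mono) (auto simp: U_def V_def norm_mult norm_power intro!: mult_left_mono)
    also have "\<dots> = (hypG \<nu> r * DN m d n r) * (2 * h * (norm \<gamma> + norm (\<sigma> \<gamma>)) * (norm b ^ r * N / norm g ^ r))"
      by (simp add: algebra_simps add_divide_distrib)
    also have "norm b ^ r * N / norm g ^ r = (T / norm g) ^ r"
      by (simp add: T_def N_def power_divide power_mult_distrib power_mult)
    also have "(hypG \<nu> r * DN m d n r) * (2 * h * (norm \<gamma> + norm (\<sigma> \<gamma>)) * (T / norm g) ^ r) <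
      (Cn * D ^ r) * (2 * h * (norm \<gamma> + norm (\<sigma> \<gamma>)) * (T / norm g) ^ r)"
      using h_pos \<gamma>0 T g(2) by (intro mult_strict_right_mono cond mult_pos_pos) auto
    also have "\<dots> = k1 * (D * (T / norm g)) ^ r"
      unfolding power_mult_distrib k1_def by (simp only: mult_ac)
    finally show ?thesis by (simp add: Q)
  qed
  have rem: "norm (R r * \<alpha> - P r) \<le> l1 / E ^ r" for r
  proof -
    have "\<alpha> * (\<gamma> * W + s * \<sigma> \<gamma>) = \<beta> * W + s * \<sigma> \<beta>"
      using alpha denom unfolding W by simp
    then have *: "\<alpha> * (s * \<sigma> \<gamma>) = \<beta> * W + s * \<sigma> \<beta> - \<alpha> * (\<gamma> * W)" by (simp add: algebra_simps)
    \<comment> \<open>By the defining equation of \<alpha>, the coefficient of \<open>hY r\<close>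
      is \<open>- W\<close> times that of \<open>hX r\<close>, so exactly the hypergeometric
      remainder appears.\<close>
    have "R r * \<alpha> - P r = k r * b ^ r * ((\<alpha> * \<gamma> - \<beta>) * hX r + (\<alpha> * (s * \<sigma> \<gamma>) - s * \<sigma> \<beta>) * hY r)"
      by (simp add: P_def R_def A_def U_def V_def algebra_simps)
    also have "\<dots> = k r * b ^ r * (- (\<beta> - \<alpha> * \<gamma>) * (hX r - W * hY r))"
      unfolding * by (simp add: algebra_simps)
    finally have "norm (R r * \<alpha> - P r) = norm (k r) * norm b ^ r * (norm (\<beta> - \<alpha> * \<gamma>) * norm (hX r - W * hY r))"
      by (simp only: norm_mult norm_power norm_minus_cancel)
    also have "\<dots> \<le> (DN m d n r * h / norm g ^ r) * norm b ^ r * (norm (\<beta> - \<alpha> * \<gamma>) *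
        (5 / 2 * hypH \<nu> r * norm (1 - W) * norm (1 - csqrt w) ^ (2 * r)))"
      unfolding hX_def hY_def W_def
      using DN_pos[OF mn(1,2), of d r] h_pos
      by (intro mult_mono nk order.refl hyp_remainder[OF \<nu> w_cases]) auto
    also have "\<dots> = (hypH \<nu> r * DN m d n r) * (5 / 2 * h * norm (1 - W) * norm (\<beta> - \<alpha> * \<gamma>) *
        (norm b ^ r * norm (1 - csqrt w) ^ (2 * r) / norm g ^ r))"
    proof -
      have "(d' * h' / g') * b' * (x' * (f' * H' * y' * n')) = (H' * d') * (f' * h' * y' * x' * (b' * n' / g'))"
        for d' h' g' b' x' f' H' y' n' :: real
        by (simp add: mult_ac)
      then show ?thesis .
    qed
    also have "norm b ^ r * norm (1 - csqrt w) ^ (2 * r) / norm g ^ r = (S / norm g) ^ r"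
      by (simp add: S_def power_divide power_mult_distrib power_mult)
    also have "(hypH \<nu> r * DN m d n r) * (5 / 2 * h * norm (1 - W) * norm (\<beta> - \<alpha> * \<gamma>) * (S / norm g) ^ r)
      \<le> (Cn * D ^ r) * (5 / 2 * h * norm (1 - W) * norm (\<beta> - \<alpha> * \<gamma>) * (S / norm g) ^ r)"
      using h_pos cond[of "hypH \<nu> r" r] by (intro mult_right_mono mult_nonneg_nonneg) (auto simp: S_def)
    also have "\<dots> = l1 * (D * (S / norm g)) ^ r"
      unfolding power_mult_distrib l1_def by (simp only: mult_ac)
    also have "\<dots> = l1 / E ^ r"
    proof -
      have "D * (S / norm g) = e" by (simp add: e_def)
      then show ?thesis unfolding E by (simp only: power_inverse divide_inverse inverse_inverse_eq)
    qed
    finally show ?thesis .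
  qed

  \<comment> \<open>The gap argument and the final constant\<close>
  have "E \<le> Q"
    using E_gt_1 Q0 by (intro approximation_determinant_bound[OF _ _ less_imp_le[OF R_bound] rem det_ge]) auto
  then have Q1: "Q \<ge> 1" using E_gt_1 by simp
  have q1: "norm q \<ge> 1" using algebraic_int_norm_ge_1[OF assms(4)] pq by blast
  have gap: "norm (\<alpha> - p / q) > 1 / (2 * k1 * Q * max E (2 * l1 * E) powr \<kappa> * norm q powr (\<kappa> + 1))"
  proof (rule approximation_gap[OF E_gt_1 Q1 kappa q1 R_bound rem])
    fix r
    show "P r * R (Suc r) \<noteq> P (Suc r) * R r" using det[of r] by auto
    assume ne: "P r * q \<noteq> R r * p"
    define z where "z = P r * q - R r * p"
    have mem: "P r \<in> L" "R r \<in> L" "\<sigma> (P r) = s * P r" "\<sigma> (R r) = s * R r"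
      "algebraic_int (P r)" "algebraic_int (R r)"
      using beta gamma A_L A_\<sigma> A_int by (simp_all add: P_def R_def)
    note pqL = KL[OF pq(1)] KL[OF pq(2)]
    have mem': "P r * q \<in> L" "R r * p \<in> L" using mem pqL by (auto intro!: LD(4))
    have "\<sigma> z = \<sigma> (P r * q + - (R r * p))" by (simp add: z_def)
    also have "\<dots> = \<sigma> (P r * q) + - \<sigma> (R r * p)"
      unfolding \<sigma>_add[OF mem'(1) LD(6)[OF mem'(2)]] \<sigma>_minus[OF mem'(2)] ..
    also have "\<dots> = (s * P r) * q + - ((s * R r) * p)"
      unfolding \<sigma>_mult[OF mem(1) pqL(2)] \<sigma>_mult[OF mem(2) pqL(1)] \<sigma>_K[OF pq(1)] \<sigma>_K[OF pq(2)] mem(3,4) ..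
    also have "\<dots> = s * z" by (simp add: z_def right_diff_distrib mult.assoc)
    finally have "\<sigma> z = s * z" .
    moreover have "z \<in> L" unfolding z_def using mem' by (rule LD(5))
    moreover have "algebraic_int z"
      unfolding z_def using mem pq by (intro algebraic_int_diff algebraic_int_mult)
    ultimately show "1 \<le> norm (P r * q - R r * p)" using norm_ge_1 ne unfolding z_def by simp
  qed
  have \<tau>: "norm (csqrt \<tau>) \<ge> 1"
    by (rule csqrt_generator_norm_ge_1[OF quadratic_extension_axioms assms(4) tau_Rats tau_imag])
  have \<kappa>: "\<kappa> \<ge> 0" unfolding kappa using E_gt_1 Q1 by simp
  define M where "M = max E (2 * l1 * E)"
  define M' where "M' = max E (norm (csqrt \<tau>) * (2 * l1 * E))"
  \<comment> \<open>Inserting \<open>norm (csqrt \<tau>) >= 1\<close> both inside the maximum and in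
    front turns the constant of the gap argument into \<open>c\<close>. The former enlarges the
    constant because \<kappa> is nonnegative.\<close>
  have "1 * (2 * l1 * E) \<le> norm (csqrt \<tau>) * (2 * l1 * E)"
    using \<tau> l1 E_gt_1 by (intro mult_right_mono) auto
  then have "M \<le> M'" by (simp add: M_def M'_def max_def)
  moreover have "M > 0" using E_gt_1 by (simp add: M_def)
  ultimately have "M powr \<kappa> \<le> M' powr \<kappa>" using \<kappa> by (intro powr_mono2) auto
  then have "1 * (2 * k1 * Q * M powr \<kappa>) \<le> norm (csqrt \<tau>) * (2 * k1 * Q * M' powr \<kappa>)"
    using \<tau> k1 Q0 by (intro mult_mono) auto
  also have "norm (csqrt \<tau>) * (2 * k1 * Q * M' powr \<kappa>) = c"
    unfolding c_eq W M'_def l1_def k1_def by (simp add: mult_ac)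
  finally have "2 * k1 * Q * M powr \<kappa> * norm q powr (\<kappa> + 1) \<le> c * norm q powr (\<kappa> + 1)"
    by (intro mult_right_mono) auto
  moreover have "2 * k1 * Q * M powr \<kappa> * norm q powr (\<kappa> + 1) > 0"
    using k1 Q0 \<open>M > 0\<close> pq(5) by (intro mult_pos_pos) auto
  ultimately have "1 / (c * norm q powr (\<kappa> + 1)) \<le> 1 / (2 * k1 * Q * M powr \<kappa> * norm q powr (\<kappa> + 1))"
    by (intro frac_le) simp_all
  with gap show ?thesis unfolding M_def by (rule le_less_trans[rotated])
qed

end
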